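(* Let $G$ and $H$ be finite groups with $H$ acting on $G$ by automorphisms, written $(h,g)\mapsto {}^hg$. Let $R$ be either $\mathbb{Z}$ or a field of characteristic $p>0$ with $p$ dividing $|G|$. Let $g_1,\ldots,g_t\in G$ be representatives of the orbits of $H$ on $G$, let $H_i=\{h\in H : {}^hg_i=g_i\}$, and let $\psi_i=\mathrm{cor}^H_{H_i}\circ\theta_{g_i}^*:\widehat{\mathrm{H}}^*(H_i,R)\to\widehat{\mathrm{H}}^*(H,RG)$ for $1\le i\le t$. Fix $i,j\in\{1,\ldots,t\}$ and let $D$ be a set of double coset representatives for $H_i\backslash H/H_j$. For each $x\in D$ let $k=k(x)$ be the unique index for which there exists $y\in H$ with $$g_k={}^y g_i\;{}^{yx}g_j \quad(\text{product in } G),$$ choose $y=y(x)\in H$ satisfying this equation, and put $V=V(x)={}^{yx}H_j\cap{}^yH_i$, which is a subgroup of $H_k$. Then for all $\alpha\in\widehat{\mathrm{H}}^*(H_i,R)$ and $\beta\in\widehat{\mathrm{H}}^*(H_j,R)$, $$\psi_i(\alpha)\smile\psi_j(\beta)=\sum_{x\in D}\psi_{k}\Big(\mathrm{cor}^{H_k}_{V}\big(\mathrm{res}^{{}^yH_i}_{V}\,y^*\alpha\;\smile\;\mathrm{res}^{{}^{yx}H_j}_{V}\,(yx)^*\beta\big)\Big)$$ in $\widehat{\mathrm{H}}^*(H,RG)$.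
   Context: For a finite group $K$, a complete resolution of the trivial $RK$-module $R$ is an exact complex $\mathbb{P}=\{P_n\}_{n\in\mathbb{Z}}$ of finitely generated projective $RK$-modules such that $\mathrm{Hom}_{RK}(\mathbb{P},RK)$ is exact and there are a projective resolution $\mathbb{Q}\to R$ and a chain map $\mathbb{P}\to\mathbb{Q}$ that is bijective in degrees $\ge 0$ and $0$ in negative degrees. For a left $RK$-module $M$, Tate cohomology is $\widehat{\mathrm{H}}^n(K,M)=\widehat{\mathrm{Ext}}^n_{RK}(R,M)=\mathrm{H}^n(\mathrm{Hom}_{RK}(\mathbb{P},M))$ for all $n\in\mathbb{Z}$, and $\widehat{\mathrm{H}}^*(K,M)=\bigoplus_{n\in\mathbb{Z}}\widehat{\mathrm{H}}^n(K,M)$. It carries the standard cup product $\widehat{\mathrm{H}}^*(K,M)\otimes\widehat{\mathrm{H}}^*(K,M')\to\widehat{\mathrm{H}}^*(K,M\otimes_R M')$. If $M$ is a ring with $K$ acting by ring automorphisms, composing with the multiplication of $M$ makes $\widehat{\mathrm{H}}^*(K,M)$ a graded ring. Here $R$ is the trivial module and $RG$ is an $RH$-module by linearly extending the action of $H$ on $G$. For subgroups $L\le K\le H$ and an $RH$-module $N$, computing with an $RH$-complete resolution $\mathbb{P}$ of $R$ (restricted to subgroups): $\mathrm{res}^K_L:\widehat{\mathrm{H}}^*(K,N)\to\widehat{\mathrm{H}}^*(L,N)$ is induced by the inclusion $\mathrm{Hom}_{RK}(\mathbb{P},N)\subset\mathrm{Hom}_{RL}(\mathbb{P},N)$; $\mathrm{cor}^K_L:\widehat{\mathrm{H}}^*(L,N)\to\widehat{\mathrm{H}}^*(K,N)$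 is induced by $(\mathrm{cor}^K_Lf)(p)=\sum_{u}u f(u^{-1}p)$, with $u$ running over left coset representatives of $L$ in $K$; for $h\in H$, $h^*:\widehat{\mathrm{H}}^*(L,N)\to\widehat{\mathrm{H}}^*({}^hL,N)$, where ${}^hL=hLh^{-1}$, is induced by $(h^*f)(p)=h f(h^{-1}p)$. For $g\in G$ and a subgroup $V\subseteq \mathrm{Stab}_H(g)$, $\theta_g^*:\widehat{\mathrm{H}}^*(V,R)\to\widehat{\mathrm{H}}^*(V,RG)$ is induced by the $RV$-module homomorphism $\theta_g:R\to RG$, $r\mapsto rg$. *)

theory Defs
  imports "HOL-Algebra.IntRing" "HOL-Algebra.Left_Coset" "HOL-Algebra.Group_Action" "HOL-Algebra.Multiplicative_Group"
begin

section \<open>Modules over a group ring\<close>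

text \<open>
  A left \<open>RH\<close>-module is an \<open>R\<close>-module with an action of \<open>H\<close> by \<open>R\<close>-linear maps; restriction to a
  subgroup \<open>K\<close> is expressed by only asking for compatibility with the elements of \<open>K\<close>. The record
  inherits the fields \<open>mult\<close> and \<open>one\<close> from the type of rings; they only matter for coefficient
  modules that are rings, and are \<open>undefined\<close> in constructions that carry no ring structure.
\<close>

record ('r, 'm, 'h) rg_module = "('r, 'm) module" +
  act :: "'h \<Rightarrow> 'm \<Rightarrow> 'm"

definition rg_module ::
    "'r ring \<Rightarrow> 'h monoid \<Rightarrow> ('r, 'm, 'h) rg_module \<Rightarrow> bool" where
  "rg_module R H M \<longleftrightarrow>
     module R M \<and> group_action H (carrier M) (act M) \<and>
     (\<forall>h\<in>carrier H. \<forall>x\<in>carrier M. \<forall>y\<in>carrier M.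
        act M h (x \<oplus>\<^bsub>M\<^esub> y) = act M h x \<oplus>\<^bsub>M\<^esub> act M h y) \<and>
     (\<forall>h\<in>carrier H. \<forall>r\<in>carrier R. \<forall>x\<in>carrier M.
        act M h (r \<odot>\<^bsub>M\<^esub> x) = r \<odot>\<^bsub>M\<^esub> act M h x)"

text \<open>\<open>rg_hom R K M N\<close> is \<open>Hom\<^bsub>RK\<^esub>(M, N)\<close>.\<close>

definition rg_hom ::
    "'r ring \<Rightarrow> 'h set \<Rightarrow> ('r, 'm, 'h) rg_module \<Rightarrow> ('r, 'n, 'h) rg_module \<Rightarrow> ('m \<Rightarrow> 'n) set" where
  "rg_hom R K M N =
     {f \<in> carrier M \<rightarrow>\<^sub>E carrier N.
        (\<forall>x\<in>carrier M. \<forall>y\<in>carrier M. f (x \<oplus>\<^bsub>M\<^esub> y) = f x \<oplus>\<^bsub>N\<^esub> f y) \<and>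
        (\<forall>r\<in>carrier R. \<forall>x\<in>carrier M. f (r \<odot>\<^bsub>M\<^esub> x) = r \<odot>\<^bsub>N\<^esub> f x) \<and>
        (\<forall>k\<in>K. \<forall>x\<in>carrier M. f (act M k x) = act N k (f x))}"

definition hom_module ::
    "'r ring \<Rightarrow> 'h set \<Rightarrow> ('r, 'm, 'h) rg_module \<Rightarrow> ('r, 'n, 'h) rg_module \<Rightarrow> ('r, 'm \<Rightarrow> 'n) module" where
  "hom_module R K M N =
     \<lparr>carrier = rg_hom R K M N, mult = undefined, one = undefined,
      zero = (\<lambda>x\<in>carrier M. \<zero>\<^bsub>N\<^esub>),
      add = (\<lambda>f g. \<lambda>x\<in>carrier M. f x \<oplus>\<^bsub>N\<^esub> g x),
      smult = (\<lambda>r f. \<lambda>x\<in>carrier M. r \<odot>\<^bsub>N\<^esub> f x)\<rparr>"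

definition trivial_module :: "'r ring \<Rightarrow> ('r, 'r, 'h) rg_module" where
  "trivial_module R =
     \<lparr>carrier = carrier R, mult = mult R, one = one R, zero = zero R, add = add R,
      smult = mult R, act = (\<lambda>h. \<lambda>r\<in>carrier R. r)\<rparr>"

text \<open>
  \<open>group_ring R G H a\<close> is the group ring \<open>RG\<close> of a finite group \<open>G\<close>, with convolution product,
  where \<open>H\<close> acts by the linear extension of the action \<open>a\<close> on the set \<open>G\<close>: the coefficient of
  \<open>h \<cdot> f\<close> at \<open>x\<close> is the coefficient of \<open>f\<close> at \<open>h\<inverse> \<cdot> x\<close>.
\<close>

definition group_ring ::
    "'r ring \<Rightarrow> 'g monoid \<Rightarrow> 'h monoid \<Rightarrow> ('h \<Rightarrow> 'g \<Rightarrow> 'g) \<Rightarrow> ('r, 'g \<Rightarrow> 'r, 'h) rg_module" where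
  "group_ring R G H a =
     \<lparr>carrier = carrier G \<rightarrow>\<^sub>E carrier R,
      mult = (\<lambda>f f'. \<lambda>x\<in>carrier G. \<Oplus>\<^bsub>R\<^esub>y\<in>carrier G. f y \<otimes>\<^bsub>R\<^esub> f' (inv\<^bsub>G\<^esub> y \<otimes>\<^bsub>G\<^esub> x)),
      one = (\<lambda>x\<in>carrier G. if x = \<one>\<^bsub>G\<^esub> then \<one>\<^bsub>R\<^esub> else \<zero>\<^bsub>R\<^esub>),
      zero = (\<lambda>x\<in>carrier G. \<zero>\<^bsub>R\<^esub>),
      add = (\<lambda>f f'. \<lambda>x\<in>carrier G. f x \<oplus>\<^bsub>R\<^esub> f' x),
      smult = (\<lambda>r f. \<lambda>x\<in>carrier G. r \<otimes>\<^bsub>R\<^esub> f x),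
      act = (\<lambda>h. \<lambda>f\<in>carrier G \<rightarrow>\<^sub>E carrier R. \<lambda>x\<in>carrier G. f (a (inv\<^bsub>H\<^esub> h) x))\<rparr>"

definition regular_module :: "'r ring \<Rightarrow> 'h monoid \<Rightarrow> ('r, 'h \<Rightarrow> 'r, 'h) rg_module" where
  "regular_module R H = group_ring R H H (mult H)"


section \<open>Direct sums, free modules, projective modules\<close>

definition direct_sum ::
    "'i set \<Rightarrow> ('i \<Rightarrow> ('r, 'm, 'e) module_scheme) \<Rightarrow> ('r, 'i \<Rightarrow> 'm) module" where
  "direct_sum I M =
     \<lparr>carrier = {f \<in> (\<Pi>\<^sub>E i\<in>I. carrier (M i)). finite {i\<in>I. f i \<noteq> \<zero>\<^bsub>M i\<^esub>}},
      mult = undefined, one = undefined,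
      zero = (\<lambda>i\<in>I. \<zero>\<^bsub>M i\<^esub>),
      add = (\<lambda>f g. \<lambda>i\<in>I. f i \<oplus>\<^bsub>M i\<^esub> g i),
      smult = (\<lambda>r f. \<lambda>i\<in>I. r \<odot>\<^bsub>M i\<^esub> f i)\<rparr>"

definition free_rg_module ::
    "'r ring \<Rightarrow> 'h monoid \<Rightarrow> 'i set \<Rightarrow> ('r, 'i \<Rightarrow> 'h \<Rightarrow> 'r, 'h) rg_module" where
  "free_rg_module R H I =
     module.extend (direct_sum I (\<lambda>_. regular_module R H))
       (rg_module.fields
          (\<lambda>h. \<lambda>f\<in>carrier (direct_sum I (\<lambda>_. regular_module R H)).
             \<lambda>i\<in>I. act (regular_module R H) h (f i)))"

text \<open>
  Projective: a direct summand of a free module. Taking the basis inside the type of the elements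
  of \<open>M\<close> loses no generality, since \<open>M\<close> is a quotient of the free module on its own carrier.
\<close>

definition projective :: "'r ring \<Rightarrow> 'h monoid \<Rightarrow> ('r, 'm, 'h) rg_module \<Rightarrow> bool" where
  "projective R H M \<longleftrightarrow>
     (\<exists>(I :: 'm set) s p. s \<in> rg_hom R (carrier H) M (free_rg_module R H I) \<and>
        p \<in> rg_hom R (carrier H) (free_rg_module R H I) M \<and> (\<forall>x\<in>carrier M. p (s x) = x))"

definition finitely_generated :: "'r ring \<Rightarrow> 'h monoid \<Rightarrow> ('r, 'm, 'h) rg_module \<Rightarrow> bool" where
  "finitely_generated R H M \<longleftrightarrow>
     (\<exists>S. finite S \<and> S \<subseteq> carrier M \<and>
        (\<forall>N. submodule N R M \<and> (\<forall>h\<in>carrier H. \<forall>x\<in>N. act M h x \<in> N) \<and> S \<subseteq> N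
           \<longrightarrow> N = carrier M))"


section \<open>Tensor products over \<open>R\<close>\<close>

definition quotient_module ::
    "('r, 'm, 'e) module_scheme \<Rightarrow> 'm set \<Rightarrow> ('r, 'm set) module" where
  "quotient_module M N =
     \<lparr>carrier = a_rcosets\<^bsub>M\<^esub> N, mult = undefined, one = undefined,
      zero = N, add = set_add M,
      smult = (\<lambda>r X. \<Union>x\<in>X. N +>\<^bsub>M\<^esub> (r \<odot>\<^bsub>M\<^esub> x))\<rparr>"

definition submodule_span ::
    "'r ring \<Rightarrow> ('r, 'm, 'e) module_scheme \<Rightarrow> 'm set \<Rightarrow> 'm set" where
  "submodule_span R M S = \<Inter>{N. submodule N R M \<and> S \<subseteq> N}"

definition free_module :: "'r ring \<Rightarrow> 'i set \<Rightarrow> ('r, 'i \<Rightarrow> 'r) module" where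
  "free_module R I = direct_sum I (\<lambda>_. trivial_module R :: ('r, 'r, unit) rg_module)"

definition free_gen :: "'r ring \<Rightarrow> 'i set \<Rightarrow> 'i \<Rightarrow> 'i \<Rightarrow> 'r" where
  "free_gen R I i = (\<lambda>j\<in>I. if j = i then \<one>\<^bsub>R\<^esub> else \<zero>\<^bsub>R\<^esub>)"

definition bilinear_relations ::
    "'r ring \<Rightarrow> ('r, 'm, 'd) module_scheme \<Rightarrow> ('r, 'n, 'e) module_scheme \<Rightarrow> ('m \<times> 'n \<Rightarrow> 'r) set" where
  "bilinear_relations R M N =
     (let F = free_module R (carrier M \<times> carrier N);
          e = (\<lambda>m n. free_gen R (carrier M \<times> carrier N) (m, n))
      in {e (m \<oplus>\<^bsub>M\<^esub> m') n \<ominus>\<^bsub>F\<^esub> (e m n \<oplus>\<^bsub>F\<^esub> e m' n) |m m' n.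
            m \<in> carrier M \<and> m' \<in> carrier M \<and> n \<in> carrier N} \<union>
         {e m (n \<oplus>\<^bsub>N\<^esub> n') \<ominus>\<^bsub>F\<^esub> (e m n \<oplus>\<^bsub>F\<^esub> e m n') |m n n'.
            m \<in> carrier M \<and> n \<in> carrier N \<and> n' \<in> carrier N} \<union>
         {e (r \<odot>\<^bsub>M\<^esub> m) n \<ominus>\<^bsub>F\<^esub> r \<odot>\<^bsub>F\<^esub> e m n |r m n.
            r \<in> carrier R \<and> m \<in> carrier M \<and> n \<in> carrier N} \<union>
         {e m (r \<odot>\<^bsub>N\<^esub> n) \<ominus>\<^bsub>F\<^esub> r \<odot>\<^bsub>F\<^esub> e m n |r m n.
            r \<in> carrier R \<and> m \<in> carrier M \<and> n \<in> carrier N})"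

definition tensor_module ::
    "'r ring \<Rightarrow> ('r, 'm, 'd) module_scheme \<Rightarrow> ('r, 'n, 'e) module_scheme \<Rightarrow>
       ('r, ('m \<times> 'n \<Rightarrow> 'r) set) module" where
  "tensor_module R M N =
     (let F = free_module R (carrier M \<times> carrier N)
      in quotient_module F (submodule_span R F (bilinear_relations R M N)))"

definition pure_tensor ::
    "'r ring \<Rightarrow> ('r, 'm, 'd) module_scheme \<Rightarrow> ('r, 'n, 'e) module_scheme \<Rightarrow>
       'm \<Rightarrow> 'n \<Rightarrow> ('m \<times> 'n \<Rightarrow> 'r) set" where
  "pure_tensor R M N m n =
     (let F = free_module R (carrier M \<times> carrier N)
      in submodule_span R F (bilinear_relations R M N)
           +>\<^bsub>F\<^esub> free_gen R (carrier M \<times> carrier N) (m, n))"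

text \<open>
  \<open>tensor_lift M N L b\<close> is the linear map \<open>M \<otimes> N \<rightarrow> L\<close> induced by the \<open>R\<close>-bilinear map \<open>b\<close>;
  for bilinear \<open>b\<close> the image in the definition is a singleton.
\<close>

definition tensor_lift ::
    "('r, 'm, 'd) module_scheme \<Rightarrow> ('r, 'n, 'e) module_scheme \<Rightarrow> ('r, 'l, 'f) module_scheme \<Rightarrow>
       ('m \<Rightarrow> 'n \<Rightarrow> 'l) \<Rightarrow> ('m \<times> 'n \<Rightarrow> 'r) set \<Rightarrow> 'l" where
  "tensor_lift M N L b T =
     the_elem ((\<lambda>x. \<Oplus>\<^bsub>L\<^esub>z\<in>{z \<in> carrier M \<times> carrier N. x z \<odot>\<^bsub>L\<^esub> b (fst z) (snd z) \<noteq> \<zero>\<^bsub>L\<^esub>}.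
                        x z \<odot>\<^bsub>L\<^esub> b (fst z) (snd z)) ` T)"

definition tensor_map ::
    "'r ring \<Rightarrow> ('r, 'm, 'd) module_scheme \<Rightarrow> ('r, 'n, 'e) module_scheme \<Rightarrow>
       ('r, 'm2, 'd2) module_scheme \<Rightarrow> ('r, 'n2, 'e2) module_scheme \<Rightarrow>
       ('m \<Rightarrow> 'm2) \<Rightarrow> ('n \<Rightarrow> 'n2) \<Rightarrow> ('m \<times> 'n \<Rightarrow> 'r) set \<Rightarrow> ('m2 \<times> 'n2 \<Rightarrow> 'r) set" where
  "tensor_map R M N M' N' f g =
     tensor_lift M N (tensor_module R M' N') (\<lambda>m n. pure_tensor R M' N' (f m) (g n))"

text \<open>The tensor product with the diagonal action.\<close>

definition tensor ::
    "'r ring \<Rightarrow> ('r, 'm, 'h) rg_module \<Rightarrow> ('r, 'n, 'h) rg_module \<Rightarrow>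
       ('r, ('m \<times> 'n \<Rightarrow> 'r) set, 'h) rg_module" where
  "tensor R M N =
     module.extend (tensor_module R M N)
       (rg_module.fields
          (\<lambda>h. \<lambda>T\<in>carrier (tensor_module R M N). tensor_map R M N M N (act M h) (act N h) T))"


section \<open>Complete resolutions\<close>

text \<open>Homological grading: \<open>bd P n\<close> maps \<open>ob P n\<close> to \<open>ob P (n - 1)\<close>.\<close>

record ('r, 'p, 'h) rg_complex =
  ob :: "int \<Rightarrow> ('r, 'p, 'h) rg_module"
  bd :: "int \<Rightarrow> 'p \<Rightarrow> 'p"

definition chain_complex :: "'r ring \<Rightarrow> 'h monoid \<Rightarrow> ('r, 'p, 'h) rg_complex \<Rightarrow> bool" where
  "chain_complex R H P \<longleftrightarrow>
     (\<forall>n. rg_module R H (ob P n)) \<and>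
     (\<forall>n. bd P n \<in> rg_hom R (carrier H) (ob P n) (ob P (n - 1))) \<and>
     (\<forall>n. \<forall>x\<in>carrier (ob P n). bd P (n - 1) (bd P n x) = \<zero>\<^bsub>ob P (n - 2)\<^esub>)"

definition exact_at :: "('r, 'p, 'h) rg_complex \<Rightarrow> int \<Rightarrow> bool" where
  "exact_at P n \<longleftrightarrow>
     {x \<in> carrier (ob P n). bd P n x = \<zero>\<^bsub>ob P (n - 1)\<^esub>} = bd P (n + 1) ` carrier (ob P (n + 1))"

definition chain_map ::
    "'r ring \<Rightarrow> 'h monoid \<Rightarrow> ('r, 'p, 'h) rg_complex \<Rightarrow> ('r, 'q, 'h) rg_complex \<Rightarrow>
       (int \<Rightarrow> 'p \<Rightarrow> 'q) \<Rightarrow> bool" where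
  "chain_map R H P Q \<tau> \<longleftrightarrow>
     (\<forall>n. \<tau> n \<in> rg_hom R (carrier H) (ob P n) (ob Q n)) \<and>
     (\<forall>n. \<forall>x\<in>carrier (ob P n). bd Q n (\<tau> n x) = \<tau> (n - 1) (bd P n x))"

definition projective_resolution ::
    "'r ring \<Rightarrow> 'h monoid \<Rightarrow> ('r, 'q, 'h) rg_complex \<Rightarrow> ('q \<Rightarrow> 'r) \<Rightarrow> bool" where
  "projective_resolution R H Q e \<longleftrightarrow>
     chain_complex R H Q \<and>
     (\<forall>n. projective R H (ob Q n)) \<and>
     (\<forall>n<0. carrier (ob Q n) = {\<zero>\<^bsub>ob Q n\<^esub>}) \<and>
     (\<forall>n>0. exact_at Q n) \<and>
     e \<in> rg_hom R (carrier H) (ob Q 0) (trivial_module R) \<and>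
     e ` carrier (ob Q 0) = carrier R \<and>
     {x \<in> carrier (ob Q 0). e x = \<zero>\<^bsub>R\<^esub>} = bd Q 1 ` carrier (ob Q 1)"

text \<open>
  The complex \<open>Hom\<^bsub>RK\<^esub>(P, N)\<close>. No sign is put on its differential, which does not affect
  cocycles and coboundaries.
\<close>

definition cobd ::
    "('r, 'p, 'h) rg_complex \<Rightarrow> int \<Rightarrow> ('p \<Rightarrow> 'n) \<Rightarrow> 'p \<Rightarrow> 'n" where
  "cobd P n f = (\<lambda>x\<in>carrier (ob P (n + 1)). f (bd P (n + 1) x))"

definition cocycles ::
    "'r ring \<Rightarrow> ('r, 'p, 'h) rg_complex \<Rightarrow> 'h set \<Rightarrow> ('r, 'n, 'h) rg_module \<Rightarrow> int \<Rightarrow> ('p \<Rightarrow> 'n) set" where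
  "cocycles R P K N n =
     {f \<in> rg_hom R K (ob P n) N. cobd P n f = \<zero>\<^bsub>hom_module R K (ob P (n + 1)) N\<^esub>}"

definition coboundaries ::
    "'r ring \<Rightarrow> ('r, 'p, 'h) rg_complex \<Rightarrow> 'h set \<Rightarrow> ('r, 'n, 'h) rg_module \<Rightarrow> int \<Rightarrow> ('p \<Rightarrow> 'n) set" where
  "coboundaries R P K N n = cobd P (n - 1) ` rg_hom R K (ob P (n - 1)) N"

text \<open>
  A complete resolution \<open>P\<close> together with the augmentation \<open>\<epsilon> : P\<^sub>0 \<rightarrow> R\<close> that it receives from a
  projective resolution \<open>Q \<rightarrow> R\<close> with the same nonnegative part. As \<open>P\<^sub>n\<close> and \<open>Q\<^sub>n\<close> are in bijection
  for \<open>n \<ge> 0\<close>, nothing is lost by taking the elements of \<open>Q\<close> from the same type.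
\<close>

definition complete_resolution ::
    "'r ring \<Rightarrow> 'h monoid \<Rightarrow> ('r, 'p, 'h) rg_complex \<Rightarrow> ('p \<Rightarrow> 'r) \<Rightarrow> bool" where
  "complete_resolution R H P \<epsilon> \<longleftrightarrow>
     chain_complex R H P \<and>
     (\<forall>n. finitely_generated R H (ob P n) \<and> projective R H (ob P n)) \<and>
     (\<forall>n. exact_at P n) \<and>
     (\<forall>n. cocycles R P (carrier H) (regular_module R H) n
            = coboundaries R P (carrier H) (regular_module R H) n) \<and>
     (\<exists>(Q :: ('r, 'p, 'h) rg_complex) e \<tau>.
        projective_resolution R H Q e \<and> chain_map R H P Q \<tau> \<and>
        (\<forall>n\<ge>0. bij_betw (\<tau> n) (carrier (ob P n)) (carrier (ob Q n))) \<and>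
        (\<forall>n<0. \<forall>x\<in>carrier (ob P n). \<tau> n x = \<zero>\<^bsub>ob Q n\<^esub>) \<and>
        \<epsilon> = compose (carrier (ob P 0)) e (\<tau> 0))"


section \<open>Tate cohomology\<close>

definition tate ::
    "'r ring \<Rightarrow> ('r, 'p, 'h) rg_complex \<Rightarrow> 'h set \<Rightarrow> ('r, 'n, 'h) rg_module \<Rightarrow> int \<Rightarrow>
       ('r, ('p \<Rightarrow> 'n) set) module" where
  "tate R P K N n =
     quotient_module ((hom_module R K (ob P n) N)\<lparr>carrier := cocycles R P K N n\<rparr>)
       (coboundaries R P K N n)"

definition tate_class ::
    "'r ring \<Rightarrow> ('r, 'p, 'h) rg_complex \<Rightarrow> 'h set \<Rightarrow> ('r, 'n, 'h) rg_module \<Rightarrow> int \<Rightarrow>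
       ('p \<Rightarrow> 'n) \<Rightarrow> ('p \<Rightarrow> 'n) set" where
  "tate_class R P K N n f = coboundaries R P K N n +>\<^bsub>hom_module R K (ob P n) N\<^esub> f"

definition tate_total ::
    "'r ring \<Rightarrow> ('r, 'p, 'h) rg_complex \<Rightarrow> 'h set \<Rightarrow> ('r, 'n, 'h) rg_module \<Rightarrow>
       ('r, int \<Rightarrow> ('p \<Rightarrow> 'n) set) module" where
  "tate_total R P K N = direct_sum UNIV (tate R P K N)"

text \<open>
  The map into the Tate cohomology of \<open>K\<close> with coefficients in \<open>N\<close> induced by a map \<open>F\<close> of cochain
  complexes. The union is over the classes of the images of all representatives; these classes
  coincide when \<open>F\<close> respects coboundaries.
\<close>

definition tate_map ::
    "'r ring \<Rightarrow> ('r, 'p, 'h) rg_complex \<Rightarrow> 'h set \<Rightarrow> ('r, 'n, 'h) rg_module \<Rightarrow>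
       (int \<Rightarrow> ('p \<Rightarrow> 'm) \<Rightarrow> ('p \<Rightarrow> 'n)) \<Rightarrow>
       (int \<Rightarrow> ('p \<Rightarrow> 'm) set) \<Rightarrow> int \<Rightarrow> ('p \<Rightarrow> 'n) set" where
  "tate_map R P K N F \<alpha> = (\<lambda>n. \<Union>f\<in>\<alpha> n. tate_class R P K N n (F n f))"

text \<open>The map induced by a homomorphism \<open>\<theta>\<close> of coefficient modules, with target \<open>N\<close>.\<close>

definition coeff_map ::
    "'r ring \<Rightarrow> ('r, 'p, 'h) rg_complex \<Rightarrow> 'h set \<Rightarrow> ('r, 'n, 'h) rg_module \<Rightarrow> ('m \<Rightarrow> 'n) \<Rightarrow>
       (int \<Rightarrow> ('p \<Rightarrow> 'm) set) \<Rightarrow> int \<Rightarrow> ('p \<Rightarrow> 'n) set" where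
  "coeff_map R P K N \<theta> = tate_map R P K N (\<lambda>n f. compose (carrier (ob P n)) \<theta> f)"

text \<open>\<open>res\<close> has target the cohomology of \<open>L\<close>, and \<open>cor\<close> goes from \<open>L\<close> to \<open>K\<close>.\<close>

definition res ::
    "'r ring \<Rightarrow> ('r, 'p, 'h) rg_complex \<Rightarrow> 'h set \<Rightarrow> ('r, 'n, 'h) rg_module \<Rightarrow>
       (int \<Rightarrow> ('p \<Rightarrow> 'n) set) \<Rightarrow> int \<Rightarrow> ('p \<Rightarrow> 'n) set" where
  "res R P L N = tate_map R P L N (\<lambda>n f. f)"

definition cor_cochain ::
    "'h monoid \<Rightarrow> ('r, 'p, 'h) rg_complex \<Rightarrow> 'h set \<Rightarrow> 'h set \<Rightarrow> ('r, 'n, 'h) rg_module \<Rightarrow> int \<Rightarrow>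
       ('p \<Rightarrow> 'n) \<Rightarrow> 'p \<Rightarrow> 'n" where
  "cor_cochain H P K L N n f =
     (\<lambda>x\<in>carrier (ob P n). \<Oplus>\<^bsub>N\<^esub>C\<in>lcosets\<^bsub>H\<lparr>carrier := K\<rparr>\<^esub> L.
        (let u = (SOME u. u \<in> C) in act N u (f (act (ob P n) (inv\<^bsub>H\<^esub> u) x))))"

definition cor ::
    "'r ring \<Rightarrow> 'h monoid \<Rightarrow> ('r, 'p, 'h) rg_complex \<Rightarrow> 'h set \<Rightarrow> 'h set \<Rightarrow>
       ('r, 'n, 'h) rg_module \<Rightarrow> (int \<Rightarrow> ('p \<Rightarrow> 'n) set) \<Rightarrow> int \<Rightarrow> ('p \<Rightarrow> 'n) set" where
  "cor R H P K L N = tate_map R P K N (cor_cochain H P K L N)"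

definition conj_subgroup :: "'h monoid \<Rightarrow> 'h \<Rightarrow> 'h set \<Rightarrow> 'h set" where
  "conj_subgroup H h L = (h <#\<^bsub>H\<^esub> L) #>\<^bsub>H\<^esub> inv\<^bsub>H\<^esub> h"

definition conj_map ::
    "'r ring \<Rightarrow> 'h monoid \<Rightarrow> ('r, 'p, 'h) rg_complex \<Rightarrow> 'h \<Rightarrow> 'h set \<Rightarrow>
       ('r, 'n, 'h) rg_module \<Rightarrow> (int \<Rightarrow> ('p \<Rightarrow> 'n) set) \<Rightarrow> int \<Rightarrow> ('p \<Rightarrow> 'n) set" where
  "conj_map R H P h L N =
     tate_map R P (conj_subgroup H h L) N
       (\<lambda>n f. \<lambda>x\<in>carrier (ob P n). act N h (f (act (ob P n) (inv\<^bsub>H\<^esub> h) x)))"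


section \<open>Cup product\<close>

definition sign_pow :: "('m, 'e) ring_scheme \<Rightarrow> int \<Rightarrow> 'm \<Rightarrow> 'm" where
  "sign_pow M n x = (if even n then x else \<ominus>\<^bsub>M\<^esub> x)"

text \<open>
  The cup product is the one defined by a complete diagonal approximation (Brown, Cohomology of
  Groups, VI.5): an augmentation preserving \<open>RH\<close>-chain map \<open>\<Delta>\<close> from \<open>P\<close> to the completed tensor
  product of \<open>P\<close> with itself, whose degree \<open>n\<close> part is the product over all \<open>p + q = n\<close> of the
  modules \<open>P\<^sub>p \<otimes> P\<^sub>q\<close>, with differential \<open>d(x \<otimes> y) = dx \<otimes> y + (-1)\<^sup>p x \<otimes> dy\<close>. It is
  given by its components \<open>\<Delta> p q : P\<^bsub>p+q\<^esub> \<rightarrow> P\<^sub>p \<otimes> P\<^sub>q\<close>. It exists for every complete resolution, is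
  unique up to homotopy, and remains one after restriction to subgroups of \<open>H\<close>.
\<close>

definition diagonal_approximation ::
    "'r ring \<Rightarrow> 'h monoid \<Rightarrow> ('r, 'p, 'h) rg_complex \<Rightarrow> ('p \<Rightarrow> 'r) \<Rightarrow>
       (int \<Rightarrow> int \<Rightarrow> 'p \<Rightarrow> ('p \<times> 'p \<Rightarrow> 'r) set) \<Rightarrow> bool" where
  "diagonal_approximation R H P \<epsilon> \<Delta> \<longleftrightarrow>
     (\<forall>p q. \<Delta> p q \<in> rg_hom R (carrier H) (ob P (p + q)) (tensor R (ob P p) (ob P q))) \<and>
     (\<forall>p q. \<forall>x\<in>carrier (ob P (p + q + 1)).
        tensor_map R (ob P (p + 1)) (ob P q) (ob P p) (ob P q) (bd P (p + 1)) (\<lambda>y. y)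
          (\<Delta> (p + 1) q x)
        \<oplus>\<^bsub>tensor R (ob P p) (ob P q)\<^esub>
        sign_pow (tensor R (ob P p) (ob P q)) p
          (tensor_map R (ob P p) (ob P (q + 1)) (ob P p) (ob P q) (\<lambda>y. y) (bd P (q + 1))
             (\<Delta> p (q + 1) x))
        = \<Delta> p q (bd P (p + q + 1) x)) \<and>
     (\<forall>x\<in>carrier (ob P 0).
        tensor_lift (ob P 0) (ob P 0) (trivial_module R :: ('r, 'r, 'h) rg_module)
          (\<lambda>a b. \<epsilon> a \<otimes>\<^bsub>R\<^esub> \<epsilon> b) (\<Delta> 0 0 x) = \<epsilon> x)"

text \<open>
  \<open>(f \<otimes> g) \<circ> \<Delta>\<close> for cochains of degrees \<open>p\<close> and \<open>q\<close>, with the usual sign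
  \<open>(f \<otimes> g)(x \<otimes> y) = (-1)\<^bsup>deg g deg x\<^esup> f x \<otimes> g y\<close>.
\<close>

definition cup_cochain ::
    "'r ring \<Rightarrow> ('r, 'p, 'h) rg_complex \<Rightarrow> (int \<Rightarrow> int \<Rightarrow> 'p \<Rightarrow> ('p \<times> 'p \<Rightarrow> 'r) set) \<Rightarrow>
       ('r, 'm, 'h) rg_module \<Rightarrow> ('r, 'n, 'h) rg_module \<Rightarrow> int \<Rightarrow> int \<Rightarrow>
       ('p \<Rightarrow> 'm) \<Rightarrow> ('p \<Rightarrow> 'n) \<Rightarrow> 'p \<Rightarrow> ('m \<times> 'n \<Rightarrow> 'r) set" where
  "cup_cochain R P \<Delta> M N p q f g =
     (\<lambda>x\<in>carrier (ob P (p + q)).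
        sign_pow (tensor R M N) (p * q) (tensor_map R (ob P p) (ob P q) M N f g (\<Delta> p q x)))"

definition cup_homogeneous ::
    "'r ring \<Rightarrow> ('r, 'p, 'h) rg_complex \<Rightarrow> (int \<Rightarrow> int \<Rightarrow> 'p \<Rightarrow> ('p \<times> 'p \<Rightarrow> 'r) set) \<Rightarrow> 'h set \<Rightarrow>
       ('r, 'm, 'h) rg_module \<Rightarrow> ('r, 'n, 'h) rg_module \<Rightarrow> int \<Rightarrow> int \<Rightarrow>
       ('p \<Rightarrow> 'm) set \<Rightarrow> ('p \<Rightarrow> 'n) set \<Rightarrow> ('p \<Rightarrow> ('m \<times> 'n \<Rightarrow> 'r) set) set" where
  "cup_homogeneous R P \<Delta> K M N p q a b =
     (\<Union>f\<in>a. \<Union>g\<in>b. tate_class R P K (tensor R M N) (p + q) (cup_cochain R P \<Delta> M N p q f g))"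

definition cup ::
    "'r ring \<Rightarrow> ('r, 'p, 'h) rg_complex \<Rightarrow> (int \<Rightarrow> int \<Rightarrow> 'p \<Rightarrow> ('p \<times> 'p \<Rightarrow> 'r) set) \<Rightarrow> 'h set \<Rightarrow>
       ('r, 'm, 'h) rg_module \<Rightarrow> ('r, 'n, 'h) rg_module \<Rightarrow>
       (int \<Rightarrow> ('p \<Rightarrow> 'm) set) \<Rightarrow> (int \<Rightarrow> ('p \<Rightarrow> 'n) set) \<Rightarrow>
       int \<Rightarrow> ('p \<Rightarrow> ('m \<times> 'n \<Rightarrow> 'r) set) set" where
  "cup R P \<Delta> K M N \<alpha> \<beta> =
     (\<lambda>n. \<Oplus>\<^bsub>tate R P K (tensor R M N) n\<^esub>
        p\<in>{p. \<alpha> p \<noteq> \<zero>\<^bsub>tate R P K M p\<^esub> \<and> \<beta> (n - p) \<noteq> \<zero>\<^bsub>tate R P K N (n - p)\<^esub>}.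
          cup_homogeneous R P \<Delta> K M N p (n - p) (\<alpha> p) (\<beta> (n - p)))"

text \<open>The product on the Tate cohomology of \<open>K\<close> with coefficients in a ring \<open>M\<close>.\<close>

definition cup_ring ::
    "'r ring \<Rightarrow> ('r, 'p, 'h) rg_complex \<Rightarrow> (int \<Rightarrow> int \<Rightarrow> 'p \<Rightarrow> ('p \<times> 'p \<Rightarrow> 'r) set) \<Rightarrow> 'h set \<Rightarrow>
       ('r, 'm, 'h) rg_module \<Rightarrow>
       (int \<Rightarrow> ('p \<Rightarrow> 'm) set) \<Rightarrow> (int \<Rightarrow> ('p \<Rightarrow> 'm) set) \<Rightarrow> int \<Rightarrow> ('p \<Rightarrow> 'm) set" where
  "cup_ring R P \<Delta> K M \<alpha> \<beta> =
     coeff_map R P K M (tensor_lift M M M (mult M)) (cup R P \<Delta> K M M \<alpha> \<beta>)"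


section \<open>The maps \<open>\<theta>\<^sub>g\<close> and \<open>\<psi>\<close>\<close>

definition theta :: "'r ring \<Rightarrow> 'g monoid \<Rightarrow> 'g \<Rightarrow> 'r \<Rightarrow> 'g \<Rightarrow> 'r" where
  "theta R G a r = (\<lambda>x\<in>carrier G. if x = a then r else \<zero>\<^bsub>R\<^esub>)"

definition psi ::
    "'r ring \<Rightarrow> 'g monoid \<Rightarrow> 'h monoid \<Rightarrow> ('h \<Rightarrow> 'g \<Rightarrow> 'g) \<Rightarrow> ('r, 'p, 'h) rg_complex \<Rightarrow> 'g \<Rightarrow>
       (int \<Rightarrow> ('p \<Rightarrow> 'r) set) \<Rightarrow> int \<Rightarrow> ('p \<Rightarrow> 'g \<Rightarrow> 'r) set" where
  "psi R G H \<phi> P a =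
     cor R H P (carrier H) (stabilizer H \<phi> a) (group_ring R G H \<phi>)
     \<circ> coeff_map R P (stabilizer H \<phi> a) (group_ring R G H \<phi>) (theta R G a)"

text \<open>The characteristic as the additive order of \<open>1\<close>, with value \<open>0\<close> if that order is infinite.\<close>

definition ring_char :: "'r ring \<Rightarrow> nat" where
  "ring_char R = group.ord (add_monoid R) \<one>\<^bsub>R\<^esub>"

end

theory Submission
  imports Defs
begin

text \<open>
  The formula already holds for cochains. Let cocycles \<open>f\<close> and \<open>g\<close> represent \<open>\<alpha>\<close> and \<open>\<beta>\<close>. The class
  \<open>\<psi>\<^sub>i \<alpha>\<close> is represented by \<open>z \<mapsto> \<Sum>\<^sub>u f(u\<inverse>z) [u g\<^sub>i]\<close> with \<open>u\<close> running over \<open>H/H\<^sub>i\<close>, so \<open>\<psi>\<^sub>i \<alpha> \<smile> \<psi>\<^sub>j \<beta>\<close> is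
  represented by the sum over \<open>(u, v) \<in> H/H\<^sub>i \<times> H/H\<^sub>j\<close> of the cochains
  \<open>(f(u\<inverse>\<cdot>) \<otimes> g(v\<inverse>\<cdot>)) \<circ> \<Delta>\<close> with value at the group element \<open>(u g\<^sub>i)(v g\<^sub>j)\<close>. As \<open>\<Delta>\<close> is
  equivariant, the summand of \<open>x \<in> D\<close> on the right-hand side is the sum over \<open>m \<in> H/V\<close> of the same
  cochains with \<open>u = m y\<close> and \<open>v = m y x\<close>, and \<open>m \<mapsto> (m y H\<^sub>i, m y x H\<^sub>j)\<close> identifies the disjoint
  union of the sets \<open>H/V(x)\<close> with \<open>H/H\<^sub>i \<times> H/H\<^sub>j\<close>. That all the operations can be computed on
  representing cocycles is the Leibniz rule for \<open>\<Delta>\<close>.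
\<close>

section \<open>Finite sums and additive maps\<close>

text \<open>An equality of cochains is within reach because every subgroup is served by the same
  complex \<open>P\<close> and the same diagonal \<open>\<Delta>\<close>. The coset representatives
  chosen by \<open>SOME\<close> inside the corestrictions do no harm: a summand is a function of (u,
  v) that is invariant under right multiplication by the two stabilizers. Two nested corestrictions
  produce H/V(x) as H/H_k followed by H_k/V(x), and an inner representative fixes g_k, so it can be
  inserted into the group element of a summand without changing it.

  The obstacle is the passage between classes and cochains. The definitions map a class by uniting
  the classes of the images of all its representatives, and elements of the total cohomology are
  families of finite support. The predicate \<open>represents\<close> therefore couples a cocycle in
  every degree with a set S of degrees outside which these cocycles are zero, and each operation is
  shown to carry representing families to representing families. Products can then be summed over
  the fixed set S instead of the degrees in which both classes happen to be nonzero.\<close>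

lemma (in comm_monoid) finprod_Sigma:
  assumes "finite A" "\<And>x. x \<in> A \<Longrightarrow> finite (B x)"
    and "\<And>x y. \<lbrakk>x \<in> A; y \<in> B x\<rbrakk> \<Longrightarrow> f x y \<in> carrier G"
  shows "(\<Otimes>x\<in>A. \<Otimes>y\<in>B x. f x y) = (\<Otimes>z\<in>Sigma A B. f (fst z) (snd z))"
  using assms
proof (induction A rule: finite_induct)
  case empty
  then show ?case by simp
next
  case (insert a A)
  have eq: "Sigma (insert a A) B = Pair a ` B a \<union> Sigma A B"
    by auto
  have "(\<Otimes>z\<in>Pair a ` B a. f (fst z) (snd z)) = (\<Otimes>y\<in>B a. f a y)"
    using insert.prems by (subst finprod_reindex) (auto simp: inj_on_def)
  moreover have "(\<Otimes>z\<in>Sigma (insert a A) B. f (fst z) (snd z)) =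
      (\<Otimes>z\<in>Pair a ` B a. f (fst z) (snd z)) \<otimes> (\<Otimes>z\<in>Sigma A B. f (fst z) (snd z))"
    unfolding eq by (rule finprod_Un_disjoint) (use insert in auto)
  ultimately show ?case
    using insert by (subst finprod_insert) (auto intro!: finprod_closed)
qed

lemma (in comm_monoid) finprod_swap:
  assumes "finite A" "finite B"
    and "\<And>x y. \<lbrakk>x \<in> A; y \<in> B\<rbrakk> \<Longrightarrow> f x y \<in> carrier G"
  shows "(\<Otimes>x\<in>A. \<Otimes>y\<in>B. f x y) = (\<Otimes>y\<in>B. \<Otimes>x\<in>A. f x y)"
  using assms(1,3)
proof (induction A rule: finite_induct)
  case empty
  then show ?case by simp
next
  case (insert a A)
  then have "(\<Otimes>x\<in>insert a A. \<Otimes>y\<in>B. f x y) = (\<Otimes>y\<in>B. f a y) \<otimes> (\<Otimes>y\<in>B. \<Otimes>x\<in>A. f x y)"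
    by (subst finprod_insert) (auto intro!: finprod_closed)
  also have "\<dots> = (\<Otimes>y\<in>B. f a y \<otimes> (\<Otimes>x\<in>A. f x y))"
    by (rule finprod_multf[symmetric]) (use insert in \<open>auto intro!: finprod_closed\<close>)
  also have "\<dots> = (\<Otimes>y\<in>B. \<Otimes>x\<in>insert a A. f x y)"
    by (rule finprod_cong') (use insert in \<open>auto intro!: finprod_closed finprod_insert[symmetric]\<close>)
  finally show ?case .
qed

text \<open>Homomorphisms of additive groups suffice for classes, cochain maps, evaluations and sign
  changes: the groups of cochains and the Tate groups are treated as abelian groups, without their
  scalars.\<close>

locale additive_map = A: abelian_group A + B: abelian_group B
  for A :: "('a, 'c) ring_scheme" and B :: "('b, 'd) ring_scheme" +
  fixes f :: "'a \<Rightarrow> 'b"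
  assumes closed: "x \<in> carrier A \<Longrightarrow> f x \<in> carrier B"
    and add: "\<lbrakk>x \<in> carrier A; y \<in> carrier A\<rbrakk> \<Longrightarrow> f (x \<oplus>\<^bsub>A\<^esub> y) = f x \<oplus>\<^bsub>B\<^esub> f y"
begin

lemma map_zero: "f \<zero>\<^bsub>A\<^esub> = \<zero>\<^bsub>B\<^esub>"
proof -
  have "f \<zero>\<^bsub>A\<^esub> \<oplus>\<^bsub>B\<^esub> f \<zero>\<^bsub>A\<^esub> = f \<zero>\<^bsub>A\<^esub>"
    by (simp flip: add)
  then show ?thesis
    by (simp add: closed)
qed

lemma map_neg: "x \<in> carrier A \<Longrightarrow> f (\<ominus>\<^bsub>A\<^esub> x) = \<ominus>\<^bsub>B\<^esub> f x"
  by (rule B.minus_equality[symmetric])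
    (simp_all add: closed A.l_neg map_zero flip: add)

lemma map_sign_pow: "x \<in> carrier A \<Longrightarrow> f (sign_pow A n x) = sign_pow B n (f x)"
  by (simp add: sign_pow_def map_neg)

lemma map_finsum:
  "(\<And>i. i \<in> I \<Longrightarrow> g i \<in> carrier A) \<Longrightarrow> f (\<Oplus>\<^bsub>A\<^esub>i\<in>I. g i) = (\<Oplus>\<^bsub>B\<^esub>i\<in>I. f (g i))"
\<comment> \<open>A sum over an infinite set is zero by convention, so the infinite case is
  \<open>map_zero\<close>.\<close>
proof (induction I rule: infinite_finite_induct)
  case (insert i I)
  then show ?case
    by (simp add: A.finsum_insert B.finsum_insert add closed Pi_def A.finsum_closed)
qed (simp_all add: map_zero A.finsum_infinite B.finsum_infinite)

end

lemma (in abelian_group) sign_pow_closed: "x \<in> carrier G \<Longrightarrow> sign_pow G n x \<in> carrier G"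
  by (simp add: sign_pow_def)

lemma (in abelian_group) sign_pow_zero: "sign_pow G n \<zero> = \<zero>"
  by (simp add: sign_pow_def)

lemma (in abelian_group) sign_pow_add:
  "\<lbrakk>x \<in> carrier G; y \<in> carrier G\<rbrakk> \<Longrightarrow> sign_pow G n (x \<oplus> y) = sign_pow G n x \<oplus> sign_pow G n y"
  by (simp add: sign_pow_def minus_add)

lemma (in module) sign_pow_smult:
  "\<lbrakk>r \<in> carrier R; x \<in> carrier M\<rbrakk> \<Longrightarrow> sign_pow M n (r \<odot>\<^bsub>M\<^esub> x) = r \<odot>\<^bsub>M\<^esub> sign_pow M n x"
  by (simp add: sign_pow_def smult_r_minus)

text \<open>Inverses, sums, cosets and signs see only carrier, addition and zero. Facts can thus
  pass between records of different types with the same additive group, such as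
  \<open>tensor\<close> and \<open>tensor_module\<close>.\<close>

lemma additive_structure_cong:
  fixes A :: "('a, 'c) ring_scheme" and B :: "('a, 'd) ring_scheme"
  assumes "carrier A = carrier B" "add A = add B" "zero A = zero B"
  shows "a_inv A = a_inv B" "finsum A = finsum B" "a_r_coset A = a_r_coset B"
    "sign_pow A = sign_pow B"
proof -
  show 1: "a_inv A = a_inv B"
    by (rule ext) (simp add: a_inv_def m_inv_def assms)
  show "finsum A = finsum B"
    by (intro ext) (simp add: finsum_def finprod_def assms)
  show "a_r_coset A = a_r_coset B"
    by (intro ext) (simp add: a_r_coset_def r_coset_def assms)
  show "sign_pow A = sign_pow B"
    by (intro ext) (simp add: sign_pow_def 1)
qed

lemma abelian_group_cong:
  fixes A :: "('a, 'c) ring_scheme" and B :: "('a, 'd) ring_scheme"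
  assumes "abelian_group B" "carrier A = carrier B" "add A = add B" "zero A = zero B"
  shows "abelian_group A"
proof -
  note E = abelian_groupE[OF assms(1)]
  show ?thesis
    by (rule abelian_groupI; unfold assms(2-4))
      (fact E(1) | fact E(2) | erule (2) E(3) | erule (1) E(4) | erule E(5) | erule E(6))+
qed

section \<open>Quotients, direct sums and free modules\<close>

lemma
  fixes M :: "('r, 'm, 'e) module_scheme"
  assumes "abelian_subgroup N M"
  shows abelian_group_quotient_module: "abelian_group (quotient_module M N)" (is ?Q)
    and additive_map_coset: "additive_map M (quotient_module M N) (\<lambda>x. N +>\<^bsub>M\<^esub> x)" (is ?A)
proof -
  interpret N: abelian_subgroup N M by fact
  have c: "\<exists>x\<in>carrier M. X = N +>\<^bsub>M\<^esub> x" if "X \<in> a_rcosets\<^bsub>M\<^esub> N" for X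
    using that by (auto simp: A_RCOSETS_def' )
  have z: "N +>\<^bsub>M\<^esub> \<zero>\<^bsub>M\<^esub> = N"
    using N.a_coset_add_zero N.a_subset by auto
  have cI: "N +>\<^bsub>M\<^esub> x \<in> a_rcosets\<^bsub>M\<^esub> N" if "x \<in> carrier M" for x
    using that N.a_rcosetsI N.a_subset by blast
  show Q: ?Q
  proof (rule abelian_groupI, unfold quotient_module_def partial_object.simps ring.simps)
    fix X Y Z
    assume "X \<in> a_rcosets\<^bsub>M\<^esub> N" "Y \<in> a_rcosets\<^bsub>M\<^esub> N" "Z \<in> a_rcosets\<^bsub>M\<^esub> N"
    then show "X <+>\<^bsub>M\<^esub> Y <+>\<^bsub>M\<^esub> Z = X <+>\<^bsub>M\<^esub> (Y <+>\<^bsub>M\<^esub> Z)"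
      by (rule N.a_rcosets_assoc)
  next
    fix X Y
    assume XY: "X \<in> a_rcosets\<^bsub>M\<^esub> N" "Y \<in> a_rcosets\<^bsub>M\<^esub> N"
    then show "X <+>\<^bsub>M\<^esub> Y \<in> a_rcosets\<^bsub>M\<^esub> N"
      by (rule N.a_setmult_closed)
    from XY obtain x y where "x \<in> carrier M" "y \<in> carrier M"
      "X = N +>\<^bsub>M\<^esub> x" "Y = N +>\<^bsub>M\<^esub> y"
      using c by blast
    then show "X <+>\<^bsub>M\<^esub> Y = Y <+>\<^bsub>M\<^esub> X"
      by (simp add: N.a_rcos_sum N.a_comm)
  next
    show "N \<in> a_rcosets\<^bsub>M\<^esub> N"
      using cI[of "\<zero>\<^bsub>M\<^esub>"] z N.a_subset N.zero_closed by auto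
  next
    fix X
    assume X: "X \<in> a_rcosets\<^bsub>M\<^esub> N"
    show "N <+>\<^bsub>M\<^esub> X = X"
      using X by (rule N.rcosets_add_eq)
    from c[OF X] obtain x where x: "x \<in> carrier M" "X = N +>\<^bsub>M\<^esub> x"
      by blast
    show "\<exists>Y\<in>a_rcosets\<^bsub>M\<^esub> N. Y <+>\<^bsub>M\<^esub> X = N"
      by (rule bexI[of _ "N +>\<^bsub>M\<^esub> (\<ominus>\<^bsub>M\<^esub> x)"])
        (use x z in \<open>simp_all add: N.a_rcos_sum N.l_neg cI\<close>)
  qed
  interpret Q: abelian_group "quotient_module M N" by fact
  show ?A
    by unfold_locales (simp_all add: quotient_module_def cI N.a_rcos_sum)
qed

lemma quotient_module_carrierE:
  assumes "X \<in> carrier (quotient_module M N)"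
  obtains x where "x \<in> carrier M" "X = N +>\<^bsub>M\<^esub> x"
  using assms by (auto simp: quotient_module_def A_RCOSETS_def')

lemma (in module) submodule_abelian_subgroup:
  assumes "submodule N R M"
  shows "abelian_subgroup N M"
  by (rule abelian_subgroupI2) (use assms a_comm_group in \<open>auto simp: submodule_def\<close>)

text \<open>The definition unites the cosets of r y over all y in the coset of x; as N absorbs
  scalars, these are all the same coset.\<close>

lemma (in module) quotient_smult:
  assumes N: "submodule N R M" and r: "r \<in> carrier R" and x: "x \<in> carrier M"
  shows "r \<odot>\<^bsub>quotient_module M N\<^esub> (N +>\<^bsub>M\<^esub> x) = N +>\<^bsub>M\<^esub> (r \<odot>\<^bsub>M\<^esub> x)"
proof -
  interpret N: abelian_subgroup N M
    using N by (rule submodule_abelian_subgroup)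
  have sN: "N \<subseteq> carrier M"
    by (rule N.a_subset)
  have "N +>\<^bsub>M\<^esub> (r \<odot>\<^bsub>M\<^esub> y) = N +>\<^bsub>M\<^esub> (r \<odot>\<^bsub>M\<^esub> x)" if y: "y \<in> N +>\<^bsub>M\<^esub> x" for y
  proof -
    from y obtain n where n: "n \<in> N" "y = n \<oplus>\<^bsub>M\<^esub> x"
      by (auto simp: a_r_coset_def')
    then have "r \<odot>\<^bsub>M\<^esub> y = r \<odot>\<^bsub>M\<^esub> n \<oplus>\<^bsub>M\<^esub> r \<odot>\<^bsub>M\<^esub> x"
      using r x sN by (auto simp: smult_r_distr)
    moreover have rn: "r \<odot>\<^bsub>M\<^esub> n \<in> N"
      using submoduleE(4)[OF N] r n by blast
    ultimately have "r \<odot>\<^bsub>M\<^esub> y \<in> N +>\<^bsub>M\<^esub> (r \<odot>\<^bsub>M\<^esub> x)"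
      by (auto simp: a_r_coset_def')
    from N.a_repr_independence'[OF this] show ?thesis
      using r x by simp
  qed
  moreover have "x \<in> N +>\<^bsub>M\<^esub> x"
    using x by (rule N.a_rcos_self)
  ultimately have "(\<Union>y\<in>N +>\<^bsub>M\<^esub> x. N +>\<^bsub>M\<^esub> (r \<odot>\<^bsub>M\<^esub> y)) = N +>\<^bsub>M\<^esub> (r \<odot>\<^bsub>M\<^esub> x)"
    by blast
  then show ?thesis
    by (simp add: quotient_module_def)
qed

lemma (in module) module_quotient_module:
  assumes N: "submodule N R M"
  shows "module R (quotient_module M N)"
proof -
  let ?Q = "quotient_module M N" and ?c = "\<lambda>x. N +>\<^bsub>M\<^esub> x"
  interpret N: abelian_subgroup N M
    using N by (rule submodule_abelian_subgroup)
  interpret c: additive_map M ?Q ?c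
    by (rule additive_map_coset) (rule N.is_abelian_subgroup)
  note q = quotient_smult[OF N]
  show ?thesis
  proof (rule moduleI)
    show "cring R" by (rule is_cring)
    show "abelian_group ?Q" by (rule c.B.abelian_group_axioms)
  next
    fix a X assume "a \<in> carrier R" "X \<in> carrier ?Q"
    then show "a \<odot>\<^bsub>?Q\<^esub> X \<in> carrier ?Q"
      by (auto elim!: quotient_module_carrierE simp: q c.closed)
  next
    fix a b X assume "a \<in> carrier R" "b \<in> carrier R" "X \<in> carrier ?Q"
    then show "(a \<oplus>\<^bsub>R\<^esub> b) \<odot>\<^bsub>?Q\<^esub> X = (a \<odot>\<^bsub>?Q\<^esub> X) \<oplus>\<^bsub>?Q\<^esub> (b \<odot>\<^bsub>?Q\<^esub> X)"
      by (auto elim!: quotient_module_carrierE simp: q c.add[symmetric] smult_l_distr)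
  next
    fix a X Y assume "a \<in> carrier R" "X \<in> carrier ?Q" "Y \<in> carrier ?Q"
    then show "a \<odot>\<^bsub>?Q\<^esub> (X \<oplus>\<^bsub>?Q\<^esub> Y) = (a \<odot>\<^bsub>?Q\<^esub> X) \<oplus>\<^bsub>?Q\<^esub> (a \<odot>\<^bsub>?Q\<^esub> Y)"
      by (auto elim!: quotient_module_carrierE simp: q c.add[symmetric] smult_r_distr)
  next
    fix a b X assume "a \<in> carrier R" "b \<in> carrier R" "X \<in> carrier ?Q"
    then show "(a \<otimes>\<^bsub>R\<^esub> b) \<odot>\<^bsub>?Q\<^esub> X = a \<odot>\<^bsub>?Q\<^esub> (b \<odot>\<^bsub>?Q\<^esub> X)"
      by (auto elim!: quotient_module_carrierE simp: q smult_assoc1)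
  next
    fix X assume "X \<in> carrier ?Q"
    then show "\<one>\<^bsub>R\<^esub> \<odot>\<^bsub>?Q\<^esub> X = X"
      by (auto elim!: quotient_module_carrierE simp: q)
  qed
qed

section \<open>Direct sums of modules\<close>

lemma direct_sum_simps:
  "carrier (direct_sum I M) = {f \<in> (\<Pi>\<^sub>E i\<in>I. carrier (M i)). finite {i\<in>I. f i \<noteq> \<zero>\<^bsub>M i\<^esub>}}"
  "\<zero>\<^bsub>direct_sum I M\<^esub> = (\<lambda>i\<in>I. \<zero>\<^bsub>M i\<^esub>)"
  "f \<oplus>\<^bsub>direct_sum I M\<^esub> g = (\<lambda>i\<in>I. f i \<oplus>\<^bsub>M i\<^esub> g i)"
  "r \<odot>\<^bsub>direct_sum I M\<^esub> f = (\<lambda>i\<in>I. r \<odot>\<^bsub>M i\<^esub> f i)"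
  by (simp_all add: direct_sum_def)

lemma abelian_group_direct_sum:
  fixes M :: "'i \<Rightarrow> ('r, 'm, 'e) module_scheme"
  assumes "\<And>i. i \<in> I \<Longrightarrow> abelian_group (M i)"
  shows "abelian_group (direct_sum I M)"
proof (rule abelian_groupI)
  fix f g h
  assume f: "f \<in> carrier (direct_sum I M)" and g: "g \<in> carrier (direct_sum I M)"
    and h: "h \<in> carrier (direct_sum I M)"
  note A = abelian_groupE[OF assms]
  have "{i \<in> I. f i \<oplus>\<^bsub>M i\<^esub> g i \<noteq> \<zero>\<^bsub>M i\<^esub>}
      \<subseteq> {i \<in> I. f i \<noteq> \<zero>\<^bsub>M i\<^esub>} \<union> {i \<in> I. g i \<noteq> \<zero>\<^bsub>M i\<^esub>}"
    using A(2,5) by auto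
  moreover have "finite \<dots>"
    using f g by (simp add: direct_sum_simps)
  ultimately have "finite {i \<in> I. f i \<oplus>\<^bsub>M i\<^esub> g i \<noteq> \<zero>\<^bsub>M i\<^esub>}"
    by (rule finite_subset)
  then have "finite {i \<in> I. (\<lambda>i\<in>I. f i \<oplus>\<^bsub>M i\<^esub> g i) i \<noteq> \<zero>\<^bsub>M i\<^esub>}"
    by (rule rev_finite_subset) auto
  then show "f \<oplus>\<^bsub>direct_sum I M\<^esub> g \<in> carrier (direct_sum I M)"
    using f g A(1) unfolding direct_sum_simps by (auto simp: PiE_iff)
  show "f \<oplus>\<^bsub>direct_sum I M\<^esub> g \<oplus>\<^bsub>direct_sum I M\<^esub> h
      = f \<oplus>\<^bsub>direct_sum I M\<^esub> (g \<oplus>\<^bsub>direct_sum I M\<^esub> h)"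
    using f g h A(3) by (auto simp: direct_sum_simps fun_eq_iff PiE_iff)
  show "f \<oplus>\<^bsub>direct_sum I M\<^esub> g = g \<oplus>\<^bsub>direct_sum I M\<^esub> f"
    using f g A(4) by (auto simp: direct_sum_simps fun_eq_iff PiE_iff)
  show "\<zero>\<^bsub>direct_sum I M\<^esub> \<oplus>\<^bsub>direct_sum I M\<^esub> f = f"
    using f A(5) by (auto simp: direct_sum_simps fun_eq_iff PiE_iff extensional_def)
  show "\<exists>f'\<in>carrier (direct_sum I M). f' \<oplus>\<^bsub>direct_sum I M\<^esub> f = \<zero>\<^bsub>direct_sum I M\<^esub>"
  proof
    have z: "(\<ominus>\<^bsub>M i\<^esub> f i = \<zero>\<^bsub>M i\<^esub>) = (f i = \<zero>\<^bsub>M i\<^esub>)" if "i \<in> I" for i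
    proof -
      interpret abelian_group "M i" using assms that by simp
      show ?thesis using f that by (auto simp: direct_sum_simps PiE_iff)
    qed
    have "{i \<in> I. (\<lambda>i\<in>I. \<ominus>\<^bsub>M i\<^esub> f i) i \<noteq> \<zero>\<^bsub>M i\<^esub>} = {i \<in> I. f i \<noteq> \<zero>\<^bsub>M i\<^esub>}"
      using z by auto
    then show "(\<lambda>i\<in>I. \<ominus>\<^bsub>M i\<^esub> f i) \<in> carrier (direct_sum I M)"
      using f abelian_group.a_inv_closed[OF assms] by (auto simp: direct_sum_simps PiE_iff)
    show "(\<lambda>i\<in>I. \<ominus>\<^bsub>M i\<^esub> f i) \<oplus>\<^bsub>direct_sum I M\<^esub> f = \<zero>\<^bsub>direct_sum I M\<^esub>"
      using f abelian_group.l_neg[OF assms] by (auto simp: direct_sum_simps fun_eq_iff PiE_iff)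
  qed
next
  show "\<zero>\<^bsub>direct_sum I M\<^esub> \<in> carrier (direct_sum I M)"
    using abelian_groupE(2)[OF assms] by (auto simp: direct_sum_simps)
qed

lemma module_direct_sum:
  assumes "cring R" and M: "\<And>i. i \<in> I \<Longrightarrow> module R (M i)"
  shows "module R (direct_sum I M)"
proof (rule moduleI)
  show "abelian_group (direct_sum I M)"
    using M by (intro abelian_group_direct_sum) (simp add: module_def)
next
  fix a f assume a: "a \<in> carrier R" and f: "f \<in> carrier (direct_sum I M)"
  have "finite {i \<in> I. (\<lambda>i\<in>I. a \<odot>\<^bsub>M i\<^esub> f i) i \<noteq> \<zero>\<^bsub>M i\<^esub>}"
  proof (rule finite_subset)
    show "{i \<in> I. (\<lambda>i\<in>I. a \<odot>\<^bsub>M i\<^esub> f i) i \<noteq> \<zero>\<^bsub>M i\<^esub>} \<subseteq> {i \<in> I. f i \<noteq> \<zero>\<^bsub>M i\<^esub>}"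
      using module.smult_r_null[OF M a] by auto
  qed (use f in \<open>simp add: direct_sum_simps\<close>)
  then show "a \<odot>\<^bsub>direct_sum I M\<^esub> f \<in> carrier (direct_sum I M)"
    using module.smult_closed[OF M a] f by (auto simp: direct_sum_simps PiE_iff)
qed (auto simp: assms direct_sum_simps fun_eq_iff PiE_iff extensional_def
    module.smult_l_distr[OF M] module.smult_r_distr[OF M] module.smult_assoc1[OF M]
    module.smult_one[OF M])

text \<open>Pins the ring to a plain ring record, the type for which tensor products and cohomology
  are defined.\<close>

locale base_cring = cring R for R :: "'r ring" (structure)

locale base_module = module R M
  for R :: "'r ring" (structure) and M :: "('r, 'm, 'e) module_scheme" (structure)

sublocale base_module \<subseteq> base_cring ..

lemma trivial_module_simps [simp]:
  "carrier (trivial_module R) = carrier R" "\<zero>\<^bsub>trivial_module R\<^esub> = \<zero>\<^bsub>R\<^esub>"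
  "add (trivial_module R) = add R" "smult (trivial_module R) = mult R"
  "mult (trivial_module R) = mult R" "act (trivial_module R) h = (\<lambda>r\<in>carrier R. r)"
  by (simp_all add: trivial_module_def)

lemma (in base_cring) module_trivial_module: "module R (trivial_module R)"
proof (rule moduleI)
  show "cring R" by (rule is_cring)
  show "abelian_group (trivial_module R)"
    by (rule abelian_group_cong[OF abelian_group_axioms]) simp_all
qed (simp_all add: l_distr r_distr m_assoc)

text \<open>The linear extension of b to finitely supported functions. Only nonzero terms are
  summed, since \<open>I\<close> may be infinite and an infinite index set would give zero. For
  \<open>I\<close> = carrier M \<times> carrier N it is the expression inside
  \<open>tensor_lift\<close>.\<close>

definition free_lift ::
    "('r, 'l, 'f) module_scheme \<Rightarrow> 'i set \<Rightarrow> ('i \<Rightarrow> 'l) \<Rightarrow> ('i \<Rightarrow> 'r) \<Rightarrow> 'l" where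
  "free_lift L I b x =
     (\<Oplus>\<^bsub>L\<^esub>i\<in>{i \<in> I. x i \<odot>\<^bsub>L\<^esub> b i \<noteq> \<zero>\<^bsub>L\<^esub>}. x i \<odot>\<^bsub>L\<^esub> b i)"

lemma free_module_simps:
  "carrier (free_module R I) = {f \<in> I \<rightarrow>\<^sub>E carrier R. finite {i\<in>I. f i \<noteq> \<zero>\<^bsub>R\<^esub>}}"
  "\<zero>\<^bsub>free_module R I\<^esub> = (\<lambda>i\<in>I. \<zero>\<^bsub>R\<^esub>)"
  "f \<oplus>\<^bsub>free_module R I\<^esub> g = (\<lambda>i\<in>I. f i \<oplus>\<^bsub>R\<^esub> g i)"
  "r \<odot>\<^bsub>free_module R I\<^esub> f = (\<lambda>i\<in>I. r \<otimes>\<^bsub>R\<^esub> f i)"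
  by (simp_all add: free_module_def direct_sum_simps)

section \<open>Free modules and linear extension from a basis\<close>

context base_cring
begin

lemma module_free_module: "module R (free_module R I)"
  unfolding free_module_def by (rule module_direct_sum[OF is_cring]) (rule module_trivial_module)

lemma free_gen_closed [simp]: "i \<in> I \<Longrightarrow> free_gen R I i \<in> carrier (free_module R I)"
proof -
  assume "i \<in> I"
  have "finite {j \<in> I. free_gen R I i j \<noteq> \<zero>}"
    by (rule finite_subset[of _ "{i}"]) (auto simp: free_gen_def)
  then show ?thesis
    by (simp add: free_module_simps) (auto simp: free_gen_def)
qed

text \<open>Induction on a finite set containing the support: each step splits off the coordinate at
  one basis element.\<close>

lemma free_module_induct [consumes 1, case_names zero add]:
  assumes x: "x \<in> carrier (free_module R I)"
    and zero: "Q \<zero>\<^bsub>free_module R I\<^esub>"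
    and add: "\<And>r i x. \<lbrakk>r \<in> carrier R; i \<in> I; x \<in> carrier (free_module R I); Q x\<rbrakk>
       \<Longrightarrow> Q (r \<odot>\<^bsub>free_module R I\<^esub> free_gen R I i \<oplus>\<^bsub>free_module R I\<^esub> x)"
  shows "Q x"
proof -
  have "Q x" if "finite S" "x \<in> carrier (free_module R I)" "{i \<in> I. x i \<noteq> \<zero>} \<subseteq> S" for S x
    using that
  proof (induction S arbitrary: x)
    case empty
    then have "x = \<zero>\<^bsub>free_module R I\<^esub>"
      by (auto simp: free_module_simps fun_eq_iff PiE_iff extensional_def)
    then show ?case using zero by simp
  next
    case (insert i S)
    show ?case
    proof (cases "i \<in> I")
      case True
      let ?y = "x(i := \<zero>)"
      have "finite {j \<in> I. ?y j \<noteq> \<zero>}"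
        by (rule finite_subset[of _ "{i \<in> I. x i \<noteq> \<zero>}"])
          (use insert.prems in \<open>auto simp: free_module_simps\<close>)
      then have y: "?y \<in> carrier (free_module R I)"
        using insert.prems True by (auto simp: free_module_simps PiE_iff extensional_def)
      have "Q ?y"
        by (rule insert.IH[OF y]) (use insert.prems in auto)
      then have "Q (x i \<odot>\<^bsub>free_module R I\<^esub> free_gen R I i \<oplus>\<^bsub>free_module R I\<^esub> ?y)"
        using insert.prems y True by (intro add) (auto simp: free_module_simps)
      also have "x i \<odot>\<^bsub>free_module R I\<^esub> free_gen R I i \<oplus>\<^bsub>free_module R I\<^esub> ?y = x"
        using insert.prems True
        by (auto simp: free_module_simps fun_eq_iff PiE_iff extensional_def free_gen_def)
      finally show ?thesis .
    next
      case False
      then show ?thesis using insert by auto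
    qed
  qed
  from this[OF _ x subset_refl] show ?thesis
    using x by (simp add: free_module_simps)
qed

end

context base_module
begin

text \<open>The index set in \<open>free_lift\<close> varies with x. Any finite set that contains
  the support gives the same sum, so x, y and x + y can be summed over one set.\<close>

lemma free_lift_eq:
  assumes b: "b \<in> I \<rightarrow> carrier M" and x: "x \<in> carrier (free_module R I)"
    and S: "finite S" "S \<subseteq> I" "\<And>i. i \<in> I - S \<Longrightarrow> x i = \<zero>"
  shows "free_lift M I b x = (\<Oplus>\<^bsub>M\<^esub>i\<in>S. x i \<odot>\<^bsub>M\<^esub> b i)"
proof -
  have xc: "x i \<in> carrier R" if "i \<in> I" for i
    using x that by (auto simp: free_module_simps)
  show ?thesis
    unfolding free_lift_def
  proof (rule M.add.finprod_mono_neutral_cong_left)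
    show "{i \<in> I. x i \<odot>\<^bsub>M\<^esub> b i \<noteq> \<zero>\<^bsub>M\<^esub>} \<subseteq> S"
      using S(3) b by (force simp: Pi_iff)
  qed (use S xc b in \<open>auto intro!: smult_closed simp: Pi_iff\<close>)
qed

lemma free_lift_closed:
  assumes b: "b \<in> I \<rightarrow> carrier M" and x: "x \<in> carrier (free_module R I)"
  shows "free_lift M I b x \<in> carrier M"
  unfolding free_lift_def
  using assms by (intro M.finsum_closed) (auto simp: free_module_simps Pi_iff)

lemma free_lift_add:
  assumes b: "b \<in> I \<rightarrow> carrier M"
    and x: "x \<in> carrier (free_module R I)" and y: "y \<in> carrier (free_module R I)"
  shows "free_lift M I b (x \<oplus>\<^bsub>free_module R I\<^esub> y) = free_lift M I b x \<oplus>\<^bsub>M\<^esub> free_lift M I b y"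
proof -
  interpret F: module R "free_module R I"
    by (rule module_free_module)
  let ?S = "{i\<in>I. x i \<noteq> \<zero>} \<union> {i\<in>I. y i \<noteq> \<zero>}"
  have fin: "finite ?S"
    using x y by (simp add: free_module_simps)
  have xc: "x i \<in> carrier R" "y i \<in> carrier R" "b i \<in> carrier M" if "i \<in> I" for i
    using x y b that by (auto simp: free_module_simps)
  have "free_lift M I b (x \<oplus>\<^bsub>free_module R I\<^esub> y)
      = (\<Oplus>\<^bsub>M\<^esub>i\<in>?S. (x \<oplus>\<^bsub>free_module R I\<^esub> y) i \<odot>\<^bsub>M\<^esub> b i)"
    using fin F.a_closed[OF x y] b by (intro free_lift_eq) (auto simp: free_module_simps)
  also have "\<dots> = (\<Oplus>\<^bsub>M\<^esub>i\<in>?S. x i \<odot>\<^bsub>M\<^esub> b i \<oplus>\<^bsub>M\<^esub> y i \<odot>\<^bsub>M\<^esub> b i)"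
    by (rule M.finsum_cong') (auto simp: free_module_simps xc smult_l_distr)
  also have "\<dots> = (\<Oplus>\<^bsub>M\<^esub>i\<in>?S. x i \<odot>\<^bsub>M\<^esub> b i) \<oplus>\<^bsub>M\<^esub> (\<Oplus>\<^bsub>M\<^esub>i\<in>?S. y i \<odot>\<^bsub>M\<^esub> b i)"
    by (rule M.finsum_addf) (auto simp: xc)
  also have "(\<Oplus>\<^bsub>M\<^esub>i\<in>?S. x i \<odot>\<^bsub>M\<^esub> b i) = free_lift M I b x"
    using fin x b by (intro free_lift_eq[symmetric]) auto
  also have "(\<Oplus>\<^bsub>M\<^esub>i\<in>?S. y i \<odot>\<^bsub>M\<^esub> b i) = free_lift M I b y"
    using fin y b by (intro free_lift_eq[symmetric]) auto
  finally show ?thesis .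
qed

lemma free_lift_smult:
  assumes b: "b \<in> I \<rightarrow> carrier M" and r: "r \<in> carrier R" and x: "x \<in> carrier (free_module R I)"
  shows "free_lift M I b (r \<odot>\<^bsub>free_module R I\<^esub> x) = r \<odot>\<^bsub>M\<^esub> free_lift M I b x"
proof -
  interpret F: module R "free_module R I"
    by (rule module_free_module)
  let ?S = "{i\<in>I. x i \<noteq> \<zero>}"
  have fin: "finite ?S"
    using x by (simp add: free_module_simps)
  have xc: "x i \<in> carrier R" "b i \<in> carrier M" if "i \<in> I" for i
    using x b that by (auto simp: free_module_simps)
  have "free_lift M I b (r \<odot>\<^bsub>free_module R I\<^esub> x)
      = (\<Oplus>\<^bsub>M\<^esub>i\<in>?S. (r \<odot>\<^bsub>free_module R I\<^esub> x) i \<odot>\<^bsub>M\<^esub> b i)"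
    using fin F.smult_closed[OF r x] b r by (intro free_lift_eq) (auto simp: free_module_simps)
  also have "\<dots> = (\<Oplus>\<^bsub>M\<^esub>i\<in>?S. r \<odot>\<^bsub>M\<^esub> (x i \<odot>\<^bsub>M\<^esub> b i))"
    by (rule M.finsum_cong') (auto simp: free_module_simps xc r smult_assoc1)
  also have "\<dots> = r \<odot>\<^bsub>M\<^esub> (\<Oplus>\<^bsub>M\<^esub>i\<in>?S. x i \<odot>\<^bsub>M\<^esub> b i)"
    by (rule finsum_smult_ldistr[symmetric]) (auto simp: xc r fin)
  also have "(\<Oplus>\<^bsub>M\<^esub>i\<in>?S. x i \<odot>\<^bsub>M\<^esub> b i) = free_lift M I b x"
    using fin x b by (intro free_lift_eq[symmetric]) auto
  finally show ?thesis .
qed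

lemma free_lift_gen:
  assumes b: "b \<in> I \<rightarrow> carrier M" and i: "i \<in> I"
  shows "free_lift M I b (free_gen R I i) = b i"
proof -
  have "free_lift M I b (free_gen R I i) = (\<Oplus>\<^bsub>M\<^esub>j\<in>{i}. free_gen R I i j \<odot>\<^bsub>M\<^esub> b j)"
    using assms by (intro free_lift_eq free_gen_closed) (auto simp: free_gen_def)
  also have "\<dots> = b i"
    using assms by (simp add: free_gen_def Pi_iff)
  finally show ?thesis .
qed

lemma additive_map_free_lift:
  assumes "b \<in> I \<rightarrow> carrier M"
  shows "additive_map (free_module R I) M (free_lift M I b)"
proof -
  interpret F: module R "free_module R I"
    by (rule module_free_module)
  show ?thesis
    by unfold_locales (simp_all add: assms free_lift_closed free_lift_add)
qed

lemma submodule_span_submodule: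
  assumes "S \<subseteq> carrier M"
  shows "submodule (submodule_span R M S) R M"
proof (rule submoduleI)
  show "submodule_span R M S \<subseteq> carrier M"
    \<comment> \<open>The whole module belongs to the intersected family because it contains S; the
      intersection of an empty family would be the whole type.\<close>
    using carrier_is_submodule assms by (auto simp: submodule_span_def)
  show "\<zero>\<^bsub>M\<^esub> \<in> submodule_span R M S"
    by (auto simp: submodule_span_def dest: submodule_abelian_subgroup
        intro!: additive_subgroup.zero_closed abelian_subgroup.axioms)
qed (auto simp: submodule_span_def dest: submoduleE)

end

section \<open>Tensor products\<close>

locale tensor_pair = M: base_module R M + N: base_module R N
  for R :: "'r ring" (structure) and M :: "('r, 'm, 'd) module_scheme"
    and N :: "('r, 'n, 'e) module_scheme"
begin

abbreviation F where "F \<equiv> free_module R (carrier M \<times> carrier N)"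
abbreviation B where "B \<equiv> submodule_span R F (bilinear_relations R M N)"
abbreviation gen where "gen m n \<equiv> free_gen R (carrier M \<times> carrier N) (m, n)"
abbreviation T where "T \<equiv> tensor_module R M N"
abbreviation pure where "pure \<equiv> pure_tensor R M N"

sublocale F: base_module R F
  unfolding base_module_def by (rule M.module_free_module)

lemma tensor_eq: "T = quotient_module F B"
  by (simp add: tensor_module_def Let_def)

lemma pure_eq: "pure m n = B +>\<^bsub>F\<^esub> gen m n"
  by (simp add: pure_tensor_def Let_def)

lemma bilinear_relationsE:
  assumes "x \<in> bilinear_relations R M N"
  obtains (add_left) m m' n where "m \<in> carrier M" "m' \<in> carrier M" "n \<in> carrier N"
      "x = gen (m \<oplus>\<^bsub>M\<^esub> m') n \<ominus>\<^bsub>F\<^esub> (gen m n \<oplus>\<^bsub>F\<^esub> gen m' n)"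
    | (add_right) m n n' where "m \<in> carrier M" "n \<in> carrier N" "n' \<in> carrier N"
      "x = gen m (n \<oplus>\<^bsub>N\<^esub> n') \<ominus>\<^bsub>F\<^esub> (gen m n \<oplus>\<^bsub>F\<^esub> gen m n')"
    | (smult_left) r m n where "r \<in> carrier R" "m \<in> carrier M" "n \<in> carrier N"
      "x = gen (r \<odot>\<^bsub>M\<^esub> m) n \<ominus>\<^bsub>F\<^esub> r \<odot>\<^bsub>F\<^esub> gen m n"
    | (smult_right) r m n where "r \<in> carrier R" "m \<in> carrier M" "n \<in> carrier N"
      "x = gen m (r \<odot>\<^bsub>N\<^esub> n) \<ominus>\<^bsub>F\<^esub> r \<odot>\<^bsub>F\<^esub> gen m n"
  using assms unfolding bilinear_relations_def Let_def
proof (elim UnE CollectE exE conjE, goal_cases)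
  case 1
  from add_left[OF 1(6-8,5)] show ?case .
next
  case 2
  from add_right[OF 2(6-8,5)] show ?case .
next
  case 3
  from smult_left[OF 3(6-8,5)] show ?case .
next
  case 4
  from smult_right[OF 4(6-8,5)] show ?case .
qed

lemma bilinear_relationsI:
  "\<lbrakk>m \<in> carrier M; m' \<in> carrier M; n \<in> carrier N\<rbrakk> \<Longrightarrow>
    gen (m \<oplus>\<^bsub>M\<^esub> m') n \<ominus>\<^bsub>F\<^esub> (gen m n \<oplus>\<^bsub>F\<^esub> gen m' n) \<in> bilinear_relations R M N"
  "\<lbrakk>m \<in> carrier M; n \<in> carrier N; n' \<in> carrier N\<rbrakk> \<Longrightarrow>
    gen m (n \<oplus>\<^bsub>N\<^esub> n') \<ominus>\<^bsub>F\<^esub> (gen m n \<oplus>\<^bsub>F\<^esub> gen m n') \<in> bilinear_relations R M N"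
  "\<lbrakk>r \<in> carrier R; m \<in> carrier M; n \<in> carrier N\<rbrakk> \<Longrightarrow>
    gen (r \<odot>\<^bsub>M\<^esub> m) n \<ominus>\<^bsub>F\<^esub> r \<odot>\<^bsub>F\<^esub> gen m n \<in> bilinear_relations R M N"
  "\<lbrakk>r \<in> carrier R; m \<in> carrier M; n \<in> carrier N\<rbrakk> \<Longrightarrow>
    gen m (r \<odot>\<^bsub>N\<^esub> n) \<ominus>\<^bsub>F\<^esub> r \<odot>\<^bsub>F\<^esub> gen m n \<in> bilinear_relations R M N"
  unfolding bilinear_relations_def Let_def Un_iff
     apply (rule disjI1, rule disjI1, rule disjI1, intro CollectI exI conjI; (rule refl | assumption))
    apply (rule disjI1, rule disjI1, rule disjI2, intro CollectI exI conjI; (rule refl | assumption))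
   apply (rule disjI1, rule disjI2, intro CollectI exI conjI; (rule refl | assumption))
  apply (rule disjI2, intro CollectI exI conjI; (rule refl | assumption))
  done

lemma gen_closed [simp]: "\<lbrakk>m \<in> carrier M; n \<in> carrier N\<rbrakk> \<Longrightarrow> gen m n \<in> carrier F"
  by (rule M.free_gen_closed) simp

lemma bilinear_relations_closed: "bilinear_relations R M N \<subseteq> carrier F"
  by (rule subsetI, erule bilinear_relationsE) simp_all

lemma submodule_B: "submodule B R F"
  by (rule F.submodule_span_submodule) (rule bilinear_relations_closed)

sublocale B: abelian_subgroup B F
  by (rule F.submodule_abelian_subgroup) (rule submodule_B)

sublocale T: base_module R T
  unfolding base_module_def tensor_eq by (rule F.module_quotient_module) (rule submodule_B)

lemma coset_additive: "additive_map F T (\<lambda>x. B +>\<^bsub>F\<^esub> x)"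
  unfolding tensor_eq by (rule additive_map_coset) (rule B.is_abelian_subgroup)

lemma coset_smult:
  "\<lbrakk>r \<in> carrier R; x \<in> carrier F\<rbrakk> \<Longrightarrow> B +>\<^bsub>F\<^esub> (r \<odot>\<^bsub>F\<^esub> x) = r \<odot>\<^bsub>T\<^esub> (B +>\<^bsub>F\<^esub> x)"
  unfolding tensor_eq by (rule F.quotient_smult[OF submodule_B, symmetric])

lemma coset_eqI:
  assumes "x \<in> carrier F" "y \<in> carrier F" "x \<ominus>\<^bsub>F\<^esub> y \<in> bilinear_relations R M N"
  shows "B +>\<^bsub>F\<^esub> x = B +>\<^bsub>F\<^esub> y"
proof -
  have "x \<ominus>\<^bsub>F\<^esub> y \<in> B"
    using assms(3) by (auto simp: submodule_span_def)
  then have "x \<in> B +>\<^bsub>F\<^esub> y"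
    using B.a_rcos_module assms by (simp add: F.minus_eq)
  from B.a_repr_independence'[OF this assms(2)] show ?thesis ..
qed

lemma pure_closed [simp]: "\<lbrakk>m \<in> carrier M; n \<in> carrier N\<rbrakk> \<Longrightarrow> pure m n \<in> carrier T"
  unfolding pure_eq by (rule additive_map.closed[OF coset_additive]) simp

lemma pure_bilinear:
  "\<lbrakk>m \<in> carrier M; m' \<in> carrier M; n \<in> carrier N\<rbrakk> \<Longrightarrow>
    pure (m \<oplus>\<^bsub>M\<^esub> m') n = pure m n \<oplus>\<^bsub>T\<^esub> pure m' n"
  "\<lbrakk>m \<in> carrier M; n \<in> carrier N; n' \<in> carrier N\<rbrakk> \<Longrightarrow>
    pure m (n \<oplus>\<^bsub>N\<^esub> n') = pure m n \<oplus>\<^bsub>T\<^esub> pure m n'"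
  "\<lbrakk>r \<in> carrier R; m \<in> carrier M; n \<in> carrier N\<rbrakk> \<Longrightarrow>
    pure (r \<odot>\<^bsub>M\<^esub> m) n = r \<odot>\<^bsub>T\<^esub> pure m n"
  "\<lbrakk>r \<in> carrier R; m \<in> carrier M; n \<in> carrier N\<rbrakk> \<Longrightarrow>
    pure m (r \<odot>\<^bsub>N\<^esub> n) = r \<odot>\<^bsub>T\<^esub> pure m n"
  unfolding pure_eq
  by (simp_all add: bilinear_relationsI coset_eqI
      flip: additive_map.add[OF coset_additive] coset_smult)

text \<open>The projection from the free module carries its induction rule over, since basis
  elements go to pure tensors.\<close>

lemma tensor_induct [consumes 1, case_names zero add]:
  assumes X: "X \<in> carrier T"
    and zero: "Q \<zero>\<^bsub>T\<^esub>"
    and add: "\<And>r m n X. \<lbrakk>r \<in> carrier R; m \<in> carrier M; n \<in> carrier N; X \<in> carrier T; Q X\<rbrakk>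
      \<Longrightarrow> Q (r \<odot>\<^bsub>T\<^esub> pure m n \<oplus>\<^bsub>T\<^esub> X)"
  shows "Q X"
proof -
  interpret c: additive_map F T "\<lambda>x. B +>\<^bsub>F\<^esub> x"
    by (rule coset_additive)
  from X obtain x where x: "x \<in> carrier F" "X = B +>\<^bsub>F\<^esub> x"
    unfolding tensor_eq by (elim quotient_module_carrierE)
  have "Q (B +>\<^bsub>F\<^esub> x)"
    using x(1)
  proof (induction rule: M.free_module_induct)
    case zero
    then show ?case using \<open>Q \<zero>\<^bsub>T\<^esub>\<close> by (simp add: c.map_zero)
  next
    case (add r i x)
    then obtain m n where i: "i = (m, n)" "m \<in> carrier M" "n \<in> carrier N"
      by blast
    have "Q (r \<odot>\<^bsub>T\<^esub> pure m n \<oplus>\<^bsub>T\<^esub> (B +>\<^bsub>F\<^esub> x))"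
      using add i by (intro assms(3)) (auto simp: c.closed)
    then show ?case
      using add i by (simp add: c.add coset_smult pure_eq)
  qed
  with x show ?thesis by simp
qed

end

section \<open>Linear maps and the universal property of the tensor product\<close>

definition linear_on ::
    "'r ring \<Rightarrow> ('r, 'm, 'd) module_scheme \<Rightarrow> ('r, 'n, 'e) module_scheme \<Rightarrow> ('m \<Rightarrow> 'n) \<Rightarrow> bool" where
  "linear_on R M N f \<longleftrightarrow>
     (\<forall>x\<in>carrier M. f x \<in> carrier N) \<and>
     (\<forall>x\<in>carrier M. \<forall>y\<in>carrier M. f (x \<oplus>\<^bsub>M\<^esub> y) = f x \<oplus>\<^bsub>N\<^esub> f y) \<and>
     (\<forall>r\<in>carrier R. \<forall>x\<in>carrier M. f (r \<odot>\<^bsub>M\<^esub> x) = r \<odot>\<^bsub>N\<^esub> f x)"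

lemma linear_onD:
  assumes "linear_on R M N f"
  shows "x \<in> carrier M \<Longrightarrow> f x \<in> carrier N"
    and "\<lbrakk>x \<in> carrier M; y \<in> carrier M\<rbrakk> \<Longrightarrow> f (x \<oplus>\<^bsub>M\<^esub> y) = f x \<oplus>\<^bsub>N\<^esub> f y"
    and "\<lbrakk>r \<in> carrier R; x \<in> carrier M\<rbrakk> \<Longrightarrow> f (r \<odot>\<^bsub>M\<^esub> x) = r \<odot>\<^bsub>N\<^esub> f x"
  using assms by (auto simp: linear_on_def)

lemma linear_onI:
  assumes "\<And>x. x \<in> carrier M \<Longrightarrow> f x \<in> carrier N"
    and "\<And>x y. \<lbrakk>x \<in> carrier M; y \<in> carrier M\<rbrakk> \<Longrightarrow> f (x \<oplus>\<^bsub>M\<^esub> y) = f x \<oplus>\<^bsub>N\<^esub> f y"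
    and "\<And>r x. \<lbrakk>r \<in> carrier R; x \<in> carrier M\<rbrakk> \<Longrightarrow> f (r \<odot>\<^bsub>M\<^esub> x) = r \<odot>\<^bsub>N\<^esub> f x"
  shows "linear_on R M N f"
  using assms by (auto simp: linear_on_def)

lemma linear_on_additive_map:
  "\<lbrakk>linear_on R M N f; abelian_group M; abelian_group N\<rbrakk> \<Longrightarrow> additive_map M N f"
  by (simp add: additive_map_def additive_map_axioms_def linear_on_def)

locale bilinear = tensor_pair R M N + L: base_module R L
  for R :: "'r ring" (structure) and M :: "('r, 'm, 'd) module_scheme"
    and N :: "('r, 'n, 'e) module_scheme" and L :: "('r, 'l, 'f) module_scheme" +
  fixes b :: "'m \<Rightarrow> 'n \<Rightarrow> 'l"
  assumes linear_left: "n \<in> carrier N \<Longrightarrow> linear_on R M L (\<lambda>m. b m n)"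
    and linear_right: "m \<in> carrier M \<Longrightarrow> linear_on R N L (b m)"
begin

abbreviation lift where "lift \<equiv> tensor_lift M N L b"
abbreviation flift where
  "flift \<equiv> free_lift L (carrier M \<times> carrier N) (\<lambda>z. b (fst z) (snd z))"

lemma b_funcset: "(\<lambda>z. b (fst z) (snd z)) \<in> carrier M \<times> carrier N \<rightarrow> carrier L"
  using linear_onD(1)[OF linear_left] by auto

sublocale flift: additive_map F L flift
  by (rule L.additive_map_free_lift) (rule b_funcset)

lemma flift_smult: "\<lbrakk>r \<in> carrier R; x \<in> carrier F\<rbrakk> \<Longrightarrow> flift (r \<odot>\<^bsub>F\<^esub> x) = r \<odot>\<^bsub>L\<^esub> flift x"
  by (rule L.free_lift_smult[OF b_funcset])

lemma flift_gen: "\<lbrakk>m \<in> carrier M; n \<in> carrier N\<rbrakk> \<Longrightarrow> flift (gen m n) = b m n"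
  using L.free_lift_gen[OF b_funcset, of "(m, n)"] by simp

lemma flift_minus:
  "\<lbrakk>x \<in> carrier F; y \<in> carrier F\<rbrakk> \<Longrightarrow> flift (x \<ominus>\<^bsub>F\<^esub> y) = flift x \<ominus>\<^bsub>L\<^esub> flift y"
  by (simp add: F.minus_eq L.minus_eq flift.add flift.map_neg)

text \<open>The kernel of \<open>flift\<close> is a submodule, and bilinearity of b puts all
  defining relations into it. Hence it contains the submodule that they span.\<close>

lemma flift_B: "x \<in> B \<Longrightarrow> flift x = \<zero>\<^bsub>L\<^esub>"
proof -
  let ?K = "{x \<in> carrier F. flift x = \<zero>\<^bsub>L\<^esub>}"
  have bc: "b m n \<in> carrier L" if "m \<in> carrier M" "n \<in> carrier N" for m n
    using linear_onD(1)[OF linear_left] that by blast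
  have "submodule ?K R F"
    by (rule F.submoduleI)
      (auto simp: flift.map_zero flift.map_neg flift.add flift_smult)
  moreover have "bilinear_relations R M N \<subseteq> ?K"
  proof
    fix x assume x: "x \<in> bilinear_relations R M N"
    then have "flift x = \<zero>\<^bsub>L\<^esub>"
      by (rule bilinear_relationsE)
        (simp_all add: flift_minus flift.add flift_smult flift_gen bc L.minus_eq L.r_neg
          linear_onD[OF linear_left] linear_onD[OF linear_right])
    with x show "x \<in> ?K"
      using bilinear_relations_closed by auto
  qed
  ultimately have "B \<subseteq> ?K"
    unfolding submodule_span_def by auto
  then show "x \<in> B \<Longrightarrow> flift x = \<zero>\<^bsub>L\<^esub>"
    by auto
qed

text \<open>Makes the \<open>the_elem\<close> in \<open>tensor_lift\<close> legitimate: by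
  \<open>flift_B\<close> the linear extension is constant on a coset of \<open>B\<close>, so its
  image there is a singleton.\<close>

lemma lift_coset:
  assumes x: "x \<in> carrier F"
  shows "lift (B +>\<^bsub>F\<^esub> x) = flift x"
proof -
  have "flift y = flift x" if "y \<in> B +>\<^bsub>F\<^esub> x" for y
  proof -
    from that obtain z where z: "z \<in> B" "y = z \<oplus>\<^bsub>F\<^esub> x"
      by (auto simp: a_r_coset_def')
    then have "z \<in> carrier F"
      using B.a_subset by auto
    with z x show ?thesis
      by (simp add: flift.add flift_B flift.closed)
  qed
  moreover have "x \<in> B +>\<^bsub>F\<^esub> x"
    using x by (rule B.a_rcos_self)
  ultimately have "flift ` (B +>\<^bsub>F\<^esub> x) = {flift x}"
    by blast
  then show ?thesis
    by (simp add: tensor_lift_def free_lift_def)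
qed

lemma lift_pure [simp]: "\<lbrakk>m \<in> carrier M; n \<in> carrier N\<rbrakk> \<Longrightarrow> lift (pure m n) = b m n"
  by (simp add: pure_eq lift_coset flift_gen)

lemma lift_linear: "linear_on R T L lift"
proof -
  interpret c: additive_map F T "\<lambda>x. B +>\<^bsub>F\<^esub> x"
    by (rule coset_additive)
  have E: "\<exists>x\<in>carrier F. X = B +>\<^bsub>F\<^esub> x" if "X \<in> carrier T" for X
    using that unfolding tensor_eq by (elim quotient_module_carrierE) blast
  show ?thesis
  proof (rule linear_onI)
    fix X assume "X \<in> carrier T"
    from E[OF this] show "lift X \<in> carrier L"
      by (auto simp: lift_coset flift.closed)
  next
    fix X Y assume "X \<in> carrier T" "Y \<in> carrier T"
    from E[OF this(1)] E[OF this(2)] show "lift (X \<oplus>\<^bsub>T\<^esub> Y) = lift X \<oplus>\<^bsub>L\<^esub> lift Y"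
      by (auto simp: lift_coset flift.add simp flip: c.add)
  next
    fix r X assume r: "r \<in> carrier R" and "X \<in> carrier T"
    from E[OF this(2)] r show "lift (r \<odot>\<^bsub>T\<^esub> X) = r \<odot>\<^bsub>L\<^esub> lift X"
      by (auto simp: lift_coset flift_smult simp flip: coset_smult)
  qed
qed

end

text \<open>The uniqueness half of the universal property. The identities for
  \<open>tensor_lift\<close> below are reduced by it to pure tensors.\<close>

lemma (in tensor_pair) linear_on_tensor_eqI:
  assumes f: "linear_on R T L f" and g: "linear_on R T L g" and L: "abelian_group L"
    and eq: "\<And>m n. \<lbrakk>m \<in> carrier M; n \<in> carrier N\<rbrakk> \<Longrightarrow> f (pure m n) = g (pure m n)"
    and X: "X \<in> carrier T"
  shows "f X = g X"
  using X
proof (induction rule: tensor_induct)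
  case zero
  then show ?case
    using additive_map.map_zero[OF linear_on_additive_map] f g L T.abelian_group_axioms by metis
next
  case (add r m n X)
  then show ?case
    by (simp add: linear_onD[OF f] linear_onD[OF g] eq)
qed

lemma (in tensor_pair) bilinear_pure: "bilinear R M N T pure"
  by (unfold_locales; rule linear_onI) (simp_all add: pure_bilinear)

section \<open>Equivariant homomorphisms\<close>

text \<open>The structure that survives restriction to K. Here K is a mere set of operators, which
  is enough to form equivariant homomorphisms and to see that they are an abelian group. The laws of
  a group action are added in \<open>group_module\<close>.\<close>

locale equivariant_module = base_module R N
  for R :: "'r ring" (structure) and N :: "('r, 'n, 'h) rg_module" and K :: "'h set" +
  assumes act_linear: "k \<in> K \<Longrightarrow> linear_on R N N (act N k)"

locale group_module = H: group H + equivariant_module R N "carrier H"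
  for R :: "'r ring" (structure) and H :: "'h monoid" and N :: "('r, 'n, 'h) rg_module" +
  assumes act_mult: "\<lbrakk>h \<in> carrier H; k \<in> carrier H; x \<in> carrier N\<rbrakk> \<Longrightarrow>
      act N (h \<otimes>\<^bsub>H\<^esub> k) x = act N h (act N k x)"
    and act_one: "x \<in> carrier N \<Longrightarrow> act N \<one>\<^bsub>H\<^esub> x = x"
begin

lemma act_closed: "\<lbrakk>h \<in> carrier H; x \<in> carrier N\<rbrakk> \<Longrightarrow> act N h x \<in> carrier N"
  by (rule linear_onD(1)[OF act_linear])

lemma equivariant: "K \<subseteq> carrier H \<Longrightarrow> equivariant_module R N K"
  by unfold_locales (auto intro: act_linear)

end

lemma rg_module_group_module:
  assumes "rg_module R H N"
  shows "group_module R H N"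
proof -
  interpret module R N
    using assms by (simp add: rg_module_def)
  interpret action: group_action H "carrier N" "act N"
    using assms by (simp add: rg_module_def)
  interpret H: group H
    using action.group_hom by (simp add: group_hom_def)
  show ?thesis
  proof
    fix h assume h: "h \<in> carrier H"
    show "linear_on R N N (act N h)"
      by (intro linear_onI action.element_image[OF h _ refl])
        (use assms h in \<open>simp_all add: rg_module_def\<close>)
  next
    show "act N \<one>\<^bsub>H\<^esub> x = x" if "x \<in> carrier N" for x
      using that by (simp flip: action.id_eq_one)
  qed (rule action.composition_rule)
qed

lemma rg_hom_iff:
  "f \<in> rg_hom R K M N \<longleftrightarrow>
     f \<in> extensional (carrier M) \<and> linear_on R M N f \<and>
     (\<forall>k\<in>K. \<forall>x\<in>carrier M. f (act M k x) = act N k (f x))"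
  by (auto simp: rg_hom_def linear_on_def PiE_iff)

lemma rg_homI:
  assumes "f \<in> extensional (carrier M)" "linear_on R M N f"
    and "\<And>k x. \<lbrakk>k \<in> K; x \<in> carrier M\<rbrakk> \<Longrightarrow> f (act M k x) = act N k (f x)"
  shows "f \<in> rg_hom R K M N"
  using assms by (simp add: rg_hom_iff)

lemma rg_homD:
  assumes "f \<in> rg_hom R K M N"
  shows "f \<in> extensional (carrier M)" "linear_on R M N f"
    and "\<lbrakk>k \<in> K; x \<in> carrier M\<rbrakk> \<Longrightarrow> f (act M k x) = act N k (f x)"
  using assms by (simp_all add: rg_hom_iff)

lemma rg_hom_closed: "\<lbrakk>f \<in> rg_hom R K M N; x \<in> carrier M\<rbrakk> \<Longrightarrow> f x \<in> carrier N"
  by (auto dest: rg_homD(2) linear_onD(1))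

lemma rg_hom_mono: "L \<subseteq> K \<Longrightarrow> rg_hom R K M N \<subseteq> rg_hom R L M N"
  by (auto simp: rg_hom_iff subset_iff)

lemma hom_module_simps:
  "carrier (hom_module R K M N) = rg_hom R K M N"
  "\<zero>\<^bsub>hom_module R K M N\<^esub> = (\<lambda>x\<in>carrier M. \<zero>\<^bsub>N\<^esub>)"
  "f \<oplus>\<^bsub>hom_module R K M N\<^esub> g = (\<lambda>x\<in>carrier M. f x \<oplus>\<^bsub>N\<^esub> g x)"
  by (simp_all add: hom_module_def)

locale hom_pair = M: equivariant_module R M K + N: equivariant_module R N K
  for R :: "'r ring" (structure) and K :: "'h set"
    and M :: "('r, 'm, 'h) rg_module" and N :: "('r, 'n, 'h) rg_module"
begin

abbreviation Hom where "Hom \<equiv> hom_module R K M N"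

lemma act_closed_M [simp]: "\<lbrakk>k \<in> K; x \<in> carrier M\<rbrakk> \<Longrightarrow> act M k x \<in> carrier M"
  by (rule linear_onD(1)[OF M.act_linear])

lemma act_additive_N: "k \<in> K \<Longrightarrow> additive_map N N (act N k)"
  by (rule linear_on_additive_map[OF N.act_linear N.abelian_group_axioms N.abelian_group_axioms])

lemma linear_restrictI:
  assumes "\<And>x. x \<in> carrier M \<Longrightarrow> f x \<in> carrier N"
    and "\<And>x y. \<lbrakk>x \<in> carrier M; y \<in> carrier M\<rbrakk> \<Longrightarrow> f (x \<oplus>\<^bsub>M\<^esub> y) = f x \<oplus>\<^bsub>N\<^esub> f y"
    and "\<And>r x. \<lbrakk>r \<in> carrier R; x \<in> carrier M\<rbrakk> \<Longrightarrow> f (r \<odot>\<^bsub>M\<^esub> x) = r \<odot>\<^bsub>N\<^esub> f x"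
    and "\<And>k x. \<lbrakk>k \<in> K; x \<in> carrier M\<rbrakk> \<Longrightarrow> f (act M k x) = act N k (f x)"
  shows "(\<lambda>x\<in>carrier M. f x) \<in> rg_hom R K M N"
  using assms by (intro rg_homI linear_onI) simp_all

lemma abelian_group_Hom: "abelian_group Hom"
proof (rule abelian_groupI; unfold hom_module_simps)
  fix f g h
  assume f: "f \<in> rg_hom R K M N" and g: "g \<in> rg_hom R K M N" and h: "h \<in> rg_hom R K M N"
  note c = rg_hom_closed[OF f] rg_hom_closed[OF g] rg_hom_closed[OF h]
  note D = linear_onD[OF rg_homD(2)]
  show "(\<lambda>x\<in>carrier M. f x \<oplus>\<^bsub>N\<^esub> g x) \<in> rg_hom R K M N"
  proof (rule linear_restrictI)
    fix k x assume k: "k \<in> K" and x: "x \<in> carrier M"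
    then show "f (act M k x) \<oplus>\<^bsub>N\<^esub> g (act M k x) = act N k (f x \<oplus>\<^bsub>N\<^esub> g x)"
      using additive_map.add[OF act_additive_N[OF k]] c by (simp add: rg_homD(3)[OF f] rg_homD(3)[OF g])
  qed (use c D[OF f] D[OF g] in \<open>simp_all add: N.a_ac N.smult_r_distr\<close>)
  show "(\<lambda>x\<in>carrier M. (\<lambda>x\<in>carrier M. f x \<oplus>\<^bsub>N\<^esub> g x) x \<oplus>\<^bsub>N\<^esub> h x) =
      (\<lambda>x\<in>carrier M. f x \<oplus>\<^bsub>N\<^esub> (\<lambda>x\<in>carrier M. g x \<oplus>\<^bsub>N\<^esub> h x) x)"
    using c by (auto simp: fun_eq_iff N.a_assoc)
  show "(\<lambda>x\<in>carrier M. f x \<oplus>\<^bsub>N\<^esub> g x) = (\<lambda>x\<in>carrier M. g x \<oplus>\<^bsub>N\<^esub> f x)"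
    using c by (auto simp: fun_eq_iff N.a_comm)
  show "(\<lambda>x\<in>carrier M. (\<lambda>x\<in>carrier M. \<zero>\<^bsub>N\<^esub>) x \<oplus>\<^bsub>N\<^esub> f x) = f"
    using c rg_homD(1)[OF f] by (auto simp: fun_eq_iff extensional_def)
  have "(\<lambda>x\<in>carrier M. \<ominus>\<^bsub>N\<^esub> f x) \<in> rg_hom R K M N"
  proof (rule linear_restrictI)
    fix k x assume k: "k \<in> K" and x: "x \<in> carrier M"
    then show "\<ominus>\<^bsub>N\<^esub> f (act M k x) = act N k (\<ominus>\<^bsub>N\<^esub> f x)"
      using additive_map.map_neg[OF act_additive_N[OF k]] c by (simp add: rg_homD(3)[OF f])
  qed (use c D[OF f] in \<open>simp_all add: N.minus_add N.smult_r_minus\<close>)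
  then show "\<exists>f'\<in>rg_hom R K M N. (\<lambda>x\<in>carrier M. f' x \<oplus>\<^bsub>N\<^esub> f x) = (\<lambda>x\<in>carrier M. \<zero>\<^bsub>N\<^esub>)"
    by (rule bexI[rotated]) (use c in \<open>auto simp: fun_eq_iff N.l_neg\<close>)
next
  show "(\<lambda>x\<in>carrier M. \<zero>\<^bsub>N\<^esub>) \<in> rg_hom R K M N"
    by (rule linear_restrictI) (simp_all add: additive_map.map_zero[OF act_additive_N])
qed

sublocale Hom: abelian_group Hom
  by (rule abelian_group_Hom)

lemma eval_additive: "x \<in> carrier M \<Longrightarrow> additive_map Hom N (\<lambda>f. f x)"
  by unfold_locales (auto simp: hom_module_simps rg_hom_closed)

text \<open>Evaluation at a point is additive. An equation between sums of cochains thereby becomes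
  one between sums in the coefficient module.\<close>

lemma hom_finsum:
  assumes "\<And>i. i \<in> I \<Longrightarrow> f i \<in> rg_hom R K M N"
  shows "(\<Oplus>\<^bsub>Hom\<^esub>i\<in>I. f i) = (\<lambda>x\<in>carrier M. \<Oplus>\<^bsub>N\<^esub>i\<in>I. f i x)"
proof
  fix x
  have "(\<Oplus>\<^bsub>Hom\<^esub>i\<in>I. f i) \<in> rg_hom R K M N"
    using Hom.finsum_closed[of f I] assms by (auto simp: hom_module_simps)
  then have "(\<Oplus>\<^bsub>Hom\<^esub>i\<in>I. f i) \<in> extensional (carrier M)"
    by (rule rg_homD)
  then show "(\<Oplus>\<^bsub>Hom\<^esub>i\<in>I. f i) x = (\<lambda>x\<in>carrier M. \<Oplus>\<^bsub>N\<^esub>i\<in>I. f i x) x"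
    using additive_map.map_finsum[OF eval_additive, of x I f] assms
    by (auto simp: hom_module_simps extensional_def)
qed

end

section \<open>Tate cohomology classes\<close>

locale group_complex = H: group H + base_cring R
  for R :: "'r ring" (structure) and H :: "'h monoid" and P :: "('r, 'p, 'h) rg_complex" +
  assumes chain_complex: "chain_complex R H P"
begin

lemma ob_group_module: "group_module R H (ob P n)"
  using chain_complex by (intro rg_module_group_module) (simp add: chain_complex_def)

lemma bd_hom: "bd P n \<in> rg_hom R (carrier H) (ob P n) (ob P (n - 1))"
  using chain_complex by (simp add: chain_complex_def)

lemma bd_closed: "x \<in> carrier (ob P n) \<Longrightarrow> bd P n x \<in> carrier (ob P (n - 1))"
  by (rule rg_hom_closed[OF bd_hom])

lemma bd_bd: "x \<in> carrier (ob P n) \<Longrightarrow> bd P (n - 1) (bd P n x) = \<zero>\<^bsub>ob P (n - 2)\<^esub>"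
  using chain_complex by (simp add: chain_complex_def)

end

sublocale group_complex \<subseteq> P: group_module R H "ob P n" for n
  by (rule ob_group_module)

text \<open>The K-equivariant cochains on a complex of H-modules. Passing to a smaller K keeps
  \<open>P\<close> and enlarges the groups.\<close>

locale cochains = group_complex R H P + N: equivariant_module R N K
  for R :: "'r ring" (structure) and H :: "'h monoid" and P :: "('r, 'p, 'h) rg_complex"
    and K :: "'h set" and N :: "('r, 'n, 'h) rg_module" +
  assumes K_subset: "K \<subseteq> carrier H"
begin

abbreviation C where "C n \<equiv> hom_module R K (ob P n) N"
abbreviation Z where "Z \<equiv> cocycles R P K N"
abbreviation B where "B \<equiv> coboundaries R P K N"
abbreviation cls where "cls \<equiv> tate_class R P K N"

lemma hom_pair: "hom_pair R K (ob P n) N"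
  using P.equivariant[OF K_subset] N.equivariant_module_axioms by (simp add: hom_pair_def)

end

sublocale cochains \<subseteq> C: hom_pair R K "ob P n" N for n
  by (rule hom_pair)

context cochains
begin

lemma cobd_closed:
  assumes f: "f \<in> rg_hom R K (ob P n) N"
  shows "cobd P n f \<in> rg_hom R K (ob P (n + 1)) N"
proof -
  note b = bd_hom[of "n + 1", simplified]
  note bc = rg_hom_closed[OF b]
  show ?thesis
    unfolding cobd_def
  proof (rule C.linear_restrictI)
    fix k x assume "k \<in> K" "x \<in> carrier (ob P (n + 1))"
    then show "f (bd P (n + 1) (act (ob P (n + 1)) k x)) = act N k (f (bd P (n + 1) x))"
      using K_subset bc by (auto simp: rg_homD(3)[OF b] rg_homD(3)[OF f])
  qed (simp_all add: bc rg_hom_closed[OF f] linear_onD[OF rg_homD(2)[OF f]] linear_onD[OF rg_homD(2)[OF b]])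
qed

lemma cobd_additive: "additive_map (C n) (C (n + 1)) (cobd P n)"
proof unfold_locales
  fix f g assume "f \<in> carrier (C n)" "g \<in> carrier (C n)"
  then show "cobd P n (f \<oplus>\<^bsub>C n\<^esub> g) = cobd P n f \<oplus>\<^bsub>C (n + 1)\<^esub> cobd P n g"
    using bd_closed[of _ "n + 1", simplified] by (intro ext) (simp add: hom_module_simps cobd_def)
qed (simp add: hom_module_simps cobd_closed)

lemma B_iff: "f \<in> B n \<longleftrightarrow> (\<exists>c\<in>rg_hom R K (ob P (n - 1)) N. f = cobd P (n - 1) c)"
  by (auto simp: coboundaries_def)

lemma Z_iff: "f \<in> Z n \<longleftrightarrow> f \<in> rg_hom R K (ob P n) N \<and> (\<forall>x\<in>carrier (ob P (n + 1)). f (bd P (n + 1) x) = \<zero>\<^bsub>N\<^esub>)"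
  by (auto simp: cocycles_def cobd_def hom_module_simps fun_eq_iff restrict_def)

lemma linear_zero:
  assumes "f \<in> rg_hom R K (ob P n) N"
  shows "f \<zero>\<^bsub>ob P n\<^esub> = \<zero>\<^bsub>N\<^esub>"
  by (rule additive_map.map_zero[OF linear_on_additive_map[OF rg_homD(2)[OF assms]
        P.abelian_group_axioms N.abelian_group_axioms]])

lemma B_subset_Z: "B n \<subseteq> Z n"
proof
  fix f assume "f \<in> B n"
  then obtain c where c: "c \<in> rg_hom R K (ob P (n - 1)) N" "f = cobd P (n - 1) c"
    by (auto simp: B_iff)
  then have f: "f \<in> rg_hom R K (ob P n) N"
    using cobd_closed[OF c(1)] by simp
  moreover have "f (bd P (n + 1) x) = \<zero>\<^bsub>N\<^esub>" if x: "x \<in> carrier (ob P (n + 1))" for x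
    using bd_closed[OF x] bd_bd[OF x] linear_zero[OF c(1)] by (simp add: c(2) cobd_def)
  ultimately show "f \<in> Z n"
    by (simp add: Z_iff)
qed

lemma subgroup_Z: "subgroup (Z n) (add_monoid (C n))"
proof (rule C.Hom.add.subgroupI)
  interpret d: additive_map "C n" "C (n + 1)" "cobd P n"
    by (rule cobd_additive)
  have Z: "f \<in> Z n \<longleftrightarrow> f \<in> carrier (C n) \<and> cobd P n f = \<zero>\<^bsub>C (n + 1)\<^esub>" for f
    by (simp add: cocycles_def hom_module_simps(1))
  show "Z n \<subseteq> carrier (C n)"
    by (auto simp: Z)
  show "Z n \<noteq> {}"
    using Z[of "\<zero>\<^bsub>C n\<^esub>"] d.map_zero by auto
  show "\<ominus>\<^bsub>C n\<^esub> f \<in> Z n" if "f \<in> Z n" for f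
    using that unfolding Z by (simp add: d.map_neg)
  show "f \<oplus>\<^bsub>C n\<^esub> g \<in> Z n" if "f \<in> Z n" "g \<in> Z n" for f g
    using that unfolding Z by (simp add: d.add)
qed

end

lemma (in additive_map) image_subgroup: "subgroup (f ` carrier A) (add_monoid B)"
proof (rule B.add.subgroupI)
  show "\<ominus>\<^bsub>B\<^esub> y \<in> f ` carrier A" if "y \<in> f ` carrier A" for y
    using that by (auto simp flip: map_neg)
  show "y \<oplus>\<^bsub>B\<^esub> z \<in> f ` carrier A" if "y \<in> f ` carrier A" "z \<in> f ` carrier A" for y z
    using that by (auto simp flip: add)
qed (auto simp: closed)

text \<open>\<open>tate\<close> divides the record of all cochains, with its carrier cut down to the
  cocycles, by the coboundaries; this supplies the group that is divided.\<close>

lemma (in abelian_group) abelian_group_carrier_update: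
  assumes "subgroup Z (add_monoid G)"
  shows "abelian_group (G\<lparr>carrier := Z\<rparr>)"
proof -
  interpret Z: subgroup Z "add_monoid G"
    by fact
  have sub: "x \<in> carrier G" if "x \<in> Z" for x
    using that Z.subset by auto
  have simps: "carrier (G\<lparr>carrier := Z\<rparr>) = Z" "add (G\<lparr>carrier := Z\<rparr>) = add G"
    "\<zero>\<^bsub>G\<lparr>carrier := Z\<rparr>\<^esub> = \<zero>"
    by simp_all
  show ?thesis
  proof (rule abelian_groupI; unfold simps)
    fix x y z assume x: "x \<in> Z" and y: "y \<in> Z" and z: "z \<in> Z"
    show "x \<oplus> y \<in> Z"
      using Z.m_closed[OF x y] by simp
    show "x \<oplus> y \<oplus> z = x \<oplus> (y \<oplus> z)"
      using x y z by (intro a_assoc sub)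
    show "x \<oplus> y = y \<oplus> x"
      using x y by (intro a_comm sub)
    show "\<zero> \<oplus> x = x"
      using x by (intro l_zero sub)
    show "\<exists>y\<in>Z. y \<oplus> x = \<zero>"
    proof
      show "\<ominus> x \<in> Z"
        using Z.m_inv_closed[OF x] by (simp flip: a_inv_def)
      show "\<ominus> x \<oplus> x = \<zero>"
        using x by (intro l_neg sub)
    qed
  next
    show "\<zero> \<in> Z"
      using Z.one_closed by simp
  qed
qed

definition cocycle_module ::
    "'r ring \<Rightarrow> ('r, 'p, 'h) rg_complex \<Rightarrow> 'h set \<Rightarrow> ('r, 'n, 'h) rg_module \<Rightarrow> int \<Rightarrow>
       ('r, 'p \<Rightarrow> 'n) module" where
  "cocycle_module R P K N n = (hom_module R K (ob P n) N)\<lparr>carrier := cocycles R P K N n\<rparr>"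

lemma cocycle_module_simps [simp]:
  "carrier (cocycle_module R P K N n) = cocycles R P K N n"
  "\<zero>\<^bsub>cocycle_module R P K N n\<^esub> = \<zero>\<^bsub>hom_module R K (ob P n) N\<^esub>"
  "add (cocycle_module R P K N n) = add (hom_module R K (ob P n) N)"
  by (simp_all add: cocycle_module_def)

context cochains
begin

abbreviation ZC where "ZC \<equiv> cocycle_module R P K N"

lemma abelian_group_ZC: "abelian_group (ZC n)"
  unfolding cocycle_module_def
  by (rule C.Hom.abelian_group_carrier_update) (rule subgroup_Z)

sublocale ZC: abelian_group "ZC n" for n
  by (rule abelian_group_ZC)

lemma cobd_ZC: "additive_map (C n) (ZC (n + 1)) (cobd P n)"
proof -
  interpret d: additive_map "C n" "C (n + 1)" "cobd P n"
    by (rule cobd_additive)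
  show ?thesis
  proof unfold_locales
    fix f assume "f \<in> carrier (C n)"
    then have "cobd P n f \<in> B (n + 1)"
      unfolding coboundaries_def by (simp add: hom_module_simps(1))
    then show "cobd P n f \<in> carrier (ZC (n + 1))"
      using B_subset_Z by auto
  qed (simp add: d.add)
qed

lemma subgroup_B: "subgroup (B n) (add_monoid (ZC n))"
  using additive_map.image_subgroup[OF cobd_ZC[of "n - 1"]]
  by (simp add: coboundaries_def hom_module_simps(1))

lemma abelian_subgroup_B: "abelian_subgroup (B n) (ZC n)"
  by (rule abelian_subgroupI2[OF ZC.a_comm_group subgroup_B])

lemma tate_eq: "tate R P K N n = quotient_module (ZC n) (B n)"
  by (simp add: tate_def cocycle_module_def)

lemma cls_eq: "cls n f = B n +>\<^bsub>ZC n\<^esub> f"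
  by (simp add: tate_class_def a_r_coset_def')

lemma cls_additive: "additive_map (ZC n) (tate R P K N n) (cls n)"
  unfolding tate_eq cls_eq by (rule additive_map_coset) (rule abelian_subgroup_B)

sublocale tate: abelian_group "tate R P K N n" for n
  unfolding tate_eq by (rule abelian_group_quotient_module) (rule abelian_subgroup_B)

lemma cls_add_coboundary:
  assumes b: "b \<in> B n" and f: "f \<in> Z n"
  shows "cls n (b \<oplus>\<^bsub>C n\<^esub> f) = cls n f"
proof -
  interpret B: abelian_subgroup "B n" "ZC n"
    by (rule abelian_subgroup_B)
  have "b \<oplus>\<^bsub>C n\<^esub> f \<in> B n +>\<^bsub>ZC n\<^esub> f"
    using b by (auto simp: a_r_coset_def')
  from B.a_repr_independence'[OF this] f show ?thesis
    by (simp add: cls_eq)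
qed

lemma cls_iff: "f' \<in> cls n f \<longleftrightarrow> (\<exists>b\<in>B n. f' = b \<oplus>\<^bsub>C n\<^esub> f)"
  by (auto simp: tate_class_def a_r_coset_def')

lemma tate_carrierE:
  assumes "x \<in> carrier (tate R P K N n)"
  obtains f where "f \<in> Z n" "x = cls n f"
  using assms unfolding tate_eq cls_eq by (elim quotient_module_carrierE) auto

end

text \<open>A choice of cocycles for the homogeneous parts of \<alpha>. Outside S they are the zero
  cochain itself and not just coboundaries, so that sums and products over the degrees in S lose
  nothing; a finite S places \<alpha> in the direct sum.\<close>

definition represents ::
    "'r ring \<Rightarrow> ('r, 'p, 'h) rg_complex \<Rightarrow> 'h set \<Rightarrow> ('r, 'n, 'h) rg_module \<Rightarrow> int set \<Rightarrow>
       (int \<Rightarrow> 'p \<Rightarrow> 'n) \<Rightarrow> (int \<Rightarrow> ('p \<Rightarrow> 'n) set) \<Rightarrow> bool" where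
  "represents R P K N S a \<alpha> \<longleftrightarrow>
     (\<forall>n. a n \<in> cocycles R P K N n \<and> \<alpha> n = tate_class R P K N n (a n)) \<and>
     (\<forall>n. n \<notin> S \<longrightarrow> a n = \<zero>\<^bsub>hom_module R K (ob P n) N\<^esub>)"

lemma representsD:
  assumes "represents R P K N S a \<alpha>"
  shows "a n \<in> cocycles R P K N n" "\<alpha> n = tate_class R P K N n (a n)"
    and "n \<notin> S \<Longrightarrow> a n = \<zero>\<^bsub>hom_module R K (ob P n) N\<^esub>"
  using assms by (auto simp: represents_def)

context cochains
begin

lemma cocycle_hom: "f \<in> Z n \<Longrightarrow> f \<in> rg_hom R K (ob P n) N"
  by (simp add: cocycles_def)

lemma tate_total_simps:
  "carrier (tate_total R P K N) = {\<alpha>. (\<forall>n. \<alpha> n \<in> carrier (tate R P K N n)) \<and>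
      finite {n. \<alpha> n \<noteq> \<zero>\<^bsub>tate R P K N n\<^esub>}}"
  "\<zero>\<^bsub>tate_total R P K N\<^esub> = (\<lambda>n. \<zero>\<^bsub>tate R P K N n\<^esub>)"
  "\<alpha> \<oplus>\<^bsub>tate_total R P K N\<^esub> \<beta> = (\<lambda>n. \<alpha> n \<oplus>\<^bsub>tate R P K N n\<^esub> \<beta> n)"
  by (auto simp: tate_total_def direct_sum_simps PiE_iff)

sublocale total: abelian_group "tate_total R P K N"
  unfolding tate_total_def by (rule abelian_group_direct_sum) (rule tate.abelian_group_axioms)

lemma ex_represents:
  assumes "\<alpha> \<in> carrier (tate_total R P K N)"
  obtains S a where "finite S" "represents R P K N S a \<alpha>"
proof -
  \<comment> \<open>Where the class vanishes the zero cochain is chosen, as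
    \<open>represents\<close> demands outside S.\<close>
  have "\<exists>f. f \<in> Z n \<and> \<alpha> n = cls n f \<and> (\<alpha> n = \<zero>\<^bsub>tate R P K N n\<^esub> \<longrightarrow> f = \<zero>\<^bsub>C n\<^esub>)" for n
  proof (cases "\<alpha> n = \<zero>\<^bsub>tate R P K N n\<^esub>")
    case True
    interpret c: additive_map "ZC n" "tate R P K N n" "cls n"
      by (rule cls_additive)
    show ?thesis
      using True c.map_zero ZC.zero_closed[of n] by auto
  next
    case False
    have "\<alpha> n \<in> carrier (tate R P K N n)"
      using assms by (simp add: tate_total_simps)
    then show ?thesis
      using False by (elim tate_carrierE) auto
  qed
  then obtain a where "\<And>n. a n \<in> Z n \<and> \<alpha> n = cls n (a n) \<and>
      (\<alpha> n = \<zero>\<^bsub>tate R P K N n\<^esub> \<longrightarrow> a n = \<zero>\<^bsub>C n\<^esub>)"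
    by metis
  then have "represents R P K N {n. \<alpha> n \<noteq> \<zero>\<^bsub>tate R P K N n\<^esub>} a \<alpha>"
    by (simp add: represents_def)
  from that[OF _ this] show ?thesis
    using assms by (simp add: tate_total_simps)
qed

lemma represents_carrier:
  assumes r: "represents R P K N S a \<alpha>" and S: "finite S"
  shows "\<alpha> \<in> carrier (tate_total R P K N)"
proof -
  have "\<alpha> n \<in> carrier (tate R P K N n)" for n
    using additive_map.closed[OF cls_additive] representsD[OF r, of n] by simp
  moreover have "\<alpha> n = \<zero>\<^bsub>tate R P K N n\<^esub>" if "n \<notin> S" for n
    using additive_map.map_zero[OF cls_additive] representsD[OF r, of n] that by simp
  then have "finite {n. \<alpha> n \<noteq> \<zero>\<^bsub>tate R P K N n\<^esub>}"
    using S by (auto intro: finite_subset[of _ S])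
  ultimately show ?thesis
    by (simp add: tate_total_simps)
qed

text \<open>Evaluation in degree n and the class map are additive, so sums may be taken on
  representatives. The set S is common to all summands and therefore also bounds the support of the
  sum.\<close>

lemma represents_finsum:
  assumes r: "\<And>i. i \<in> I \<Longrightarrow> represents R P K N S (a i) (\<alpha> i)" and S: "finite S"
  shows "represents R P K N S (\<lambda>n. \<Oplus>\<^bsub>C n\<^esub>i\<in>I. a i n) (\<Oplus>\<^bsub>tate_total R P K N\<^esub>i\<in>I. \<alpha> i)"
proof -
  have t: "\<alpha> i \<in> carrier (tate_total R P K N)" if "i \<in> I" for i
    by (rule represents_carrier[OF r[OF that] S])
  have ev: "additive_map (tate_total R P K N) (tate R P K N n) (\<lambda>\<alpha>. \<alpha> n)" for n
    by unfold_locales (auto simp: tate_total_simps)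
  have inj: "additive_map (ZC n) (C n) (\<lambda>f. f)" for n
    by unfold_locales (auto simp: cocycle_hom hom_module_simps(1))
  have aZ: "a i n \<in> carrier (ZC n)" if "i \<in> I" for i n
    using representsD(1)[OF r[OF that]] by simp
  have sum: "(\<Oplus>\<^bsub>C n\<^esub>i\<in>I. a i n) = (\<Oplus>\<^bsub>ZC n\<^esub>i\<in>I. a i n)" for n
    by (rule additive_map.map_finsum[OF inj aZ, symmetric])
  show ?thesis
    unfolding represents_def
  proof (intro conjI allI impI)
    fix n
    show "(\<Oplus>\<^bsub>C n\<^esub>i\<in>I. a i n) \<in> Z n"
      using ZC.finsum_closed[of "\<lambda>i. a i n" I n] aZ by (simp add: sum Pi_iff)
    have "(\<Oplus>\<^bsub>tate_total R P K N\<^esub>i\<in>I. \<alpha> i) n = (\<Oplus>\<^bsub>tate R P K N n\<^esub>i\<in>I. \<alpha> i n)"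
      by (rule additive_map.map_finsum[OF ev t])
    also have "\<dots> = (\<Oplus>\<^bsub>tate R P K N n\<^esub>i\<in>I. cls n (a i n))"
      using representsD[OF r] additive_map.closed[OF cls_additive]
      by (intro tate.finsum_cong') auto
    also have "\<dots> = cls n (\<Oplus>\<^bsub>ZC n\<^esub>i\<in>I. a i n)"
      by (rule additive_map.map_finsum[OF cls_additive aZ, symmetric])
    finally show "(\<Oplus>\<^bsub>tate_total R P K N\<^esub>i\<in>I. \<alpha> i) n = cls n (\<Oplus>\<^bsub>C n\<^esub>i\<in>I. a i n)"
      by (simp add: sum)
    show "(\<Oplus>\<^bsub>C n\<^esub>i\<in>I. a i n) = \<zero>\<^bsub>C n\<^esub>" if "n \<notin> S"
      using representsD(3)[OF r] that by (intro C.Hom.add.finprod_one_eqI) simp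
  qed
qed

end

section \<open>Maps of cochain complexes\<close>

definition cochain_map ::
    "'r ring \<Rightarrow> ('r, 'p, 'h) rg_complex \<Rightarrow> 'h set \<Rightarrow> ('r, 'm, 'h) rg_module \<Rightarrow> 'h set \<Rightarrow>
       ('r, 'n, 'h) rg_module \<Rightarrow> (int \<Rightarrow> ('p \<Rightarrow> 'm) \<Rightarrow> ('p \<Rightarrow> 'n)) \<Rightarrow> bool" where
  "cochain_map R P K M L N F \<longleftrightarrow>
     (\<forall>n. additive_map (hom_module R K (ob P n) M) (hom_module R L (ob P n) N) (F n)) \<and>
     (\<forall>n. \<forall>f\<in>rg_hom R K (ob P n) M. F (n + 1) (cobd P n f) = cobd P n (F n f))"

text \<open>A map of complexes takes cocycles to cocycles and coboundaries to coboundaries. Hence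
  the classes united in \<open>tate_map\<close> agree, and the union is the class of the image of
  the chosen cocycle.\<close>

lemma represents_tate_map:
  assumes "cochains R H P K M" "cochains R H P L N"
    and F: "cochain_map R P K M L N F" and r: "represents R P K M S a \<alpha>"
  shows "represents R P L N S (\<lambda>n. F n (a n)) (tate_map R P L N F \<alpha>)"
proof -
  interpret M: cochains R H P K M by fact
  interpret N: cochains R H P L N by fact
  have add: "additive_map (M.C n) (N.C n) (F n)" for n
    using F by (simp add: cochain_map_def)
  have d: "F (n + 1) (cobd P n f) = cobd P n (F n f)" if "f \<in> rg_hom R K (ob P n) M" for n f
    using F that by (simp add: cochain_map_def)
  have cl: "F n f \<in> rg_hom R L (ob P n) N" if "f \<in> rg_hom R K (ob P n) M" for n f
    using additive_map.closed[OF add] that by (simp add: hom_module_simps(1))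
  have Z: "F n f \<in> N.Z n" if "f \<in> M.Z n" for n f
  proof -
    have "cobd P n (F n f) = \<zero>\<^bsub>N.C (n + 1)\<^esub>"
      using that d[of f n] additive_map.map_zero[OF add[of "n + 1"]] by (simp add: cocycles_def)
    with cl that show ?thesis
      by (simp add: cocycles_def)
  qed
  have B: "F n f \<in> N.B n" if "f \<in> M.B n" for n f
    using that d[of _ "n - 1"] cl by (auto simp: M.B_iff N.B_iff)
  show ?thesis
    unfolding represents_def
  proof (intro conjI allI impI)
    fix n
    have aZ: "a n \<in> M.Z n"
      by (rule representsD[OF r])
    then show "F n (a n) \<in> N.Z n"
      by (rule Z)
    have "N.cls n (F n (b \<oplus>\<^bsub>M.C n\<^esub> a n)) = N.cls n (F n (a n))" if b: "b \<in> M.B n" for b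
    proof -
      have "b \<in> carrier (M.C n)" "a n \<in> carrier (M.C n)"
        using b aZ M.B_subset_Z M.cocycle_hom by (auto simp: hom_module_simps(1))
      then show ?thesis
        by (simp add: additive_map.add[OF add] N.cls_add_coboundary B Z b aZ)
    qed
    \<comment> \<open>Equal classes unite to that class only if there is at least one of
      them.\<close>
    moreover have "M.B n \<noteq> {}"
      using subgroup.one_closed[OF M.subgroup_B] by auto
    moreover have "\<alpha> n = (\<lambda>b. b \<oplus>\<^bsub>M.C n\<^esub> a n) ` M.B n"
      using representsD(2)[OF r] M.cls_iff by auto
    ultimately show "tate_map R P L N F \<alpha> n = N.cls n (F n (a n))"
      by (simp add: tate_map_def)
    show "F n (a n) = \<zero>\<^bsub>N.C n\<^esub>" if "n \<notin> S"
      using representsD(3)[OF r that] additive_map.map_zero[OF add] by simp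
  qed
qed

text \<open>Cochains are extensional functions, so additivity and compatibility with the
  differentials need checking only at elements of the complex.\<close>

lemma cochain_mapI:
  assumes "cochains R H P K M" "cochains R H P L N"
    and cl: "\<And>n f. f \<in> rg_hom R K (ob P n) M \<Longrightarrow> F n f \<in> rg_hom R L (ob P n) N"
    and add: "\<And>n f g x. \<lbrakk>f \<in> rg_hom R K (ob P n) M; g \<in> rg_hom R K (ob P n) M; x \<in> carrier (ob P n)\<rbrakk> \<Longrightarrow>
      F n (\<lambda>x\<in>carrier (ob P n). f x \<oplus>\<^bsub>M\<^esub> g x) x = F n f x \<oplus>\<^bsub>N\<^esub> F n g x"
    and d: "\<And>n f x. \<lbrakk>f \<in> rg_hom R K (ob P n) M; x \<in> carrier (ob P (n + 1))\<rbrakk> \<Longrightarrow>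
      F (n + 1) (\<lambda>x\<in>carrier (ob P (n + 1)). f (bd P (n + 1) x)) x = F n f (bd P (n + 1) x)"
  shows "cochain_map R P K M L N F"
proof -
  interpret M: cochains R H P K M by fact
  interpret N: cochains R H P L N by fact
  have "F n (\<lambda>x\<in>carrier (ob P n). f x \<oplus>\<^bsub>M\<^esub> g x) = (\<lambda>x\<in>carrier (ob P n). F n f x \<oplus>\<^bsub>N\<^esub> F n g x)"
    if fg: "f \<in> rg_hom R K (ob P n) M" "g \<in> rg_hom R K (ob P n) M" for n f g
  proof
    fix x
    have "(\<lambda>x\<in>carrier (ob P n). f x \<oplus>\<^bsub>M\<^esub> g x) \<in> rg_hom R K (ob P n) M"
      using M.C.Hom.a_closed[of f n g] fg by (simp add: hom_module_simps)
    from rg_homD(1)[OF cl[OF this]]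
    show "F n (\<lambda>x\<in>carrier (ob P n). f x \<oplus>\<^bsub>M\<^esub> g x) x = (\<lambda>x\<in>carrier (ob P n). F n f x \<oplus>\<^bsub>N\<^esub> F n g x) x"
      using add[OF fg] by (cases "x \<in> carrier (ob P n)") (simp_all add: extensional_def)
  qed
  then have "additive_map (M.C n) (N.C n) (F n)" for n
    by unfold_locales (simp_all add: hom_module_simps cl)
  moreover have "F (n + 1) (cobd P n f) = cobd P n (F n f)" if f: "f \<in> rg_hom R K (ob P n) M" for n f
  proof
    fix x
    from rg_homD(1)[OF cl[OF M.cobd_closed[OF f]]]
    show "F (n + 1) (cobd P n f) x = cobd P n (F n f) x"
      using d[OF f] unfolding cobd_def
      by (cases "x \<in> carrier (ob P (n + 1))") (simp_all add: extensional_def)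
  qed
  ultimately show ?thesis
    by (simp add: cochain_map_def)
qed

context cochains
begin

lemma cochains_mono: "L \<subseteq> K \<Longrightarrow> cochains R H P L N"
  using K_subset by unfold_locales (auto intro: N.act_linear)

lemma cochain_map_res:
  assumes "L \<subseteq> K"
  shows "cochain_map R P K N L N (\<lambda>n f. f)"
  using cochains_axioms cochains_mono[OF assms]
proof (rule cochain_mapI)
  show "f \<in> rg_hom R L (ob P n) N" if "f \<in> rg_hom R K (ob P n) N" for f n
    using rg_hom_mono[OF assms] that by auto
qed simp_all

lemma cochain_map_coeff:
  assumes "cochains R H P K N'" and lin: "linear_on R N N' \<theta>"
    and eq: "\<And>k x. \<lbrakk>k \<in> K; x \<in> carrier N\<rbrakk> \<Longrightarrow> \<theta> (act N k x) = act N' k (\<theta> x)"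
  shows "cochain_map R P K N K N' (\<lambda>n f. compose (carrier (ob P n)) \<theta> f)"
  using cochains_axioms assms(1)
proof (rule cochain_mapI)
  interpret N': cochains R H P K N' by fact
  fix n f assume f: "f \<in> rg_hom R K (ob P n) N"
  note c = rg_hom_closed[OF f]
  note L = linear_onD[OF lin]
  show "compose (carrier (ob P n)) \<theta> f \<in> rg_hom R K (ob P n) N'"
    unfolding compose_def
    by (rule N'.C.linear_restrictI)
      (simp_all add: L c linear_onD[OF rg_homD(2)[OF f]] rg_homD(3)[OF f] eq)
  fix x
  show "compose (carrier (ob P n)) \<theta> (\<lambda>x\<in>carrier (ob P n). f x \<oplus>\<^bsub>N\<^esub> g x) x =
      compose (carrier (ob P n)) \<theta> f x \<oplus>\<^bsub>N'\<^esub> compose (carrier (ob P n)) \<theta> g x"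
    if "g \<in> rg_hom R K (ob P n) N" "x \<in> carrier (ob P n)" for g
    using that by (simp add: compose_def L c rg_hom_closed)
  show "compose (carrier (ob P (n + 1))) \<theta> (\<lambda>x\<in>carrier (ob P (n + 1)). f (bd P (n + 1) x)) x =
      compose (carrier (ob P n)) \<theta> f (bd P (n + 1) x)"
    if "x \<in> carrier (ob P (n + 1))"
    using that bd_closed[OF that] by (simp add: compose_def)
qed

end

section \<open>Conjugation and corestriction\<close>

text \<open>The action of h on linear maps from M to N. For a subgroup K its fixed points are the
  K-equivariant maps; conjugation of cochains and the summands of \<open>cor_cochain\<close> are
  instances.\<close>

definition translate ::
    "'h monoid \<Rightarrow> ('r, 'm, 'h) rg_module \<Rightarrow> ('r, 'n, 'h) rg_module \<Rightarrow> 'h \<Rightarrow> ('m \<Rightarrow> 'n) \<Rightarrow> 'm \<Rightarrow> 'n" where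
  "translate H M N h f = (\<lambda>x\<in>carrier M. act N h (f (act M (inv\<^bsub>H\<^esub> h) x)))"

locale group_module_pair = M: group_module R H M + N: group_module R H N
  for R :: "'r ring" (structure) and H :: "'h monoid"
    and M :: "('r, 'm, 'h) rg_module" and N :: "('r, 'n, 'h) rg_module"
begin

lemma translate_closed:
  assumes f: "linear_on R M N f" and h: "h \<in> carrier H" and x: "x \<in> carrier M"
  shows "translate H M N h f x \<in> carrier N"
  using h x by (simp add: translate_def M.act_closed N.act_closed linear_onD[OF f])

lemma translate_linear:
  assumes f: "linear_on R M N f" and h: "h \<in> carrier H"
  shows "linear_on R M N (translate H M N h f)"
  using linear_onD[OF M.act_linear[of "inv\<^bsub>H\<^esub> h"]] linear_onD[OF N.act_linear[OF h]] linear_onD[OF f] h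
  by (intro linear_onI) (simp_all add: translate_def)

text \<open>Since h = k (k^-1 h), the factor k can be pulled out in front. Summed over cosets, this
  turns equivariance of the corestriction into a permutation of the cosets.\<close>

lemma translate_act:
  assumes f: "linear_on R M N f" and h: "h \<in> carrier H" "k \<in> carrier H" and x: "x \<in> carrier M"
  shows "translate H M N h f (act M k x) = act N k (translate H M N (inv\<^bsub>H\<^esub> k \<otimes>\<^bsub>H\<^esub> h) f x)"
proof -
  have "translate H M N h f (act M k x) = act N h (f (act M (inv\<^bsub>H\<^esub> h \<otimes>\<^bsub>H\<^esub> k) x))"
    using h x by (simp add: translate_def M.act_closed M.act_mult)
  also have "\<dots> = act N (k \<otimes>\<^bsub>H\<^esub> (inv\<^bsub>H\<^esub> k \<otimes>\<^bsub>H\<^esub> h)) (f (act M (inv\<^bsub>H\<^esub> h \<otimes>\<^bsub>H\<^esub> k) x))"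
    using h by (simp add: M.H.m_assoc[symmetric])
  also have "\<dots> = act N k (act N (inv\<^bsub>H\<^esub> k \<otimes>\<^bsub>H\<^esub> h) (f (act M (inv\<^bsub>H\<^esub> h \<otimes>\<^bsub>H\<^esub> k) x)))"
    using h x by (intro N.act_mult) (simp_all add: M.act_closed linear_onD[OF f])
  also have "inv\<^bsub>H\<^esub> h \<otimes>\<^bsub>H\<^esub> k = inv\<^bsub>H\<^esub> (inv\<^bsub>H\<^esub> k \<otimes>\<^bsub>H\<^esub> h)"
    using h by (simp add: M.H.inv_mult_group)
  finally show ?thesis
    using x by (simp add: translate_def)
qed

text \<open>A K-equivariant f is fixed by each k \<in> K, so the translate depends only on the coset
  hK. This makes sums over chosen coset representatives independent of the choice.\<close>

lemma translate_mult_right: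
  assumes f: "f \<in> rg_hom R K M N" and K: "subgroup K H" and h: "h \<in> carrier H" and k: "k \<in> K"
    and x: "x \<in> carrier M"
  shows "translate H M N (h \<otimes>\<^bsub>H\<^esub> k) f x = translate H M N h f x"
proof -
  interpret K: subgroup K H by fact
  have kH: "k \<in> carrier H" "inv\<^bsub>H\<^esub> k \<in> K"
    using k by auto
  have "f (act M (inv\<^bsub>H\<^esub> (h \<otimes>\<^bsub>H\<^esub> k)) x) = f (act M (inv\<^bsub>H\<^esub> k) (act M (inv\<^bsub>H\<^esub> h) x))"
    using h kH x by (simp add: M.H.inv_mult_group M.act_mult)
  also have "\<dots> = act N (inv\<^bsub>H\<^esub> k) (f (act M (inv\<^bsub>H\<^esub> h) x))"
    using h kH x by (intro rg_homD(3)[OF f]) (simp_all add: M.act_closed)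
  finally have "f (act M (inv\<^bsub>H\<^esub> (h \<otimes>\<^bsub>H\<^esub> k)) x) = act N (inv\<^bsub>H\<^esub> k) (f (act M (inv\<^bsub>H\<^esub> h) x))" .
  then show ?thesis
    using h kH x rg_hom_closed[OF f]
    by (simp add: translate_def M.act_closed N.act_mult N.act_closed M.H.m_assoc flip: N.act_mult[of _ "inv\<^bsub>H\<^esub> k"])
qed

end

section \<open>Conjugate subgroups and left cosets\<close>

lemma conj_subgroup_iff:
  "x \<in> conj_subgroup H h L \<longleftrightarrow> (\<exists>l\<in>L. x = h \<otimes>\<^bsub>H\<^esub> l \<otimes>\<^bsub>H\<^esub> inv\<^bsub>H\<^esub> h)"
  by (auto simp: conj_subgroup_def l_coset_def r_coset_def)

lemma subgroup_conj_subgroup: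
  "\<lbrakk>group H; subgroup L H; h \<in> carrier H\<rbrakk> \<Longrightarrow> subgroup (conj_subgroup H h L) H"
  unfolding conj_subgroup_def by (rule group.subgroup_conjugation_is_surj2)

lemma (in group) lcosets_update_iff:
  "C \<in> lcosets\<^bsub>G\<lparr>carrier := K\<rparr>\<^esub> L \<longleftrightarrow> (\<exists>a\<in>K. C = a <# L)"
  by (auto simp: LCOSETS_def l_coset_def)

lemma (in group) lcoset_eq_iff:
  assumes L: "subgroup L G" and ab: "a \<in> carrier G" "b \<in> carrier G"
  shows "a <# L = b <# L \<longleftrightarrow> (\<exists>l\<in>L. b = a \<otimes> l)"
proof
  assume "a <# L = b <# L"
  then have "b \<in> a <# L"
    using lcos_self[OF ab(2) L] by simp
  then show "\<exists>l\<in>L. b = a \<otimes> l"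
    by (auto simp: l_coset_def)
next
  assume "\<exists>l\<in>L. b = a \<otimes> l"
  then have "b \<in> a <# L"
    by (auto simp: l_coset_def)
  then show "a <# L = b <# L"
    by (rule l_repr_independence) (use ab L in auto)
qed

text \<open>The very choice made in \<open>cor_cochain\<close>; nothing is known of it beyond
  membership in its coset.\<close>

abbreviation coset_rep :: "'a set \<Rightarrow> 'a" where "coset_rep C \<equiv> (SOME u. u \<in> C)"

lemma (in group) coset_rep:
  assumes L: "subgroup L G" and a: "a \<in> carrier G"
  obtains l where "l \<in> L" "coset_rep (a <# L) = a \<otimes> l"
proof -
  have "coset_rep (a <# L) \<in> a <# L"
    by (rule someI) (rule lcos_self[OF a L])
  then show ?thesis
    using that by (auto simp: l_coset_def)
qed

locale subgroup_pair = H: group H + K: subgroup K H + L: subgroup L H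
  for H :: "'h monoid" and K :: "'h set" and L :: "'h set" +
  assumes L_subset_K: "L \<subseteq> K"
begin

abbreviation cosets where "cosets \<equiv> lcosets\<^bsub>H\<lparr>carrier := K\<rparr>\<^esub> L"

lemma coset_rep_closed: "C \<in> cosets \<Longrightarrow> coset_rep C \<in> K"
proof -
  assume "C \<in> cosets"
  then obtain a where a: "a \<in> K" "C = a <#\<^bsub>H\<^esub> L"
    by (auto simp: H.lcosets_update_iff)
  obtain l where "l \<in> L" "coset_rep (a <#\<^bsub>H\<^esub> L) = a \<otimes>\<^bsub>H\<^esub> l"
    using H.coset_rep[OF L.subgroup_axioms, of a] a by auto
  with a L_subset_K show ?thesis by auto
qed

lemma coset_rep_coset: "C \<in> cosets \<Longrightarrow> coset_rep C <#\<^bsub>H\<^esub> L = C"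
proof -
  assume "C \<in> cosets"
  then obtain a where a: "a \<in> K" "C = a <#\<^bsub>H\<^esub> L"
    by (auto simp: H.lcosets_update_iff)
  obtain l where l: "l \<in> L" "coset_rep (a <#\<^bsub>H\<^esub> L) = a \<otimes>\<^bsub>H\<^esub> l"
    using H.coset_rep[OF L.subgroup_axioms, of a] a by auto
  then have "a <#\<^bsub>H\<^esub> L = coset_rep (a <#\<^bsub>H\<^esub> L) <#\<^bsub>H\<^esub> L"
    using a L.subset by (subst H.lcoset_eq_iff[OF L.subgroup_axioms]) auto
  with a show ?thesis by simp
qed

lemma coset_mem: "a \<in> K \<Longrightarrow> a <#\<^bsub>H\<^esub> L \<in> cosets"
  by (auto simp: H.lcosets_update_iff)

lemma finite_cosets: "finite (carrier H) \<Longrightarrow> finite cosets"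
proof -
  assume "finite (carrier H)"
  then have "finite K"
    using K.subset finite_subset by blast
  moreover have "cosets = (\<lambda>a. a <#\<^bsub>H\<^esub> L) ` K"
    by (auto simp: H.lcosets_update_iff)
  ultimately show ?thesis by simp
qed

lemma coset_rep_invariant:
  assumes E: "\<And>u l. \<lbrakk>u \<in> K; l \<in> L\<rbrakk> \<Longrightarrow> E (u \<otimes>\<^bsub>H\<^esub> l) = E u" and a: "a \<in> K"
  shows "E (coset_rep (a <#\<^bsub>H\<^esub> L)) = E a"
proof -
  obtain l where "l \<in> L" "coset_rep (a <#\<^bsub>H\<^esub> L) = a \<otimes>\<^bsub>H\<^esub> l"
    using H.coset_rep[OF L.subgroup_axioms, of a] a by auto
  then show ?thesis using E a by simp
qed

text \<open>Left multiplication by k permutes the cosets of L in K, and E is constant on cosets, so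
  the chosen representatives do not matter.\<close>

lemma finsum_cosets_shift:
  assumes "abelian_monoid A"
    and E: "\<And>u l. \<lbrakk>u \<in> K; l \<in> L\<rbrakk> \<Longrightarrow> E (u \<otimes>\<^bsub>H\<^esub> l) = E u"
    and cl: "\<And>u. u \<in> K \<Longrightarrow> E u \<in> carrier A"
    and k: "k \<in> K"
  shows "(\<Oplus>\<^bsub>A\<^esub>C\<in>cosets. E (k \<otimes>\<^bsub>H\<^esub> coset_rep C)) = (\<Oplus>\<^bsub>A\<^esub>C\<in>cosets. E (coset_rep C))"
proof -
  interpret A: abelian_monoid A by fact
  \<comment> \<open>The permutation C \<mapsto> kC of the cosets.\<close>
  define s where "s C = (k \<otimes>\<^bsub>H\<^esub> coset_rep C) <#\<^bsub>H\<^esub> L" for C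
  have kH: "k \<in> carrier H"
    using k by auto
  have rH: "coset_rep C \<in> carrier H" if "C \<in> cosets" for C
    using coset_rep_closed[OF that] by auto
  have inj: "inj_on s cosets"
  proof (rule inj_onI)
    fix C C' assume C: "C \<in> cosets" "C' \<in> cosets" "s C = s C'"
    then obtain l where l: "l \<in> L" "k \<otimes>\<^bsub>H\<^esub> coset_rep C' = k \<otimes>\<^bsub>H\<^esub> coset_rep C \<otimes>\<^bsub>H\<^esub> l"
      unfolding s_def using kH rH by (auto simp: H.lcoset_eq_iff[OF L.subgroup_axioms])
    then have "coset_rep C' = coset_rep C \<otimes>\<^bsub>H\<^esub> l"
      using kH rH C L.subset by (auto simp: H.m_assoc)
    then have "coset_rep C <#\<^bsub>H\<^esub> L = coset_rep C' <#\<^bsub>H\<^esub> L"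
      using l rH C by (subst H.lcoset_eq_iff[OF L.subgroup_axioms]) auto
    then show "C = C'"
      using C by (simp add: coset_rep_coset)
  qed
  have img: "s ` cosets = cosets"
  proof
    show "s ` cosets \<subseteq> cosets"
      using k coset_rep_closed by (auto simp: s_def intro: coset_mem)
    show "cosets \<subseteq> s ` cosets"
    proof
      fix C assume C: "C \<in> cosets"
      \<comment> \<open>The preimage of C is the coset of k^-1 u for the representative u of C; the
        representative chosen in that coset may differ from k^-1 u by an element of L.\<close>
      let ?a = "inv\<^bsub>H\<^esub> k \<otimes>\<^bsub>H\<^esub> coset_rep C"
      have a: "?a \<in> K"
        using k coset_rep_closed[OF C] by auto
      then obtain l where l: "l \<in> L" "coset_rep (?a <#\<^bsub>H\<^esub> L) = ?a \<otimes>\<^bsub>H\<^esub> l"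
        using H.coset_rep[OF L.subgroup_axioms, of ?a] by auto
      have "k \<otimes>\<^bsub>H\<^esub> coset_rep (?a <#\<^bsub>H\<^esub> L) = coset_rep C \<otimes>\<^bsub>H\<^esub> l"
        using l kH rH[OF C] L.subset by (auto simp flip: H.m_assoc)
      then have "coset_rep C <#\<^bsub>H\<^esub> L = s (?a <#\<^bsub>H\<^esub> L)"
        unfolding s_def using l kH rH[OF C]
        by (subst H.lcoset_eq_iff[OF L.subgroup_axioms]) auto
      then show "C \<in> s ` cosets"
        using C coset_mem[OF a] by (simp add: coset_rep_coset)
    qed
  qed
  have "(\<Oplus>\<^bsub>A\<^esub>C\<in>cosets. E (coset_rep C)) = (\<Oplus>\<^bsub>A\<^esub>C\<in>s ` cosets. E (coset_rep C))"
    by (simp add: img)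
  also have "\<dots> = (\<Oplus>\<^bsub>A\<^esub>C\<in>cosets. E (coset_rep (s C)))"
    using coset_rep_closed cl inj img by (intro A.finsum_reindex) auto
  also have "\<dots> = (\<Oplus>\<^bsub>A\<^esub>C\<in>cosets. E (k \<otimes>\<^bsub>H\<^esub> coset_rep C))"
    using coset_rep_closed cl k
    by (intro A.finsum_cong') (auto simp: s_def intro!: coset_rep_invariant E)
  finally show ?thesis ..
qed

end

section \<open>Conjugation and corestriction as maps of cochain complexes\<close>

locale module_complex = group_complex R H P + N: group_module R H N
  for R :: "'r ring" (structure) and H :: "'h monoid" and P :: "('r, 'p, 'h) rg_complex"
    and N :: "('r, 'n, 'h) rg_module"
begin

lemma pair: "group_module_pair R H (ob P n) N"
  using ob_group_module N.group_module_axioms by (simp add: group_module_pair_def)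

lemma cochains_subset: "K \<subseteq> carrier H \<Longrightarrow> cochains R H P K N"
  by (intro cochains.intro cochains_axioms.intro N.equivariant group_complex_axioms)

lemma translate_add:
  assumes f: "linear_on R (ob P n) N f" and g: "linear_on R (ob P n) N g"
    and h: "h \<in> carrier H" and x: "x \<in> carrier (ob P n)"
  shows "translate H (ob P n) N h (\<lambda>x\<in>carrier (ob P n). f x \<oplus>\<^bsub>N\<^esub> g x) x =
    translate H (ob P n) N h f x \<oplus>\<^bsub>N\<^esub> translate H (ob P n) N h g x"
  using h x by (simp add: translate_def P.act_closed linear_onD(1)[OF f] linear_onD(1)[OF g]
      linear_onD(2)[OF N.act_linear])

text \<open>The differential of \<open>P\<close> commutes with the action of H, hence with
  translation.\<close>

lemma translate_bd:
  assumes h: "h \<in> carrier H" and x: "x \<in> carrier (ob P (n + 1))"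
  shows "translate H (ob P (n + 1)) N h (\<lambda>x\<in>carrier (ob P (n + 1)). f (bd P (n + 1) x)) x =
    translate H (ob P n) N h f (bd P (n + 1) x)"
proof -
  note b = bd_hom[of "n + 1", simplified]
  show ?thesis
    using h x rg_hom_closed[OF b] by (simp add: translate_def P.act_closed rg_homD(3)[OF b])
qed

lemma cochain_map_conj:
  assumes L: "L \<subseteq> carrier H" and h: "h \<in> carrier H"
    and hL: "conj_subgroup H h L \<subseteq> carrier H"
  shows "cochain_map R P L N (conj_subgroup H h L) N (\<lambda>n. translate H (ob P n) N h)"
  using cochains_subset[OF L] cochains_subset[OF hL]
proof (rule cochain_mapI)
  fix n f assume f: "f \<in> rg_hom R L (ob P n) N"
  interpret pair: group_module_pair R H "ob P n" N
    by (rule pair)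
  have f': "linear_on R (ob P n) N f"
    by (rule rg_homD[OF f])
  show "translate H (ob P n) N h f \<in> rg_hom R (conj_subgroup H h L) (ob P n) N"
  proof (rule rg_homI)
    show "translate H (ob P n) N h f \<in> extensional (carrier (ob P n))"
      by (simp add: translate_def)
    show "linear_on R (ob P n) N (translate H (ob P n) N h f)"
      by (rule pair.translate_linear[OF f' h])
    fix k x assume k: "k \<in> conj_subgroup H h L" and x: "x \<in> carrier (ob P n)"
    then obtain l where l: "l \<in> L" "k = h \<otimes>\<^bsub>H\<^esub> l \<otimes>\<^bsub>H\<^esub> inv\<^bsub>H\<^esub> h"
      by (auto simp: conj_subgroup_iff)
    have lH: "l \<in> carrier H"
      using l L by auto
    \<comment> \<open>With k = h l h^-1: in the argument of f, h^-1 k becomes l h^-1, then f lets l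
      pass to the outside, and h l = k h brings k to the front.\<close>
    have e1: "inv\<^bsub>H\<^esub> h \<otimes>\<^bsub>H\<^esub> k = l \<otimes>\<^bsub>H\<^esub> inv\<^bsub>H\<^esub> h"
      using h lH by (simp add: l H.m_assoc flip: H.m_assoc[of "inv\<^bsub>H\<^esub> h"])
    have e2: "k \<otimes>\<^bsub>H\<^esub> h = h \<otimes>\<^bsub>H\<^esub> l"
      using h lH by (simp add: l H.m_assoc)
    have kH: "k \<in> carrier H"
      using h lH by (simp add: l)
    have "translate H (ob P n) N h f (act (ob P n) k x) = act N h (f (act (ob P n) (inv\<^bsub>H\<^esub> h \<otimes>\<^bsub>H\<^esub> k) x))"
      using h kH x by (simp add: translate_def P.act_closed P.act_mult)
    also have "\<dots> = act N h (act N l (f (act (ob P n) (inv\<^bsub>H\<^esub> h) x)))"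
      unfolding e1 using h lH x l(1) by (simp add: P.act_mult P.act_closed rg_homD(3)[OF f])
    also have "\<dots> = act N (k \<otimes>\<^bsub>H\<^esub> h) (f (act (ob P n) (inv\<^bsub>H\<^esub> h) x))"
      using h lH x by (simp add: e2 N.act_mult P.act_closed rg_hom_closed[OF f])
    also have "\<dots> = act N k (translate H (ob P n) N h f x)"
      using h kH x by (simp add: translate_def N.act_mult P.act_closed rg_hom_closed[OF f])
    finally show "translate H (ob P n) N h f (act (ob P n) k x) = act N k (translate H (ob P n) N h f x)" .
  qed
qed (use h in \<open>simp_all add: translate_add translate_bd rg_homD(2)\<close>)

end

locale corestriction = module_complex R H P N + subgroup_pair H K L
  for R :: "'r ring" (structure) and H :: "'h monoid" and P :: "('r, 'p, 'h) rg_complex"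
    and N :: "('r, 'n, 'h) rg_module" and K L +
  assumes finite_H: "finite (carrier H)"
begin

lemma cor_cochain_eq:
  "cor_cochain H P K L N n f =
    (\<lambda>x\<in>carrier (ob P n). \<Oplus>\<^bsub>N\<^esub>C\<in>cosets. translate H (ob P n) N (coset_rep C) f x)"
  by (rule ext) (simp add: cor_cochain_def translate_def Let_def)

lemma coset_rep_H: "C \<in> cosets \<Longrightarrow> coset_rep C \<in> carrier H"
  using coset_rep_closed by auto

text \<open>Each translate of f is linear and compatible with the differential. The single
  translates need not be K-equivariant, but their sum is, by \<open>translate_act\<close> followed
  by a shift of the cosets.\<close>

lemma cochain_map_cor: "cochain_map R P L N K N (cor_cochain H P K L N)"
  using cochains_subset[OF L.subset] cochains_subset[OF K.subset]
proof (rule cochain_mapI)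
  fix n f assume f: "f \<in> rg_hom R L (ob P n) N"
  interpret K: cochains R H P K N
    by (rule cochains_subset) (rule K.subset)
  interpret pair: group_module_pair R H "ob P n" N
    by (rule pair)
  note f' = rg_homD(2)[OF f]
  note tc = pair.translate_closed[OF f' coset_rep_H]
  note tl = linear_onD[OF pair.translate_linear[OF f' coset_rep_H]]
  show "cor_cochain H P K L N n f \<in> rg_hom R K (ob P n) N"
    unfolding cor_cochain_eq
  proof (rule K.C.linear_restrictI)
    fix x assume x: "x \<in> carrier (ob P n)"
    show "(\<Oplus>\<^bsub>N\<^esub>C\<in>cosets. translate H (ob P n) N (coset_rep C) f x) \<in> carrier N"
      using tc[OF _ x] by (intro N.finsum_closed) auto
    fix y assume y: "y \<in> carrier (ob P n)"
    have "(\<Oplus>\<^bsub>N\<^esub>C\<in>cosets. translate H (ob P n) N (coset_rep C) f (x \<oplus>\<^bsub>ob P n\<^esub> y)) =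
        (\<Oplus>\<^bsub>N\<^esub>C\<in>cosets. translate H (ob P n) N (coset_rep C) f x
          \<oplus>\<^bsub>N\<^esub> translate H (ob P n) N (coset_rep C) f y)"
      using tc x y by (intro N.finsum_cong') (auto simp: tl)
    also have "\<dots> = (\<Oplus>\<^bsub>N\<^esub>C\<in>cosets. translate H (ob P n) N (coset_rep C) f x)
        \<oplus>\<^bsub>N\<^esub> (\<Oplus>\<^bsub>N\<^esub>C\<in>cosets. translate H (ob P n) N (coset_rep C) f y)"
      using tc x y by (intro N.finsum_addf) auto
    finally show "(\<Oplus>\<^bsub>N\<^esub>C\<in>cosets. translate H (ob P n) N (coset_rep C) f (x \<oplus>\<^bsub>ob P n\<^esub> y)) = \<dots>" .
  next
    fix r x assume r: "r \<in> carrier R" and x: "x \<in> carrier (ob P n)"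
    have "(\<Oplus>\<^bsub>N\<^esub>C\<in>cosets. translate H (ob P n) N (coset_rep C) f (r \<odot>\<^bsub>ob P n\<^esub> x)) =
        (\<Oplus>\<^bsub>N\<^esub>C\<in>cosets. r \<odot>\<^bsub>N\<^esub> translate H (ob P n) N (coset_rep C) f x)"
      using tc x r by (intro N.finsum_cong') (auto simp: tl)
    also have "\<dots> = r \<odot>\<^bsub>N\<^esub> (\<Oplus>\<^bsub>N\<^esub>C\<in>cosets. translate H (ob P n) N (coset_rep C) f x)"
      using tc x r finite_cosets[OF finite_H] by (intro N.finsum_smult_ldistr[symmetric]) auto
    finally show "(\<Oplus>\<^bsub>N\<^esub>C\<in>cosets. translate H (ob P n) N (coset_rep C) f (r \<odot>\<^bsub>ob P n\<^esub> x)) = \<dots>" .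
  next
    fix k x assume k: "k \<in> K" and x: "x \<in> carrier (ob P n)"
    have kH: "k \<in> carrier H"
      using k by auto
    have "(\<Oplus>\<^bsub>N\<^esub>C\<in>cosets. translate H (ob P n) N (coset_rep C) f (act (ob P n) k x)) =
        (\<Oplus>\<^bsub>N\<^esub>C\<in>cosets. act N k (translate H (ob P n) N (inv\<^bsub>H\<^esub> k \<otimes>\<^bsub>H\<^esub> coset_rep C) f x))"
      using kH x coset_rep_H
      by (intro N.finsum_cong')
        (auto simp: pair.translate_act[OF f'] intro!: N.act_closed pair.translate_closed[OF f'])
    also have "\<dots> = act N k (\<Oplus>\<^bsub>N\<^esub>C\<in>cosets. translate H (ob P n) N (inv\<^bsub>H\<^esub> k \<otimes>\<^bsub>H\<^esub> coset_rep C) f x)"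
      using kH x coset_rep_H
      by (intro additive_map.map_finsum[OF K.C.act_additive_N[OF k], symmetric])
        (auto intro!: pair.translate_closed[OF f'])
    also have "(\<Oplus>\<^bsub>N\<^esub>C\<in>cosets. translate H (ob P n) N (inv\<^bsub>H\<^esub> k \<otimes>\<^bsub>H\<^esub> coset_rep C) f x) =
        (\<Oplus>\<^bsub>N\<^esub>C\<in>cosets. translate H (ob P n) N (coset_rep C) f x)"
      using k x by (intro finsum_cosets_shift)
        (auto intro!: pair.translate_mult_right[OF f] pair.translate_closed[OF f']
          L.subgroup_axioms N.abelian_monoid_axioms)
    finally show "(\<Oplus>\<^bsub>N\<^esub>C\<in>cosets. translate H (ob P n) N (coset_rep C) f (act (ob P n) k x)) =
        act N k (\<Oplus>\<^bsub>N\<^esub>C\<in>cosets. translate H (ob P n) N (coset_rep C) f x)" .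
  qed
  show "cor_cochain H P K L N n (\<lambda>x\<in>carrier (ob P n). f x \<oplus>\<^bsub>N\<^esub> g x) x =
      cor_cochain H P K L N n f x \<oplus>\<^bsub>N\<^esub> cor_cochain H P K L N n g x"
    if g: "g \<in> rg_hom R L (ob P n) N" and x: "x \<in> carrier (ob P n)" for g x
  proof -
    note tg = pair.translate_closed[OF rg_homD(2)[OF g] coset_rep_H]
    have "(\<Oplus>\<^bsub>N\<^esub>C\<in>cosets. translate H (ob P n) N (coset_rep C) (\<lambda>x\<in>carrier (ob P n). f x \<oplus>\<^bsub>N\<^esub> g x) x) =
        (\<Oplus>\<^bsub>N\<^esub>C\<in>cosets. translate H (ob P n) N (coset_rep C) f x
          \<oplus>\<^bsub>N\<^esub> translate H (ob P n) N (coset_rep C) g x)"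
      using tc tg x by (intro N.finsum_cong')
        (auto simp: translate_add[OF f' rg_homD(2)[OF g] coset_rep_H])
    also have "\<dots> = (\<Oplus>\<^bsub>N\<^esub>C\<in>cosets. translate H (ob P n) N (coset_rep C) f x)
        \<oplus>\<^bsub>N\<^esub> (\<Oplus>\<^bsub>N\<^esub>C\<in>cosets. translate H (ob P n) N (coset_rep C) g x)"
      using tc tg x by (intro N.finsum_addf) auto
    finally show ?thesis
      using x by (simp add: cor_cochain_eq)
  qed
  show "cor_cochain H P K L N (n + 1) (\<lambda>x\<in>carrier (ob P (n + 1)). f (bd P (n + 1) x)) x =
      cor_cochain H P K L N n f (bd P (n + 1) x)"
    if x: "x \<in> carrier (ob P (n + 1))" for x
  proof -
    have bx: "bd P (n + 1) x \<in> carrier (ob P n)"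
      using bd_closed[OF x] by simp
    have "(\<Oplus>\<^bsub>N\<^esub>C\<in>cosets. translate H (ob P (n + 1)) N (coset_rep C)
          (\<lambda>x\<in>carrier (ob P (n + 1)). f (bd P (n + 1) x)) x) =
        (\<Oplus>\<^bsub>N\<^esub>C\<in>cosets. translate H (ob P n) N (coset_rep C) f (bd P (n + 1) x))"
      using tc[OF _ bx] x by (intro N.finsum_cong') (auto simp: translate_bd[OF coset_rep_H])
    then show ?thesis
      using x bx by (simp add: cor_cochain_eq)
  qed
qed

end

section \<open>Cup products of cochains\<close>

lemma bilinear_compose:
  assumes "bilinear R M' N' L b" and f: "linear_on R M M' f" and g: "linear_on R N N' g"
    and "base_module R M" "base_module R N"
  shows "bilinear R M N L (\<lambda>m n. b (f m) (g n))"
proof -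
  interpret b: bilinear R M' N' L b by fact
  interpret M: base_module R M by fact
  interpret N: base_module R N by fact
  note F = linear_onD[OF f]
  note G = linear_onD[OF g]
  show ?thesis
  proof unfold_locales
    fix n assume "n \<in> carrier N"
    then show "linear_on R M L (\<lambda>m. b (f m) (g n))"
      using linear_onD[OF b.linear_left[OF G(1)]] by (intro linear_onI) (simp_all add: F)
  next
    fix m assume "m \<in> carrier M"
    then show "linear_on R N L (\<lambda>n. b (f m) (g n))"
      using linear_onD[OF b.linear_right[OF F(1)]] by (intro linear_onI) (simp_all add: G)
  qed
qed

lemma linear_on_compose:
  "\<lbrakk>linear_on R M N f; linear_on R N L g\<rbrakk> \<Longrightarrow> linear_on R M L (\<lambda>x. g (f x))"
  by (simp add: linear_on_def)

lemma bilinear_push: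
  assumes "bilinear R M N L b" and f: "linear_on R L L' f" and "base_module R L'"
  shows "bilinear R M N L' (\<lambda>m n. f (b m n))"
proof -
  interpret b: bilinear R M N L b by fact
  interpret L': base_module R L' by fact
  show ?thesis
    by unfold_locales
      (use linear_on_compose[OF b.linear_left f] linear_on_compose[OF b.linear_right f] in auto)
qed

context tensor_pair
begin

lemma lift_push:
  assumes b: "bilinear R M N L b" and f: "linear_on R L L' f" and L': "base_module R L'"
    and X: "X \<in> carrier T"
  shows "f (tensor_lift M N L b X) = tensor_lift M N L' (\<lambda>m n. f (b m n)) X"
proof -
  interpret b: bilinear R M N L b by fact
  interpret fb: bilinear R M N L' "\<lambda>m n. f (b m n)"
    by (rule bilinear_push[OF b f L'])
  show ?thesis
    using linear_on_compose[OF b.lift_linear f] fb.lift_linear fb.L.abelian_group_axioms _ X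
    by (rule linear_on_tensor_eqI) simp
qed

lemma lift_cong:
  assumes b: "bilinear R M N L b" and b': "bilinear R M N L b'"
    and eq: "\<And>m n. \<lbrakk>m \<in> carrier M; n \<in> carrier N\<rbrakk> \<Longrightarrow> b m n = b' m n"
    and X: "X \<in> carrier T"
  shows "tensor_lift M N L b X = tensor_lift M N L b' X"
proof -
  interpret b: bilinear R M N L b by fact
  interpret b': bilinear R M N L b' by fact
  show ?thesis
    using b.lift_linear b'.lift_linear b.L.abelian_group_axioms _ X
    by (rule linear_on_tensor_eqI) (simp add: eq)
qed

lemma lift_add:
  assumes b: "bilinear R M N L b" and b': "bilinear R M N L b'"
    and b'': "bilinear R M N L b''"
    and eq: "\<And>m n. \<lbrakk>m \<in> carrier M; n \<in> carrier N\<rbrakk> \<Longrightarrow> b m n = b' m n \<oplus>\<^bsub>L\<^esub> b'' m n"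
    and X: "X \<in> carrier T"
  shows "tensor_lift M N L b X = tensor_lift M N L b' X \<oplus>\<^bsub>L\<^esub> tensor_lift M N L b'' X"
proof -
  interpret b: bilinear R M N L b by fact
  interpret b': bilinear R M N L b' by fact
  interpret b'': bilinear R M N L b'' by fact
  note D = linear_onD[OF b'.lift_linear] linear_onD[OF b''.lift_linear]
  have "linear_on R T L (\<lambda>X. tensor_lift M N L b' X \<oplus>\<^bsub>L\<^esub> tensor_lift M N L b'' X)"
    by (rule linear_onI) (simp_all add: D b.L.a_ac b.L.smult_r_distr)
  from linear_on_tensor_eqI[OF b.lift_linear this b.L.abelian_group_axioms _ X]
  show ?thesis by (simp add: eq)
qed

lemma lift_zero:
  assumes b: "bilinear R M N L b"
    and eq: "\<And>m n. \<lbrakk>m \<in> carrier M; n \<in> carrier N\<rbrakk> \<Longrightarrow> b m n = \<zero>\<^bsub>L\<^esub>"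
    and X: "X \<in> carrier T"
  shows "tensor_lift M N L b X = \<zero>\<^bsub>L\<^esub>"
proof -
  interpret b: bilinear R M N L b by fact
  have "linear_on R T L (\<lambda>X. \<zero>\<^bsub>L\<^esub>)"
    by (rule linear_onI) simp_all
  from linear_on_tensor_eqI[OF b.lift_linear this b.L.abelian_group_axioms _ X]
  show ?thesis by (simp add: eq)
qed

text \<open>Serves the product of two corestrictions, which is a sum over pairs of cosets. Both
  sides are linear in X and agree on pure tensors.\<close>

lemma lift_finsum:
  assumes b: "\<And>i. i \<in> I \<Longrightarrow> bilinear R M N L (b i)" and L: "base_module R L"
    and c: "bilinear R M N L c"
    and eq: "\<And>m n. \<lbrakk>m \<in> carrier M; n \<in> carrier N\<rbrakk> \<Longrightarrow> c m n = (\<Oplus>\<^bsub>L\<^esub>i\<in>I. b i m n)"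
    and I: "finite I" and X: "X \<in> carrier T"
  shows "tensor_lift M N L c X = (\<Oplus>\<^bsub>L\<^esub>i\<in>I. tensor_lift M N L (b i) X)"
proof -
  interpret L: base_module R L by fact
  interpret c: bilinear R M N L c by fact
  note D = linear_onD[OF bilinear.lift_linear[OF b]]
  have "linear_on R T L (\<lambda>X. \<Oplus>\<^bsub>L\<^esub>i\<in>I. tensor_lift M N L (b i) X)"
  proof (rule linear_onI)
    fix X Y assume X: "X \<in> carrier T"
    show "(\<Oplus>\<^bsub>L\<^esub>i\<in>I. tensor_lift M N L (b i) X) \<in> carrier L"
      using X by (intro L.finsum_closed) (auto simp: D)
    show "(\<Oplus>\<^bsub>L\<^esub>i\<in>I. tensor_lift M N L (b i) (r \<odot>\<^bsub>T\<^esub> X)) =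
        r \<odot>\<^bsub>L\<^esub> (\<Oplus>\<^bsub>L\<^esub>i\<in>I. tensor_lift M N L (b i) X)" if "r \<in> carrier R" for r
      using X that I by (subst L.finsum_smult_ldistr) (auto intro!: L.finsum_cong' simp: D)
    assume Y: "Y \<in> carrier T"
    show "(\<Oplus>\<^bsub>L\<^esub>i\<in>I. tensor_lift M N L (b i) (X \<oplus>\<^bsub>T\<^esub> Y)) =
        (\<Oplus>\<^bsub>L\<^esub>i\<in>I. tensor_lift M N L (b i) X) \<oplus>\<^bsub>L\<^esub> (\<Oplus>\<^bsub>L\<^esub>i\<in>I. tensor_lift M N L (b i) Y)"
    proof -
      have "(\<Oplus>\<^bsub>L\<^esub>i\<in>I. tensor_lift M N L (b i) (X \<oplus>\<^bsub>T\<^esub> Y)) =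
          (\<Oplus>\<^bsub>L\<^esub>i\<in>I. tensor_lift M N L (b i) X \<oplus>\<^bsub>L\<^esub> tensor_lift M N L (b i) Y)"
        using X Y by (intro L.finsum_cong') (auto simp: D)
      also have "\<dots> = (\<Oplus>\<^bsub>L\<^esub>i\<in>I. tensor_lift M N L (b i) X) \<oplus>\<^bsub>L\<^esub>
          (\<Oplus>\<^bsub>L\<^esub>i\<in>I. tensor_lift M N L (b i) Y)"
        using X Y by (intro L.finsum_addf) (auto simp: D)
      finally show ?thesis .
    qed
  qed
  then show ?thesis
  proof (rule linear_on_tensor_eqI[OF c.lift_linear _ L.abelian_group_axioms _ X])
    fix m n assume mn: "m \<in> carrier M" "n \<in> carrier N"
    have "(\<Oplus>\<^bsub>L\<^esub>i\<in>I. b i m n) = (\<Oplus>\<^bsub>L\<^esub>i\<in>I. tensor_lift M N L (b i) (pure m n))"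
      using mn linear_onD(1)[OF bilinear.linear_left[OF b mn(2)] mn(1)]
      by (intro L.finsum_cong') (auto simp: bilinear.lift_pure[OF b])
    then show "tensor_lift M N L c (pure m n) = (\<Oplus>\<^bsub>L\<^esub>i\<in>I. tensor_lift M N L (b i) (pure m n))"
      using mn by (simp add: eq)
  qed
qed

text \<open>\<open>tensor_map\<close> is itself a lift, of (m, n) \<mapsto> f m \<otimes> g n.
  Following it by the lift of b gives another lift by \<open>lift_push\<close>, whose bilinear map
  is read off on pure tensors.\<close>

lemma lift_tensor_map:
  assumes b: "bilinear R M' N' L b" and f: "linear_on R M M' f" and g: "linear_on R N N' g"
    and X: "X \<in> carrier T"
  shows "tensor_map R M N M' N' f g X \<in> carrier (tensor_module R M' N')"
    and "tensor_lift M' N' L b (tensor_map R M N M' N' f g X) =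
      tensor_lift M N L (\<lambda>m n. b (f m) (g n)) X"
proof -
  interpret b: bilinear R M' N' L b by fact
  note mods = M.base_module_axioms N.base_module_axioms
  interpret fg: bilinear R M N b.T "\<lambda>m n. b.pure (f m) (g n)"
    by (rule bilinear_compose[OF b.bilinear_pure f g mods])
  show "tensor_map R M N M' N' f g X \<in> carrier (tensor_module R M' N')"
    unfolding tensor_map_def by (rule linear_onD(1)[OF fg.lift_linear X])
  have "tensor_lift M' N' L b (tensor_map R M N M' N' f g X) =
      tensor_lift M N L (\<lambda>m n. b.lift (b.pure (f m) (g n))) X"
    unfolding tensor_map_def
    by (rule lift_push[OF fg.bilinear_axioms b.lift_linear b.L.base_module_axioms X])
  also have "\<dots> = tensor_lift M N L (\<lambda>m n. b (f m) (g n)) X"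
    by (rule lift_cong[OF bilinear_push[OF fg.bilinear_axioms b.lift_linear b.L.base_module_axioms]
          bilinear_compose[OF b f g mods] _ X])
      (simp add: linear_onD(1)[OF f] linear_onD(1)[OF g])
  finally show "tensor_lift M' N' L b (tensor_map R M N M' N' f g X) =
      tensor_lift M N L (\<lambda>m n. b (f m) (g n)) X" .
qed

end

section \<open>The diagonal action and equivariant pairings\<close>

lemma tensor_simps:
  "carrier (tensor R M N) = carrier (tensor_module R M N)"
  "\<zero>\<^bsub>tensor R M N\<^esub> = \<zero>\<^bsub>tensor_module R M N\<^esub>"
  "add (tensor R M N) = add (tensor_module R M N)"
  "smult (tensor R M N) = smult (tensor_module R M N)"
  "act (tensor R M N) h =
    (\<lambda>T\<in>carrier (tensor_module R M N). tensor_map R M N M N (act M h) (act N h) T)"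
  by (simp_all add: tensor_def module.defs rg_module.defs)

lemma sign_pow_tensor: "sign_pow (tensor R M N) = sign_pow (tensor_module R M N)"
  by (rule additive_structure_cong) (simp_all add: tensor_simps)

lemma tensor_lift_tensor:
  "tensor_lift A A' (tensor R M N) b = tensor_lift A A' (tensor_module R M N) b"
  unfolding tensor_lift_def
  by (simp add: tensor_simps additive_structure_cong(2)[of "tensor R M N" "tensor_module R M N"])

lemma linear_on_tensor: "linear_on R A (tensor R M N) f \<longleftrightarrow> linear_on R A (tensor_module R M N) f"
  by (simp add: linear_on_def tensor_simps)

lemma base_module_tensor:
  assumes "base_module R M" "base_module R N"
  shows "base_module R (tensor R M N)"
proof -
  interpret tensor_pair R M N
    using assms by (simp add: tensor_pair_def)
  show ?thesis
    unfolding base_module_def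
    by (rule moduleI)
      (simp_all add: tensor_simps M.is_cring T.smult_l_distr T.smult_r_distr T.smult_assoc1
        abelian_group_cong[OF T.abelian_group_axioms])
qed

text \<open>Covers the universal pairing into M \<otimes> N together with the multiplications of R
  and RG, so that the Leibniz rule is proved once for all the cup products involved.\<close>

locale pairing = M: equivariant_module R M K + N: equivariant_module R N K +
    L: equivariant_module R L K + bilinear R M N L \<mu>
  for R :: "'r ring" (structure) and K :: "'h set" and M :: "('r, 'm, 'h) rg_module"
    and N :: "('r, 'n, 'h) rg_module" and L :: "('r, 'l, 'h) rg_module"
    and \<mu> :: "'m \<Rightarrow> 'n \<Rightarrow> 'l" +
  assumes mu_act: "\<lbrakk>k \<in> K; m \<in> carrier M; n \<in> carrier N\<rbrakk> \<Longrightarrow>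
    \<mu> (act M k m) (act N k n) = act L k (\<mu> m n)"

lemma pairing_tensor:
  assumes M: "equivariant_module R M K" and N: "equivariant_module R N K"
  shows "pairing R K M N (tensor R M N) (pure_tensor R M N)"
proof -
  interpret M: equivariant_module R M K by fact
  interpret N: equivariant_module R N K by fact
  interpret tensor_pair R M N
    by (rule tensor_pair.intro[OF M.base_module_axioms N.base_module_axioms])
  note mods = M.base_module_axioms N.base_module_axioms
  note p = bilinear_pure
  have MN: "base_module R (tensor R M N)"
    by (rule base_module_tensor[OF mods])
  have b: "bilinear R M N T (\<lambda>m n. pure (act M k m) (act N k n))" if "k \<in> K" for k
    by (rule bilinear_compose[OF p M.act_linear[OF that] N.act_linear[OF that] mods])
  have "equivariant_module R (tensor R M N) K"
  proof (intro equivariant_module.intro equivariant_module_axioms.intro MN)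
    show "linear_on R (tensor R M N) (tensor R M N) (act (tensor R M N) k)" if "k \<in> K" for k
      using bilinear.lift_linear[OF b[OF that]]
      by (auto simp: linear_on_def tensor_simps tensor_map_def)
  qed
  moreover have "bilinear R M N (tensor R M N) pure"
    using bilinear.linear_left[OF p] bilinear.linear_right[OF p]
    by (intro bilinear.intro bilinear_axioms.intro MN tensor_pair_axioms)
      (simp_all add: linear_on_tensor)
  moreover have "pure (act M k m) (act N k n) = act (tensor R M N) k (pure m n)"
    if "k \<in> K" "m \<in> carrier M" "n \<in> carrier N" for k m n
    using that bilinear.lift_pure[OF b] by (simp add: tensor_simps tensor_map_def)
  ultimately show ?thesis
    by (intro pairing.intro pairing_axioms.intro M N)
qed

text \<open>
  The sign is a separate parameter \<open>s\<close>, since the Leibniz rule relates products with different signs.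
\<close>

definition pairing_cup ::
    "('r, 'p, 'h) rg_complex \<Rightarrow> (int \<Rightarrow> int \<Rightarrow> 'p \<Rightarrow> ('p \<times> 'p \<Rightarrow> 'r) set) \<Rightarrow> ('r, 'l, 'h) rg_module \<Rightarrow>
       ('m \<Rightarrow> 'n \<Rightarrow> 'l) \<Rightarrow> int \<Rightarrow> int \<Rightarrow> int \<Rightarrow> ('p \<Rightarrow> 'm) \<Rightarrow> ('p \<Rightarrow> 'n) \<Rightarrow> 'p \<Rightarrow> 'l" where
  "pairing_cup P \<Delta> L \<mu> s p q f g =
     (\<lambda>x\<in>carrier (ob P (p + q)).
        sign_pow L s (tensor_lift (ob P p) (ob P q) L (\<lambda>a b. \<mu> (f a) (g b)) (\<Delta> p q x)))"

lemma cup_cochain_eq: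
  "cup_cochain R P \<Delta> M N p q f g = pairing_cup P \<Delta> (tensor R M N) (pure_tensor R M N) (p * q) p q f g"
  by (simp add: cup_cochain_def pairing_cup_def tensor_map_def tensor_lift_tensor)

section \<open>Equivariance and the chain map property of the diagonal\<close>

locale diagonal_complex = group_complex R H P
  for R :: "'r ring" (structure) and H :: "'h monoid" and P :: "('r, 'p, 'h) rg_complex" +
  fixes \<Delta> :: "int \<Rightarrow> int \<Rightarrow> 'p \<Rightarrow> ('p \<times> 'p \<Rightarrow> 'r) set" and \<epsilon> :: "'p \<Rightarrow> 'r"
  assumes diagonal: "diagonal_approximation R H P \<epsilon> \<Delta>"
begin

abbreviation PT where "PT p q \<equiv> tensor_module R (ob P p) (ob P q)"

lemma tensor_pair_ob: "tensor_pair R (ob P p) (ob P q)"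
  by (rule tensor_pair.intro[OF P.base_module_axioms P.base_module_axioms])

lemma Delta_hom: "\<Delta> p q \<in> rg_hom R (carrier H) (ob P (p + q)) (tensor R (ob P p) (ob P q))"
  using diagonal by (simp add: diagonal_approximation_def)

lemma Delta_linear: "linear_on R (ob P (p + q)) (PT p q) (\<Delta> p q)"
  using rg_homD(2)[OF Delta_hom] by (simp add: linear_on_tensor)

lemma Delta_closed: "x \<in> carrier (ob P (p + q)) \<Longrightarrow> \<Delta> p q x \<in> carrier (PT p q)"
  by (rule linear_onD(1)[OF Delta_linear])

lemma Delta_act:
  assumes "h \<in> carrier H" "x \<in> carrier (ob P (p + q))"
  shows "\<Delta> p q (act (ob P (p + q)) h x) =
    tensor_map R (ob P p) (ob P q) (ob P p) (ob P q) (act (ob P p) h) (act (ob P q) h) (\<Delta> p q x)"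
  using rg_homD(3)[OF Delta_hom assms] Delta_closed[OF assms(2)] by (simp add: tensor_simps)

text \<open>Equivariance of \<open>\<Delta>\<close> in the form used for cochains: acting on the
  argument amounts to acting on both tensor factors.\<close>

lemma lift_Delta_act:
  assumes b: "bilinear R (ob P p) (ob P q) L b"
    and h: "h \<in> carrier H" and x: "x \<in> carrier (ob P (p + q))"
  shows "tensor_lift (ob P p) (ob P q) L b (\<Delta> p q (act (ob P (p + q)) h x)) =
    tensor_lift (ob P p) (ob P q) L (\<lambda>a c. b (act (ob P p) h a) (act (ob P q) h c)) (\<Delta> p q x)"
  unfolding Delta_act[OF h x]
  by (rule tensor_pair.lift_tensor_map(2)[OF tensor_pair_ob b P.act_linear[OF h] P.act_linear[OF h]
        Delta_closed[OF x]])

lemma bd_linear: "linear_on R (ob P (n + 1)) (ob P n) (bd P (n + 1))"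
  using rg_homD(2)[OF bd_hom[of "n + 1"]] by simp

lemma id_linear: "linear_on R M M (\<lambda>y. y)"
  by (simp add: linear_on_def)

text \<open>The chain map equation for \<open>\<Delta>\<close>, pushed through the linear extension
  of b; its two \<open>tensor_map\<close> terms become lifts of b precomposed with the differential
  in one factor.\<close>

lemma lift_Delta_bd:
  assumes b: "bilinear R (ob P p) (ob P q) L b" and x: "x \<in> carrier (ob P (p + q + 1))"
  shows "tensor_lift (ob P (p + 1)) (ob P q) L (\<lambda>a c. b (bd P (p + 1) a) c) (\<Delta> (p + 1) q x)
    \<oplus>\<^bsub>L\<^esub> sign_pow L p
      (tensor_lift (ob P p) (ob P (q + 1)) L (\<lambda>a c. b a (bd P (q + 1) c)) (\<Delta> p (q + 1) x))
    = tensor_lift (ob P p) (ob P q) L b (\<Delta> p q (bd P (p + q + 1) x))"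
proof -
  interpret b: bilinear R "ob P p" "ob P q" L b by fact
  interpret lift: additive_map b.T L b.lift
    by (rule linear_on_additive_map[OF b.lift_linear]) unfold_locales
  \<comment> \<open>The same degree, written in the shapes that \<open>\<Delta> (p + 1) q\<close>
    and \<open>\<Delta> p (q + 1)\<close> demand.\<close>
  have x1: "x \<in> carrier (ob P (p + 1 + q))" and x2: "x \<in> carrier (ob P (p + (q + 1)))"
    using x by (simp_all add: ac_simps)
  let ?u = "tensor_map R (ob P (p + 1)) (ob P q) (ob P p) (ob P q) (bd P (p + 1)) (\<lambda>y. y) (\<Delta> (p + 1) q x)"
  let ?v = "tensor_map R (ob P p) (ob P (q + 1)) (ob P p) (ob P q) (\<lambda>y. y) (bd P (q + 1)) (\<Delta> p (q + 1) x)"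
  note u = tensor_pair.lift_tensor_map[OF tensor_pair_ob b.bilinear_axioms bd_linear id_linear Delta_closed[OF x1]]
  note v = tensor_pair.lift_tensor_map[OF tensor_pair_ob b.bilinear_axioms id_linear bd_linear Delta_closed[OF x2]]
  have "?u \<oplus>\<^bsub>b.T\<^esub> sign_pow b.T p ?v = \<Delta> p q (bd P (p + q + 1) x)"
    using diagonal x by (simp add: diagonal_approximation_def tensor_simps sign_pow_tensor)
  then have "b.lift (\<Delta> p q (bd P (p + q + 1) x)) = b.lift (?u \<oplus>\<^bsub>b.T\<^esub> sign_pow b.T p ?v)"
    by simp
  also have "\<dots> = b.lift ?u \<oplus>\<^bsub>L\<^esub> sign_pow L p (b.lift ?v)"
    using u(1) v(1) by (simp add: lift.add lift.map_sign_pow abelian_group.sign_pow_closed[OF b.T.abelian_group_axioms])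
  finally show ?thesis
    by (simp add: u(2) v(2))
qed

end

lemma (in abelian_group) sign_pow_sign_pow:
  "x \<in> carrier G \<Longrightarrow> sign_pow G s (sign_pow G t x) = sign_pow G (s + t) x"
  by (simp add: sign_pow_def)

locale cup_pairing = diagonal_complex R H P \<Delta> \<epsilon> + pairing R K M N L \<mu>
  for R :: "'r ring" (structure) and H :: "'h monoid" and P :: "('r, 'p, 'h) rg_complex"
    and \<Delta> :: "int \<Rightarrow> int \<Rightarrow> 'p \<Rightarrow> ('p \<times> 'p \<Rightarrow> 'r) set" and \<epsilon> :: "'p \<Rightarrow> 'r"
    and K :: "'h set" and M :: "('r, 'm, 'h) rg_module"
    and N :: "('r, 'n, 'h) rg_module" and L :: "('r, 'l, 'h) rg_module"
    and \<mu> :: "'m \<Rightarrow> 'n \<Rightarrow> 'l" +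
  assumes K_subset: "K \<subseteq> carrier H"
begin

sublocale M: cochains R H P K M
  by (intro cochains.intro cochains_axioms.intro group_complex_axioms
      M.equivariant_module_axioms K_subset)

sublocale N: cochains R H P K N
  by (intro cochains.intro cochains_axioms.intro group_complex_axioms
      N.equivariant_module_axioms K_subset)

sublocale L: cochains R H P K L
  by (intro cochains.intro cochains_axioms.intro group_complex_axioms
      L.equivariant_module_axioms K_subset)

abbreviation pcup where "pcup \<equiv> pairing_cup P \<Delta> L \<mu>"
abbreviation clift where
  "clift p q f g \<equiv> tensor_lift (ob P p) (ob P q) L (\<lambda>a b. \<mu> (f a) (g b))"

lemma bilinear_cochains:
  assumes f: "linear_on R (ob P p) M f" and g: "linear_on R (ob P q) N g"
  shows "bilinear R (ob P p) (ob P q) L (\<lambda>a b. \<mu> (f a) (g b))"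
  by (rule bilinear_compose[OF bilinear_axioms f g P.base_module_axioms P.base_module_axioms])

lemma clift_closed:
  assumes f: "linear_on R (ob P p) M f" and g: "linear_on R (ob P q) N g"
    and x: "x \<in> carrier (ob P (p + q))"
  shows "clift p q f g (\<Delta> p q x) \<in> carrier L"
  by (rule linear_onD(1)[OF bilinear.lift_linear[OF bilinear_cochains[OF f g]] Delta_closed[OF x]])

text \<open>For equivariance, k reaches both tensor factors by \<open>lift_Delta_act\<close>, passes
  through f and g, and leaves the pairing by \<open>mu_act\<close>.\<close>

lemma pcup_closed:
  assumes f: "f \<in> rg_hom R K (ob P p) M" and g: "g \<in> rg_hom R K (ob P q) N"
  shows "pcup s p q f g \<in> rg_hom R K (ob P (p + q)) L"
  unfolding pairing_cup_def
proof (rule L.C.linear_restrictI)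
  note f' = rg_homD(2)[OF f]
  note g' = rg_homD(2)[OF g]
  note b = bilinear_cochains[OF f' g']
  note l = linear_onD[OF bilinear.lift_linear[OF b]]
  note D = linear_onD[OF Delta_linear]
  note c = clift_closed[OF f' g']
  fix x assume x: "x \<in> carrier (ob P (p + q))"
  show "sign_pow L s (clift p q f g (\<Delta> p q x)) \<in> carrier L"
    using c[OF x] by (rule L.sign_pow_closed)
  show "sign_pow L s (clift p q f g (\<Delta> p q (x \<oplus>\<^bsub>ob P (p + q)\<^esub> y))) =
      sign_pow L s (clift p q f g (\<Delta> p q x)) \<oplus>\<^bsub>L\<^esub> sign_pow L s (clift p q f g (\<Delta> p q y))"
    if y: "y \<in> carrier (ob P (p + q))" for y
    using x y c by (simp add: D l L.sign_pow_add)
  show "sign_pow L s (clift p q f g (\<Delta> p q (r \<odot>\<^bsub>ob P (p + q)\<^esub> x))) =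
      r \<odot>\<^bsub>L\<^esub> sign_pow L s (clift p q f g (\<Delta> p q x))" if "r \<in> carrier R" for r
    using x that c by (simp add: D l L.sign_pow_smult)
  show "sign_pow L s (clift p q f g (\<Delta> p q (act (ob P (p + q)) k x))) =
      act L k (sign_pow L s (clift p q f g (\<Delta> p q x)))" if k: "k \<in> K" for k
  proof -
    have kH: "k \<in> carrier H"
      using k K_subset by auto
    note ak = L.act_linear[OF k]
    have "clift p q f g (\<Delta> p q (act (ob P (p + q)) k x)) =
        tensor_lift (ob P p) (ob P q) L (\<lambda>a c. \<mu> (f (act (ob P p) k a)) (g (act (ob P q) k c))) (\<Delta> p q x)"
      by (rule lift_Delta_act[OF b kH x])
    also have "\<dots> = tensor_lift (ob P p) (ob P q) L (\<lambda>a c. act L k (\<mu> (f a) (g c))) (\<Delta> p q x)"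
      by (rule tensor_pair.lift_cong[OF tensor_pair_ob
            bilinear_compose[OF b P.act_linear[OF kH] P.act_linear[OF kH] P.base_module_axioms P.base_module_axioms]
            bilinear_push[OF b ak L.base_module_axioms] _ Delta_closed[OF x]])
        (simp add: rg_homD(3)[OF f k] rg_homD(3)[OF g k] mu_act[OF k] rg_hom_closed[OF f] rg_hom_closed[OF g])
    also have "\<dots> = act L k (clift p q f g (\<Delta> p q x))"
      by (rule tensor_pair.lift_push[OF tensor_pair_ob b ak L.base_module_axioms Delta_closed[OF x], symmetric])
    finally show ?thesis
      using additive_map.map_sign_pow[OF L.C.act_additive_N[OF k] c[OF x]] by simp
  qed
qed

lemma pcup_add_left:
  assumes f: "f \<in> rg_hom R K (ob P p) M" and f': "f' \<in> rg_hom R K (ob P p) M"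
    and g: "g \<in> rg_hom R K (ob P q) N"
  shows "pcup s p q (f \<oplus>\<^bsub>M.C p\<^esub> f') g = pcup s p q f g \<oplus>\<^bsub>L.C (p + q)\<^esub> pcup s p q f' g"
proof
  fix x
  have s: "f \<oplus>\<^bsub>M.C p\<^esub> f' \<in> rg_hom R K (ob P p) M"
    using M.C.Hom.a_closed[of f p f'] f f' by (simp add: hom_module_simps(1))
  note D = linear_onD[OF linear_left]
  have "clift p q (f \<oplus>\<^bsub>M.C p\<^esub> f') g (\<Delta> p q x) = clift p q f g (\<Delta> p q x) \<oplus>\<^bsub>L\<^esub> clift p q f' g (\<Delta> p q x)"
    if x: "x \<in> carrier (ob P (p + q))"
    by (rule tensor_pair.lift_add[OF tensor_pair_ob
          bilinear_cochains[OF rg_homD(2)[OF s] rg_homD(2)[OF g]]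
          bilinear_cochains[OF rg_homD(2)[OF f] rg_homD(2)[OF g]]
          bilinear_cochains[OF rg_homD(2)[OF f'] rg_homD(2)[OF g]] _ Delta_closed[OF x]])
      (simp add: hom_module_simps(3) D rg_hom_closed[OF f] rg_hom_closed[OF f'] rg_hom_closed[OF g])
  then show "pcup s p q (f \<oplus>\<^bsub>M.C p\<^esub> f') g x = (pcup s p q f g \<oplus>\<^bsub>L.C (p + q)\<^esub> pcup s p q f' g) x"
    using clift_closed[OF rg_homD(2)[OF f] rg_homD(2)[OF g]] clift_closed[OF rg_homD(2)[OF f'] rg_homD(2)[OF g]]
    by (simp add: pairing_cup_def hom_module_simps(3)[of R K "ob P (p + q)"] L.sign_pow_add)
qed

lemma pcup_add_right:
  assumes f: "f \<in> rg_hom R K (ob P p) M" and g: "g \<in> rg_hom R K (ob P q) N"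
    and g': "g' \<in> rg_hom R K (ob P q) N"
  shows "pcup s p q f (g \<oplus>\<^bsub>N.C q\<^esub> g') = pcup s p q f g \<oplus>\<^bsub>L.C (p + q)\<^esub> pcup s p q f g'"
proof
  fix x
  have s: "g \<oplus>\<^bsub>N.C q\<^esub> g' \<in> rg_hom R K (ob P q) N"
    using N.C.Hom.a_closed[of g q g'] g g' by (simp add: hom_module_simps(1))
  note D = linear_onD[OF linear_right]
  have "clift p q f (g \<oplus>\<^bsub>N.C q\<^esub> g') (\<Delta> p q x) = clift p q f g (\<Delta> p q x) \<oplus>\<^bsub>L\<^esub> clift p q f g' (\<Delta> p q x)"
    if x: "x \<in> carrier (ob P (p + q))"
    by (rule tensor_pair.lift_add[OF tensor_pair_ob
          bilinear_cochains[OF rg_homD(2)[OF f] rg_homD(2)[OF s]]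
          bilinear_cochains[OF rg_homD(2)[OF f] rg_homD(2)[OF g]]
          bilinear_cochains[OF rg_homD(2)[OF f] rg_homD(2)[OF g']] _ Delta_closed[OF x]])
      (simp add: hom_module_simps(3) D rg_hom_closed[OF f] rg_hom_closed[OF g'] rg_hom_closed[OF g])
  then show "pcup s p q f (g \<oplus>\<^bsub>N.C q\<^esub> g') x = (pcup s p q f g \<oplus>\<^bsub>L.C (p + q)\<^esub> pcup s p q f g') x"
    using clift_closed[OF rg_homD(2)[OF f] rg_homD(2)[OF g]] clift_closed[OF rg_homD(2)[OF f] rg_homD(2)[OF g']]
    by (simp add: pairing_cup_def hom_module_simps(3)[of R K "ob P (p + q)"] L.sign_pow_add)
qed

end

section \<open>The Leibniz rule and independence of representatives\<close>

context cup_pairing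
begin

lemma clift_zero:
  assumes f: "linear_on R (ob P p) M f" and g: "linear_on R (ob P q) N g"
    and z: "(\<forall>a\<in>carrier (ob P p). f a = \<zero>\<^bsub>M\<^esub>) \<or> (\<forall>b\<in>carrier (ob P q). g b = \<zero>\<^bsub>N\<^esub>)"
    and x: "x \<in> carrier (ob P (p + q))"
  shows "clift p q f g (\<Delta> p q x) = \<zero>\<^bsub>L\<^esub>"
proof (rule tensor_pair.lift_zero[OF tensor_pair_ob bilinear_cochains[OF f g] _ Delta_closed[OF x]])
  fix a b assume a: "a \<in> carrier (ob P p)" and b: "b \<in> carrier (ob P q)"
  have "\<mu> \<zero>\<^bsub>M\<^esub> (g b) = \<zero>\<^bsub>L\<^esub>"
    by (rule additive_map.map_zero[OF linear_on_additive_map[OF linear_left[OF linear_onD(1)[OF g b]]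
          M.abelian_group_axioms L.abelian_group_axioms]])
  moreover have "\<mu> (f a) \<zero>\<^bsub>N\<^esub> = \<zero>\<^bsub>L\<^esub>"
    by (rule additive_map.map_zero[OF linear_on_additive_map[OF linear_right[OF linear_onD(1)[OF f a]]
          N.abelian_group_axioms L.abelian_group_axioms]])
  ultimately show "\<mu> (f a) (g b) = \<zero>\<^bsub>L\<^esub>"
    using z a b by auto
qed

text \<open>The sign with exponent p is that of the differential of P \<otimes> P; neither the
  coboundary nor \<open>clift\<close> carries a sign of its own.\<close>

lemma Leibniz:
  assumes f: "f \<in> rg_hom R K (ob P p) M" and g: "g \<in> rg_hom R K (ob P q) N"
    and x: "x \<in> carrier (ob P (p + q + 1))"
  shows "clift (p + 1) q (cobd P p f) g (\<Delta> (p + 1) q x)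
      \<oplus>\<^bsub>L\<^esub> sign_pow L p (clift p (q + 1) f (cobd P q g) (\<Delta> p (q + 1) x))
    = clift p q f g (\<Delta> p q (bd P (p + q + 1) x))"
proof -
  note f' = rg_homD(2)[OF f] and g' = rg_homD(2)[OF g]
  note df = rg_homD(2)[OF M.cobd_closed[OF f]] and dg = rg_homD(2)[OF N.cobd_closed[OF g]]
  note fd = linear_on_compose[OF bd_linear f'] and gd = linear_on_compose[OF bd_linear g']
  have x1: "x \<in> carrier (ob P (p + 1 + q))" and x2: "x \<in> carrier (ob P (p + (q + 1)))"
    using x by (simp_all add: ac_simps)
  have "clift (p + 1) q (cobd P p f) g (\<Delta> (p + 1) q x) =
      clift (p + 1) q (\<lambda>a. f (bd P (p + 1) a)) g (\<Delta> (p + 1) q x)"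
    by (rule tensor_pair.lift_cong[OF tensor_pair_ob bilinear_cochains[OF df g']
          bilinear_cochains[OF fd g'] _ Delta_closed[OF x1]]) (simp add: cobd_def)
  moreover have "clift p (q + 1) f (cobd P q g) (\<Delta> p (q + 1) x) =
      clift p (q + 1) f (\<lambda>b. g (bd P (q + 1) b)) (\<Delta> p (q + 1) x)"
    by (rule tensor_pair.lift_cong[OF tensor_pair_ob bilinear_cochains[OF f' dg]
          bilinear_cochains[OF f' gd] _ Delta_closed[OF x2]]) (simp add: cobd_def)
  ultimately show ?thesis
    using lift_Delta_bd[OF bilinear_cochains[OF f' g'] x] by simp
qed

lemma Z_cobd_zero:
  "f \<in> M.Z p \<Longrightarrow> a \<in> carrier (ob P (p + 1)) \<Longrightarrow> cobd P p f a = \<zero>\<^bsub>M\<^esub>"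
  "g \<in> N.Z q \<Longrightarrow> b \<in> carrier (ob P (q + 1)) \<Longrightarrow> cobd P q g b = \<zero>\<^bsub>N\<^esub>"
  by (simp_all add: M.Z_iff N.Z_iff cobd_def)

lemma clift_left_cobd:
  assumes c: "c \<in> rg_hom R K (ob P p) M" and g: "g \<in> N.Z q"
    and x: "x \<in> carrier (ob P (p + q + 1))"
  shows "clift (p + 1) q (cobd P p c) g (\<Delta> (p + 1) q x) = clift p q c g (\<Delta> p q (bd P (p + q + 1) x))"
proof -
  note g' = N.cocycle_hom[OF g]
  have x1: "x \<in> carrier (ob P (p + 1 + q))" and x2: "x \<in> carrier (ob P (p + (q + 1)))"
    using x by (simp_all add: ac_simps)
  have "clift p (q + 1) c (cobd P q g) (\<Delta> p (q + 1) x) = \<zero>\<^bsub>L\<^esub>"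
    using clift_zero[OF rg_homD(2)[OF c] rg_homD(2)[OF N.cobd_closed[OF g']] _ x2] Z_cobd_zero(2)[OF g]
    by blast
  then show ?thesis
    using Leibniz[OF c g' x] clift_closed[OF rg_homD(2)[OF M.cobd_closed[OF c]] rg_homD(2)[OF g'] x1]
    by (simp add: L.sign_pow_zero)
qed

text \<open>For a cocycle f one term of the Leibniz rule drops out. The remaining one carries the
  sign with exponent p, which is moved to the other side by applying it twice.\<close>

lemma clift_right_cobd:
  assumes f: "f \<in> M.Z p" and c: "c \<in> rg_hom R K (ob P q) N"
    and x: "x \<in> carrier (ob P (p + q + 1))"
  shows "clift p (q + 1) f (cobd P q c) (\<Delta> p (q + 1) x) =
    sign_pow L p (clift p q f c (\<Delta> p q (bd P (p + q + 1) x)))"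
proof -
  note f' = M.cocycle_hom[OF f]
  have x1: "x \<in> carrier (ob P (p + 1 + q))" and x2: "x \<in> carrier (ob P (p + (q + 1)))"
    using x by (simp_all add: ac_simps)
  let ?y = "clift p (q + 1) f (cobd P q c) (\<Delta> p (q + 1) x)"
  have y: "?y \<in> carrier L"
    by (rule clift_closed[OF rg_homD(2)[OF f'] rg_homD(2)[OF N.cobd_closed[OF c]] x2])
  have "clift (p + 1) q (cobd P p f) c (\<Delta> (p + 1) q x) = \<zero>\<^bsub>L\<^esub>"
    using clift_zero[OF rg_homD(2)[OF M.cobd_closed[OF f']] rg_homD(2)[OF c] _ x1] Z_cobd_zero(1)[OF f]
    by blast
  then have "sign_pow L p ?y = clift p q f c (\<Delta> p q (bd P (p + q + 1) x))"
    using Leibniz[OF f' c x] y by (simp add: L.sign_pow_closed)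
  then have "sign_pow L p (sign_pow L p ?y) = sign_pow L p (clift p q f c (\<Delta> p q (bd P (p + q + 1) x)))"
    by simp
  then show ?thesis
    using y by (simp add: L.sign_pow_sign_pow) (simp add: sign_pow_def)
qed

lemma bd_closed': "x \<in> carrier (ob P (n + 1)) \<Longrightarrow> bd P (n + 1) x \<in> carrier (ob P n)"
  using bd_closed[of x "n + 1"] by simp

lemma pcup_left_cobd:
  assumes c: "c \<in> rg_hom R K (ob P p) M" and g: "g \<in> N.Z q"
  shows "pcup s (p + 1) q (cobd P p c) g = cobd P (p + q) (pcup s p q c g)"
proof -
  have e: "p + 1 + q = p + q + 1" by simp
  show ?thesis
    using clift_left_cobd[OF c g] bd_closed'[of _ "p + q"]
    by (auto simp: pairing_cup_def cobd_def[of P "p + q"] e fun_eq_iff)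
qed

text \<open>A coboundary in the right factor is reached past degree p on the left, so the bounding
  cochain has the exponent s + p.\<close>

lemma pcup_right_cobd:
  assumes f: "f \<in> M.Z p" and c: "c \<in> rg_hom R K (ob P q) N"
  shows "pcup s p (q + 1) f (cobd P q c) = cobd P (p + q) (pcup (s + p) p q f c)"
proof -
  have e: "p + (q + 1) = p + q + 1" by simp
  have "sign_pow L s (sign_pow L p (clift p q f c (\<Delta> p q (bd P (p + q + 1) x)))) =
      sign_pow L (s + p) (clift p q f c (\<Delta> p q (bd P (p + q + 1) x)))"
    if "x \<in> carrier (ob P (p + q + 1))" for x
    using clift_closed[OF rg_homD(2)[OF M.cocycle_hom[OF f]] rg_homD(2)[OF c] bd_closed'[OF that]]
    by (rule L.sign_pow_sign_pow)
  then show ?thesis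
    using clift_right_cobd[OF f c] bd_closed'[of _ "p + q"]
    by (auto simp: pairing_cup_def cobd_def[of P "p + q"] e fun_eq_iff)
qed

lemma pcup_cocycle:
  assumes f: "f \<in> M.Z p" and g: "g \<in> N.Z q"
  shows "pcup s p q f g \<in> L.Z (p + q)"
  unfolding L.Z_iff
proof (intro conjI ballI)
  note f' = M.cocycle_hom[OF f] and g' = N.cocycle_hom[OF g]
  show "pcup s p q f g \<in> rg_hom R K (ob P (p + q)) L"
    by (rule pcup_closed[OF f' g'])
  fix x assume x: "x \<in> carrier (ob P (p + q + 1))"
  then have x1: "x \<in> carrier (ob P (p + 1 + q))"
    by (simp add: ac_simps)
  have "clift p q f g (\<Delta> p q (bd P (p + q + 1) x)) = clift (p + 1) q (cobd P p f) g (\<Delta> (p + 1) q x)"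
    by (rule clift_left_cobd[OF f' g x, symmetric])
  also have "\<dots> = \<zero>\<^bsub>L\<^esub>"
    using clift_zero[OF rg_homD(2)[OF M.cobd_closed[OF f']] rg_homD(2)[OF g'] _ x1] Z_cobd_zero(1)[OF f]
    by blast
  finally show "pcup s p q f g (bd P (p + q + 1) x) = \<zero>\<^bsub>L\<^esub>"
    using bd_closed'[OF x] by (simp add: pairing_cup_def L.sign_pow_zero)
qed

lemma pcup_left_B:
  assumes "b \<in> M.B p" and g: "g \<in> N.Z q"
  shows "pcup s p q b g \<in> L.B (p + q)"
proof -
  obtain c where c: "c \<in> rg_hom R K (ob P (p - 1)) M" "b = cobd P (p - 1) c"
    using assms(1) by (auto simp: M.B_iff)
  have e: "p - 1 + q = p + q - 1" by simp
  show ?thesis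
    using pcup_left_cobd[OF c(1) g, of s] pcup_closed[OF c(1) N.cocycle_hom[OF g], of s]
    by (auto simp: c(2) L.B_iff e)
qed

lemma pcup_right_B:
  assumes f: "f \<in> M.Z p" and "b \<in> N.B q"
  shows "pcup s p q f b \<in> L.B (p + q)"
proof -
  obtain c where c: "c \<in> rg_hom R K (ob P (q - 1)) N" "b = cobd P (q - 1) c"
    using assms(2) by (auto simp: N.B_iff)
  have e: "p + (q - 1) = p + q - 1" by simp
  show ?thesis
    using pcup_right_cobd[OF f c(1), of s] pcup_closed[OF M.cocycle_hom[OF f] c(1), of "s + p"]
    by (auto simp: c(2) L.B_iff e)
qed

text \<open>Biadditivity splits the product into b(c + g) + fc + fg. The first two terms are
  coboundaries, as one factor is a coboundary and the other a cocycle.\<close>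

lemma pcup_class:
  assumes f: "f \<in> M.Z p" and g: "g \<in> N.Z q" and b: "b \<in> M.B p" and c: "c \<in> N.B q"
  shows "L.cls (p + q) (pcup s p q (b \<oplus>\<^bsub>M.C p\<^esub> f) (c \<oplus>\<^bsub>N.C q\<^esub> g)) = L.cls (p + q) (pcup s p q f g)"
proof -
  have bZ: "b \<in> M.Z p" and cZ: "c \<in> N.Z q"
    using b c M.B_subset_Z N.B_subset_Z by auto
  have cgZ: "c \<oplus>\<^bsub>N.C q\<^esub> g \<in> N.Z q"
    using N.ZC.a_closed[of c q g] cZ g by simp
  have "pcup s p q (b \<oplus>\<^bsub>M.C p\<^esub> f) (c \<oplus>\<^bsub>N.C q\<^esub> g) =
      pcup s p q b (c \<oplus>\<^bsub>N.C q\<^esub> g) \<oplus>\<^bsub>L.C (p + q)\<^esub> pcup s p q f (c \<oplus>\<^bsub>N.C q\<^esub> g)"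
    by (rule pcup_add_left[OF M.cocycle_hom[OF bZ] M.cocycle_hom[OF f] N.cocycle_hom[OF cgZ]])
  also have "pcup s p q f (c \<oplus>\<^bsub>N.C q\<^esub> g) = pcup s p q f c \<oplus>\<^bsub>L.C (p + q)\<^esub> pcup s p q f g"
    by (rule pcup_add_right[OF M.cocycle_hom[OF f] N.cocycle_hom[OF cZ] N.cocycle_hom[OF g]])
  finally have e: "pcup s p q (b \<oplus>\<^bsub>M.C p\<^esub> f) (c \<oplus>\<^bsub>N.C q\<^esub> g) = pcup s p q b (c \<oplus>\<^bsub>N.C q\<^esub> g)
      \<oplus>\<^bsub>L.C (p + q)\<^esub> (pcup s p q f c \<oplus>\<^bsub>L.C (p + q)\<^esub> pcup s p q f g)" .
  have "pcup s p q f c \<oplus>\<^bsub>L.C (p + q)\<^esub> pcup s p q f g \<in> L.Z (p + q)"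
    using L.ZC.a_closed[of "pcup s p q f c" "p + q" "pcup s p q f g"] pcup_cocycle[OF f cZ] pcup_cocycle[OF f g]
    by simp
  then show ?thesis
    unfolding e
    by (simp only: L.cls_add_coboundary[OF pcup_left_B[OF b cgZ]]
        L.cls_add_coboundary[OF pcup_right_B[OF f c] pcup_cocycle[OF f g]])
qed

lemma pcup_zero:
  assumes f: "f \<in> rg_hom R K (ob P p) M" and g: "g \<in> rg_hom R K (ob P q) N"
    and z: "f = \<zero>\<^bsub>M.C p\<^esub> \<or> g = \<zero>\<^bsub>N.C q\<^esub>"
  shows "pcup s p q f g = \<zero>\<^bsub>L.C (p + q)\<^esub>"
  using clift_zero[OF rg_homD(2)[OF f] rg_homD(2)[OF g]] z
  by (auto simp: pairing_cup_def hom_module_simps(2) fun_eq_iff L.sign_pow_zero)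

end

text \<open>All pairs of representatives contribute the same class to the union, by
  \<open>pcup_class\<close>.\<close>

lemma cup_homogeneous_class:
  assumes "cup_pairing R H P \<Delta> \<epsilon> K M N (tensor R M N) (pure_tensor R M N)"
    and f: "f \<in> cocycles R P K M p" and g: "g \<in> cocycles R P K N q"
  shows "cup_homogeneous R P \<Delta> K M N p q (tate_class R P K M p f) (tate_class R P K N q g) =
    tate_class R P K (tensor R M N) (p + q) (cup_cochain R P \<Delta> M N p q f g)"
proof -
  interpret cup_pairing R H P \<Delta> \<epsilon> K M N "tensor R M N" "pure_tensor R M N" by fact
  have "L.cls (p + q) (cup_cochain R P \<Delta> M N p q f' g') = L.cls (p + q) (cup_cochain R P \<Delta> M N p q f g)"
    if "f' \<in> M.cls p f" "g' \<in> N.cls q g" for f' g'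
  proof -
    from that obtain b c where "b \<in> M.B p" "c \<in> N.B q"
      "f' = b \<oplus>\<^bsub>M.C p\<^esub> f" "g' = c \<oplus>\<^bsub>N.C q\<^esub> g"
      by (auto simp: M.cls_iff N.cls_iff)
    then show ?thesis
      by (simp only: cup_cochain_eq pcup_class[OF f g])
  qed
  moreover have "M.cls p f \<noteq> {}" "N.cls q g \<noteq> {}"
    using subgroup.one_closed[OF M.subgroup_B] subgroup.one_closed[OF N.subgroup_B]
    by (auto simp: M.cls_iff N.cls_iff set_eq_iff)
  ultimately show ?thesis
    unfolding cup_homogeneous_def by auto
qed

text \<open>\<open>cup\<close> sums over the degrees in which both classes are nonzero. These lie in
  S, and the other degrees in S contribute zero classes, so the cochains may be summed over
  S.\<close>

lemma represents_cup:
  assumes "cup_pairing R H P \<Delta> \<epsilon> K M N (tensor R M N) (pure_tensor R M N)"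
    and a: "represents R P K M S a \<alpha>" and b: "represents R P K N S' b \<beta>" and S: "finite S"
  shows "represents R P K (tensor R M N) {p + q |p q. p \<in> S \<and> q \<in> S'}
    (\<lambda>n. \<Oplus>\<^bsub>hom_module R K (ob P n) (tensor R M N)\<^esub>p\<in>S. cup_cochain R P \<Delta> M N p (n - p) (a p) (b (n - p)))
    (cup R P \<Delta> K M N \<alpha> \<beta>)"
proof -
  interpret cup_pairing R H P \<Delta> \<epsilon> K M N "tensor R M N" "pure_tensor R M N" by fact
  let ?cc = "\<lambda>n p. cup_cochain R P \<Delta> M N p (n - p) (a p) (b (n - p))"
  note aZ = representsD(1)[OF a] and bZ = representsD(1)[OF b]
  have cZ: "?cc n p \<in> L.Z n" for n p
    using pcup_cocycle[OF aZ[of p] bZ[of "n - p"]] by (simp add: cup_cochain_eq)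
  have inj: "additive_map (L.ZC n) (L.C n) (\<lambda>f. f)" for n
    by unfold_locales (auto simp: L.cocycle_hom hom_module_simps(1))
  have sum: "(\<Oplus>\<^bsub>L.C n\<^esub>p\<in>S. ?cc n p) = (\<Oplus>\<^bsub>L.ZC n\<^esub>p\<in>S. ?cc n p)" for n
    by (rule additive_map.map_finsum[OF inj, symmetric]) (simp add: cZ)
  have hom: "cup_homogeneous R P \<Delta> K M N p (n - p) (\<alpha> p) (\<beta> (n - p)) = L.cls n (?cc n p)" for n p
    using cup_homogeneous_class[OF assms(1) aZ[of p] bZ[of "n - p"]]
    by (simp add: representsD(2)[OF a] representsD(2)[OF b])
  \<comment> \<open>A zero class may be represented by a nonzero coboundary. As the class of the
    product does not depend on representatives, it is computed with the zero cochain
    instead.\<close>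
  have zero: "L.cls n (?cc n p) = \<zero>\<^bsub>tate R P K (tensor R M N) n\<^esub>"
    if "\<alpha> p = \<zero>\<^bsub>tate R P K M p\<^esub> \<or> \<beta> (n - p) = \<zero>\<^bsub>tate R P K N (n - p)\<^esub>" for n p
  proof -
    have M0: "\<zero>\<^bsub>M.C p\<^esub> \<in> M.Z p" and N0: "\<zero>\<^bsub>N.C (n - p)\<^esub> \<in> N.Z (n - p)"
      using M.ZC.zero_closed[of p] N.ZC.zero_closed[of "n - p"] by simp_all
    have p0: "cup_cochain R P \<Delta> M N p (n - p) f g = \<zero>\<^bsub>L.C n\<^esub>"
      if "f \<in> M.Z p" "g \<in> N.Z (n - p)" "f = \<zero>\<^bsub>M.C p\<^esub> \<or> g = \<zero>\<^bsub>N.C (n - p)\<^esub>" for f g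
      using pcup_zero[OF M.cocycle_hom[OF that(1)] N.cocycle_hom[OF that(2)] that(3)]
      by (simp add: cup_cochain_eq)
    have L0: "L.cls n \<zero>\<^bsub>L.C n\<^esub> = \<zero>\<^bsub>tate R P K (tensor R M N) n\<^esub>"
      using additive_map.map_zero[OF L.cls_additive[of n]] by simp
    have cM0: "M.cls p \<zero>\<^bsub>M.C p\<^esub> = \<zero>\<^bsub>tate R P K M p\<^esub>"
      using additive_map.map_zero[OF M.cls_additive[of p]] by simp
    have cN0: "N.cls (n - p) \<zero>\<^bsub>N.C (n - p)\<^esub> = \<zero>\<^bsub>tate R P K N (n - p)\<^esub>"
      using additive_map.map_zero[OF N.cls_additive[of "n - p"]] by simp
    from that show ?thesis
    proof
      assume "\<alpha> p = \<zero>\<^bsub>tate R P K M p\<^esub>"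
      then show ?thesis
        using cup_homogeneous_class[OF assms(1) M0 bZ[of "n - p"]] p0[OF M0 bZ] L0 cM0
        by (simp add: hom[symmetric] representsD(2)[OF b])
    next
      assume "\<beta> (n - p) = \<zero>\<^bsub>tate R P K N (n - p)\<^esub>"
      then show ?thesis
        using cup_homogeneous_class[OF assms(1) aZ[of p] N0] p0[OF aZ N0] L0 cN0
        by (simp add: hom[symmetric] representsD(2)[OF a])
    qed
  qed
  show ?thesis
    unfolding represents_def
  proof (intro conjI allI impI)
    fix n
    show "(\<Oplus>\<^bsub>L.C n\<^esub>p\<in>S. ?cc n p) \<in> L.Z n"
      using L.ZC.finsum_closed[of "?cc n" S n] cZ by (simp add: sum Pi_iff)
    let ?I = "{p. \<alpha> p \<noteq> \<zero>\<^bsub>tate R P K M p\<^esub> \<and> \<beta> (n - p) \<noteq> \<zero>\<^bsub>tate R P K N (n - p)\<^esub>}"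
    have clc: "L.cls n (?cc n p) \<in> carrier (tate R P K (tensor R M N) n)" for p
      using additive_map.closed[OF L.cls_additive] cZ by simp
    have sub: "?I \<subseteq> S"
    proof
      fix p assume p: "p \<in> ?I"
      show "p \<in> S"
      proof (rule ccontr)
        assume "p \<notin> S"
        then have "\<alpha> p = \<zero>\<^bsub>tate R P K M p\<^esub>"
          using additive_map.map_zero[OF M.cls_additive[of p]] representsD(2,3)[OF a, of p] by simp
        with p show False by simp
      qed
    qed
    have "cup R P \<Delta> K M N \<alpha> \<beta> n = (\<Oplus>\<^bsub>tate R P K (tensor R M N) n\<^esub>p\<in>?I. L.cls n (?cc n p))"
      by (simp only: cup_def hom)
    also have "\<dots> = (\<Oplus>\<^bsub>tate R P K (tensor R M N) n\<^esub>p\<in>S. L.cls n (?cc n p))"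
      using S sub zero clc by (intro L.tate.add.finprod_mono_neutral_cong_left) auto
    also have "\<dots> = L.cls n (\<Oplus>\<^bsub>L.ZC n\<^esub>p\<in>S. ?cc n p)"
      by (rule additive_map.map_finsum[OF L.cls_additive, symmetric]) (simp add: cZ)
    finally show "cup R P \<Delta> K M N \<alpha> \<beta> n = L.cls n (\<Oplus>\<^bsub>L.C n\<^esub>p\<in>S. ?cc n p)"
      by (simp add: sum)
    assume n: "n \<notin> {p + q |p q. p \<in> S \<and> q \<in> S'}"
    have "?cc n p = \<zero>\<^bsub>L.C n\<^esub>" if p: "p \<in> S" for p
    proof -
      have "n - p \<notin> S'"
      proof
        assume "n - p \<in> S'"
        then have "\<exists>p q. n = p + q \<and> p \<in> S \<and> q \<in> S'"
          using p by (intro exI[of _ p] exI[of _ "n - p"]) simp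
        with n show False by simp
      qed
      then have "b (n - p) = \<zero>\<^bsub>N.C (n - p)\<^esub>"
        by (rule representsD(3)[OF b])
      then show ?thesis
        using pcup_zero[OF M.cocycle_hom[OF aZ[of p]] N.cocycle_hom[OF bZ[of "n - p"]]]
        by (simp add: cup_cochain_eq)
    qed
    then show "(\<Oplus>\<^bsub>L.C n\<^esub>p\<in>S. ?cc n p) = \<zero>\<^bsub>L.C n\<^esub>"
      by (rule L.C.Hom.add.finprod_one_eqI)
  qed
qed

text \<open>Multiplying after the universal cup product gives, already on cochains and with the same
  sign, the cup product of the pairing \<open>mult M\<close>.\<close>

lemma represents_cup_ring:
  assumes "cup_pairing R H P \<Delta> \<epsilon> K M M M (mult M)"
    and a: "represents R P K M S a \<alpha>" and b: "represents R P K M S' b \<beta>" and S: "finite S"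
  shows "represents R P K M {p + q |p q. p \<in> S \<and> q \<in> S'}
    (\<lambda>n. \<Oplus>\<^bsub>hom_module R K (ob P n) M\<^esub>p\<in>S. pairing_cup P \<Delta> M (mult M) (p * (n - p)) p (n - p) (a p) (b (n - p)))
    (cup_ring R P \<Delta> K M \<alpha> \<beta>)"
proof -
  interpret R: cup_pairing R H P \<Delta> \<epsilon> K M M M "mult M" by fact
  have "cup_pairing R H P \<Delta> \<epsilon> K M M (tensor R M M) (pure_tensor R M M)"
    by (intro cup_pairing.intro cup_pairing_axioms.intro R.diagonal_complex_axioms pairing_tensor
        R.M.equivariant_module_axioms R.K_subset)
  note T = this
  interpret T: cup_pairing R H P \<Delta> \<epsilon> K M M "tensor R M M" "pure_tensor R M M"
    by (rule T)
  let ?m = "tensor_lift M M M (mult M)"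
  have lin: "linear_on R (tensor R M M) M ?m"
    using R.lift_linear by (simp add: linear_on_def tensor_simps)
  \<comment> \<open>Equivariance of the multiplication M \<otimes> M \<rightarrow> M, which rests on
    \<open>mu_act\<close>; it makes composition with the multiplication a map of complexes.\<close>
  have act: "?m (act (tensor R M M) k X) = act M k (?m X)"
    if k: "k \<in> K" and X: "X \<in> carrier (tensor R M M)" for k X
  proof -
    note ak = R.M.act_linear[OF k]
    have X': "X \<in> carrier R.T"
      using X by (simp add: tensor_simps)
    have "?m (act (tensor R M M) k X) = tensor_lift M M M (\<lambda>m n. act M k m \<otimes>\<^bsub>M\<^esub> act M k n) X"
      using R.lift_tensor_map(2)[OF R.bilinear_axioms ak ak X'] X' by (simp add: tensor_simps)
    also have "\<dots> = tensor_lift M M M (\<lambda>m n. act M k (m \<otimes>\<^bsub>M\<^esub> n)) X"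
      by (rule R.lift_cong[OF bilinear_compose[OF R.bilinear_axioms ak ak R.M.base_module_axioms R.M.base_module_axioms]
            bilinear_push[OF R.bilinear_axioms ak R.M.base_module_axioms] _ X'])
        (simp add: R.mu_act[OF k])
    also have "\<dots> = act M k (?m X)"
      by (rule R.lift_push[OF R.bilinear_axioms ak R.M.base_module_axioms X', symmetric])
    finally show ?thesis .
  qed
  have cm: "cochain_map R P K (tensor R M M) K M (\<lambda>n f. compose (carrier (ob P n)) ?m f)"
    by (rule T.L.cochain_map_coeff[OF R.M.cochains_axioms lin act])
  let ?F = "\<lambda>n f. compose (carrier (ob P n)) ?m f"
  have Fadd: "additive_map (T.L.C n) (R.M.C n) (?F n)" for n
    using cm by (simp add: cochain_map_def)
  have F: "?F n (cup_cochain R P \<Delta> M M p (n - p) f g) =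
      pairing_cup P \<Delta> M (mult M) (p * (n - p)) p (n - p) f g"
    if f: "f \<in> rg_hom R K (ob P p) M" and g: "g \<in> rg_hom R K (ob P (n - p)) M" for n p f g
  proof
    fix x
    note fg = T.bilinear_cochains[OF rg_homD(2)[OF f] rg_homD(2)[OF g]]
    interpret m: additive_map "tensor R M M" M ?m
      by (rule linear_on_additive_map[OF lin T.L.abelian_group_axioms R.M.abelian_group_axioms])
    have "?m (sign_pow (tensor R M M) (p * (n - p)) (T.clift p (n - p) f g (\<Delta> p (n - p) x))) =
        sign_pow M (p * (n - p)) (R.clift p (n - p) f g (\<Delta> p (n - p) x))"
      if x: "x \<in> carrier (ob P (p + (n - p)))"
    proof -
      have "?m (T.clift p (n - p) f g (\<Delta> p (n - p) x)) =
          tensor_lift (ob P p) (ob P (n - p)) M (\<lambda>u v. ?m (pure_tensor R M M (f u) (g v))) (\<Delta> p (n - p) x)"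
        by (rule tensor_pair.lift_push[OF R.tensor_pair_ob fg lin R.M.base_module_axioms R.Delta_closed[OF x]])
      also have "\<dots> = R.clift p (n - p) f g (\<Delta> p (n - p) x)"
        by (rule tensor_pair.lift_cong[OF R.tensor_pair_ob
              bilinear_push[OF fg lin R.M.base_module_axioms]
              R.bilinear_cochains[OF rg_homD(2)[OF f] rg_homD(2)[OF g]] _ R.Delta_closed[OF x]])
          (simp add: rg_hom_closed[OF f] rg_hom_closed[OF g])
      finally show ?thesis
        using T.clift_closed[OF rg_homD(2)[OF f] rg_homD(2)[OF g] x] by (simp add: m.map_sign_pow)
    qed
    then show "?F n (cup_cochain R P \<Delta> M M p (n - p) f g) x =
        pairing_cup P \<Delta> M (mult M) (p * (n - p)) p (n - p) f g x"
      by (simp add: cup_cochain_eq pairing_cup_def compose_def)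
  qed
  have aH: "a n \<in> rg_hom R K (ob P n) M" and bH: "b n \<in> rg_hom R K (ob P n) M" for n
    using representsD(1)[OF a] representsD(1)[OF b] by (simp_all add: R.M.cocycle_hom)
  have cH: "cup_cochain R P \<Delta> M M p (n - p) (a p) (b (n - p)) \<in> carrier (T.L.C n)" for n p
    using T.pcup_closed[OF aH[of p] bH[of "n - p"]] by (simp add: cup_cochain_eq hom_module_simps(1))
  have "?F n (\<Oplus>\<^bsub>T.L.C n\<^esub>p\<in>S. cup_cochain R P \<Delta> M M p (n - p) (a p) (b (n - p))) =
      (\<Oplus>\<^bsub>R.M.C n\<^esub>p\<in>S. pairing_cup P \<Delta> M (mult M) (p * (n - p)) p (n - p) (a p) (b (n - p)))" for n
    using additive_map.map_finsum[OF Fadd[of n] cH] by (simp add: F[OF aH bH])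
  then show ?thesis
    using represents_tate_map[OF T.L.cochains_axioms R.M.cochains_axioms cm represents_cup[OF T a b S]]
    by (simp add: cup_ring_def coeff_map_def)
qed

section \<open>The trivial module and the group ring\<close>

lemma group_module_trivial:
  fixes H :: "'h monoid"
  assumes "group H" "base_cring R"
  shows "group_module R H (trivial_module R)"
proof -
  interpret base_cring R by fact
  show ?thesis
    using assms(1) module_trivial_module
    by (intro group_module.intro group_module_axioms.intro equivariant_module.intro
        equivariant_module_axioms.intro linear_onI)
      (simp_all add: base_module_def group.is_monoid)
qed

lemma pairing_trivial:
  fixes R :: "'r ring" and H :: "'h monoid"
  assumes "base_cring R" "group H" "K \<subseteq> carrier H"
  defines "triv \<equiv> (trivial_module R :: ('r, 'r, 'h) rg_module)"
  shows "pairing R K triv triv triv (mult triv)"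
proof -
  interpret base_cring R by fact
  interpret t: group_module R H triv
    unfolding triv_def by (rule group_module_trivial[OF assms(2,1)])
  note t.equivariant[OF assms(3)]
  moreover have "bilinear R triv triv triv (mult triv)"
    by (intro bilinear.intro bilinear_axioms.intro tensor_pair.intro linear_onI t.base_module_axioms)
      (simp_all add: triv_def l_distr r_distr m_ac)
  ultimately show ?thesis
    by (intro pairing.intro pairing_axioms.intro) (simp_all add: triv_def)
qed

section \<open>The group ring with its action of H\<close>

locale group_automorphisms = G: group G + H: group H + base_cring R
  for R :: "'r ring" (structure) and G :: "'g monoid" and H :: "'h monoid"
    and \<phi> :: "'h \<Rightarrow> 'g \<Rightarrow> 'g" +
  assumes phi_hom: "group_hom H (AutoGroup G) \<phi>" and finite_G: "finite (carrier G)"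
begin

lemma phi_auto: "h \<in> carrier H \<Longrightarrow> \<phi> h \<in> hom G G \<inter> Bij (carrier G)"
  using group_hom.hom_closed[OF phi_hom] by (simp add: AutoGroup_def auto_def)

lemma phi_closed [simp]: "\<lbrakk>h \<in> carrier H; x \<in> carrier G\<rbrakk> \<Longrightarrow> \<phi> h x \<in> carrier G"
  using phi_auto by (auto dest: hom_in_carrier)

lemma phi_mult:
  "\<lbrakk>h \<in> carrier H; x \<in> carrier G; y \<in> carrier G\<rbrakk> \<Longrightarrow> \<phi> h (x \<otimes>\<^bsub>G\<^esub> y) = \<phi> h x \<otimes>\<^bsub>G\<^esub> \<phi> h y"
  using phi_auto by (auto simp: hom_def)

lemma phi_bij: "h \<in> carrier H \<Longrightarrow> bij_betw (\<phi> h) (carrier G) (carrier G)"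
  using phi_auto by (auto simp: Bij_def)

text \<open>\<open>AutoGroup\<close> has the multiplication of \<open>BijGroup\<close> on a smaller
  carrier, so a homomorphism into it is also an action on the underlying set.\<close>

lemma phi_action: "group_action H (carrier G) \<phi>"
proof -
  have "\<phi> h \<in> carrier (BijGroup (carrier G))" if "h \<in> carrier H" for h
    using phi_auto[OF that] by (simp add: BijGroup_def)
  moreover have "\<phi> (h \<otimes>\<^bsub>H\<^esub> k) = \<phi> h \<otimes>\<^bsub>BijGroup (carrier G)\<^esub> \<phi> k"
    if "h \<in> carrier H" "k \<in> carrier H" for h k
    using group_hom.hom_mult[OF phi_hom that] by (simp add: AutoGroup_def)
  ultimately show ?thesis
    by (intro group_action.intro group_hom.intro group_hom_axioms.intro homI H.group_axioms group_BijGroup)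
qed

sublocale action: group_action H "carrier G" \<phi>
  by (rule phi_action)

lemma phi_comp:
  "\<lbrakk>h \<in> carrier H; k \<in> carrier H; x \<in> carrier G\<rbrakk> \<Longrightarrow> \<phi> (h \<otimes>\<^bsub>H\<^esub> k) x = \<phi> h (\<phi> k x)"
  by (rule action.composition_rule)

lemma phi_one: "x \<in> carrier G \<Longrightarrow> \<phi> \<one>\<^bsub>H\<^esub> x = x"
  by (simp flip: action.id_eq_one)

lemma phi_inv: "\<lbrakk>h \<in> carrier H; x \<in> carrier G\<rbrakk> \<Longrightarrow> \<phi> h (inv\<^bsub>G\<^esub> x) = inv\<^bsub>G\<^esub> \<phi> h x"
  using group_hom.hom_inv[of G G "\<phi> h" x] phi_auto
  by (auto simp: group_hom_def group_hom_axioms_def)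

lemma phi_eq_iff:
  "\<lbrakk>h \<in> carrier H; x \<in> carrier G; a \<in> carrier G\<rbrakk> \<Longrightarrow> \<phi> (inv\<^bsub>H\<^esub> h) x = a \<longleftrightarrow> x = \<phi> h a"
  by (auto simp: phi_one simp flip: phi_comp)

abbreviation RG where "RG \<equiv> group_ring R G H \<phi>"

lemma RG_simps:
  "carrier RG = carrier G \<rightarrow>\<^sub>E carrier R"
  "\<zero>\<^bsub>RG\<^esub> = (\<lambda>x\<in>carrier G. \<zero>)"
  "f \<oplus>\<^bsub>RG\<^esub> f' = (\<lambda>x\<in>carrier G. f x \<oplus> f' x)"
  "r \<odot>\<^bsub>RG\<^esub> f = (\<lambda>x\<in>carrier G. r \<otimes> f x)"
  "f \<otimes>\<^bsub>RG\<^esub> f' = (\<lambda>x\<in>carrier G. \<Oplus>y\<in>carrier G. f y \<otimes> f' (inv\<^bsub>G\<^esub> y \<otimes>\<^bsub>G\<^esub> x))"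
  "act RG h f = (\<lambda>f\<in>carrier G \<rightarrow>\<^sub>E carrier R. \<lambda>x\<in>carrier G. f (\<phi> (inv\<^bsub>H\<^esub> h) x)) f"
  by (simp_all add: group_ring_def)

lemma add_RG: "x \<in> carrier G \<Longrightarrow> (f \<oplus>\<^bsub>RG\<^esub> f') x = f x \<oplus> f' x"
  by (simp add: RG_simps)

lemma smult_RG: "x \<in> carrier G \<Longrightarrow> (r \<odot>\<^bsub>RG\<^esub> f) x = r \<otimes> f x"
  by (simp add: RG_simps)

lemma RG_closed: "\<lbrakk>f \<in> carrier RG; x \<in> carrier G\<rbrakk> \<Longrightarrow> f x \<in> carrier R"
  by (auto simp: RG_simps)

lemma RG_eqI:
  assumes "f \<in> carrier RG" "f' \<in> carrier RG" "\<And>x. x \<in> carrier G \<Longrightarrow> f x = f' x"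
  shows "f = f'"
  using assms unfolding RG_simps by (rule PiE_ext)

lemma base_module_RG: "base_module R RG"
  unfolding base_module_def
proof (rule moduleI)
  show "abelian_group RG"
  proof (rule abelian_groupI)
    show "\<exists>f'\<in>carrier RG. f' \<oplus>\<^bsub>RG\<^esub> f = \<zero>\<^bsub>RG\<^esub>" if "f \<in> carrier RG" for f
      using RG_closed[OF that]
      by (intro bexI[of _ "\<lambda>x\<in>carrier G. \<ominus> f x"]) (auto simp: RG_simps l_neg)
  qed (auto simp: RG_simps fun_eq_iff PiE_iff a_ac extensional_def)
qed (auto simp: RG_simps fun_eq_iff PiE_iff extensional_def l_distr r_distr m_assoc is_cring)

sublocale RG: base_module R RG
  by (rule base_module_RG)

lemma act_RG:
  "\<lbrakk>f \<in> carrier RG; x \<in> carrier G\<rbrakk> \<Longrightarrow> act RG h f x = f (\<phi> (inv\<^bsub>H\<^esub> h) x)"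
  by (simp add: RG_simps)

lemma act_RG_closed: "\<lbrakk>h \<in> carrier H; f \<in> carrier RG\<rbrakk> \<Longrightarrow> act RG h f \<in> carrier RG"
  by (auto simp: RG_simps PiE_iff)

lemma group_module_RG: "group_module R H RG"
proof (intro group_module.intro group_module_axioms.intro equivariant_module.intro
    equivariant_module_axioms.intro linear_onI H.group_axioms base_module_RG)
  fix h f f' r assume h: "h \<in> carrier H" and f: "f \<in> carrier RG"
  show "act RG h f \<in> carrier RG"
    by (rule act_RG_closed[OF h f])
  show "act RG h (f \<oplus>\<^bsub>RG\<^esub> f') = act RG h f \<oplus>\<^bsub>RG\<^esub> act RG h f'" if f': "f' \<in> carrier RG"
    by (rule RG_eqI) (use h f f' in \<open>simp_all add: act_RG_closed act_RG add_RG\<close>)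
  show "act RG h (r \<odot>\<^bsub>RG\<^esub> f) = r \<odot>\<^bsub>RG\<^esub> act RG h f" if r: "r \<in> carrier R"
    by (rule RG_eqI) (use h f r in \<open>simp_all add: act_RG_closed act_RG smult_RG\<close>)
  show "act RG (h \<otimes>\<^bsub>H\<^esub> k) f = act RG h (act RG k f)" if k: "k \<in> carrier H" for k
    by (rule RG_eqI)
      (use h f k in \<open>simp_all add: act_RG_closed act_RG H.inv_mult_group phi_comp\<close>)
next
  fix f assume f: "f \<in> carrier RG"
  show "act RG \<one>\<^bsub>H\<^esub> f = f"
    by (rule RG_eqI) (use f in \<open>simp_all add: act_RG_closed act_RG phi_one\<close>)
qed

lemma mult_RG_closed: "\<lbrakk>f \<in> carrier RG; f' \<in> carrier RG\<rbrakk> \<Longrightarrow> f \<otimes>\<^bsub>RG\<^esub> f' \<in> carrier RG"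
  by (auto simp: RG_simps PiE_iff intro!: finsum_closed)

lemma mult_RG:
  "x \<in> carrier G \<Longrightarrow> (f \<otimes>\<^bsub>RG\<^esub> f') x = (\<Oplus>y\<in>carrier G. f y \<otimes> f' (inv\<^bsub>G\<^esub> y \<otimes>\<^bsub>G\<^esub> x))"
  by (simp add: RG_simps)

lemma bilinear_mult_RG: "bilinear R RG RG RG (mult RG)"
proof (intro bilinear.intro bilinear_axioms.intro tensor_pair.intro linear_onI base_module_RG)
  fix f f' f'' r
  assume f: "f \<in> carrier RG" and f': "f' \<in> carrier RG"
  note c = RG_closed[OF f] RG_closed[OF f']
  show "f' \<otimes>\<^bsub>RG\<^esub> f \<in> carrier RG" "f \<otimes>\<^bsub>RG\<^esub> f' \<in> carrier RG"
    using f f' by (simp_all add: mult_RG_closed)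
  show "(f' \<oplus>\<^bsub>RG\<^esub> f'') \<otimes>\<^bsub>RG\<^esub> f = f' \<otimes>\<^bsub>RG\<^esub> f \<oplus>\<^bsub>RG\<^esub> f'' \<otimes>\<^bsub>RG\<^esub> f"
    "f \<otimes>\<^bsub>RG\<^esub> (f' \<oplus>\<^bsub>RG\<^esub> f'') = f \<otimes>\<^bsub>RG\<^esub> f' \<oplus>\<^bsub>RG\<^esub> f \<otimes>\<^bsub>RG\<^esub> f''"
    if f'': "f'' \<in> carrier RG"
  proof -
    note c = c RG_closed[OF f'']
    have 1: "(\<Oplus>y\<in>carrier G. (f' \<oplus>\<^bsub>RG\<^esub> f'') y \<otimes> f (inv\<^bsub>G\<^esub> y \<otimes>\<^bsub>G\<^esub> x)) =
      (\<Oplus>y\<in>carrier G. f' y \<otimes> f (inv\<^bsub>G\<^esub> y \<otimes>\<^bsub>G\<^esub> x)) \<oplus> (\<Oplus>y\<in>carrier G. f'' y \<otimes> f (inv\<^bsub>G\<^esub> y \<otimes>\<^bsub>G\<^esub> x))"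
      if "x \<in> carrier G" for x
    proof -
      have "(\<Oplus>y\<in>carrier G. (f' \<oplus>\<^bsub>RG\<^esub> f'') y \<otimes> f (inv\<^bsub>G\<^esub> y \<otimes>\<^bsub>G\<^esub> x)) =
        (\<Oplus>y\<in>carrier G. f' y \<otimes> f (inv\<^bsub>G\<^esub> y \<otimes>\<^bsub>G\<^esub> x) \<oplus> f'' y \<otimes> f (inv\<^bsub>G\<^esub> y \<otimes>\<^bsub>G\<^esub> x))"
        using c that by (intro finsum_cong') (auto simp: add_RG l_distr)
      then show ?thesis
        using c that by (simp add: finsum_addf Pi_iff)
    qed
    show "(f' \<oplus>\<^bsub>RG\<^esub> f'') \<otimes>\<^bsub>RG\<^esub> f = f' \<otimes>\<^bsub>RG\<^esub> f \<oplus>\<^bsub>RG\<^esub> f'' \<otimes>\<^bsub>RG\<^esub> f"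
      by (rule RG_eqI) (use f f' f'' 1 in \<open>simp_all add: mult_RG_closed mult_RG add_RG\<close>)
    have 2: "(\<Oplus>y\<in>carrier G. f y \<otimes> (f' \<oplus>\<^bsub>RG\<^esub> f'') (inv\<^bsub>G\<^esub> y \<otimes>\<^bsub>G\<^esub> x)) =
      (\<Oplus>y\<in>carrier G. f y \<otimes> f' (inv\<^bsub>G\<^esub> y \<otimes>\<^bsub>G\<^esub> x)) \<oplus> (\<Oplus>y\<in>carrier G. f y \<otimes> f'' (inv\<^bsub>G\<^esub> y \<otimes>\<^bsub>G\<^esub> x))"
      if "x \<in> carrier G" for x
    proof -
      have "(\<Oplus>y\<in>carrier G. f y \<otimes> (f' \<oplus>\<^bsub>RG\<^esub> f'') (inv\<^bsub>G\<^esub> y \<otimes>\<^bsub>G\<^esub> x)) =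
        (\<Oplus>y\<in>carrier G. f y \<otimes> f' (inv\<^bsub>G\<^esub> y \<otimes>\<^bsub>G\<^esub> x) \<oplus> f y \<otimes> f'' (inv\<^bsub>G\<^esub> y \<otimes>\<^bsub>G\<^esub> x))"
        using c that by (intro finsum_cong') (auto simp: add_RG r_distr)
      then show ?thesis
        using c that by (simp add: finsum_addf Pi_iff)
    qed
    show "f \<otimes>\<^bsub>RG\<^esub> (f' \<oplus>\<^bsub>RG\<^esub> f'') = f \<otimes>\<^bsub>RG\<^esub> f' \<oplus>\<^bsub>RG\<^esub> f \<otimes>\<^bsub>RG\<^esub> f''"
      by (rule RG_eqI) (use f f' f'' 2 in \<open>simp_all add: mult_RG_closed mult_RG add_RG\<close>)
  qed
  show "(r \<odot>\<^bsub>RG\<^esub> f') \<otimes>\<^bsub>RG\<^esub> f = r \<odot>\<^bsub>RG\<^esub> (f' \<otimes>\<^bsub>RG\<^esub> f)"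
    "f \<otimes>\<^bsub>RG\<^esub> (r \<odot>\<^bsub>RG\<^esub> f') = r \<odot>\<^bsub>RG\<^esub> (f \<otimes>\<^bsub>RG\<^esub> f')" if r: "r \<in> carrier R"
  proof -
    have 1: "(\<Oplus>y\<in>carrier G. (r \<odot>\<^bsub>RG\<^esub> f') y \<otimes> f (inv\<^bsub>G\<^esub> y \<otimes>\<^bsub>G\<^esub> x)) =
      r \<otimes> (\<Oplus>y\<in>carrier G. f' y \<otimes> f (inv\<^bsub>G\<^esub> y \<otimes>\<^bsub>G\<^esub> x))" if "x \<in> carrier G" for x
      using c that r finite_G
      by (subst finsum_rdistr) (auto simp: smult_RG m_assoc intro!: finsum_cong')
    show "(r \<odot>\<^bsub>RG\<^esub> f') \<otimes>\<^bsub>RG\<^esub> f = r \<odot>\<^bsub>RG\<^esub> (f' \<otimes>\<^bsub>RG\<^esub> f)"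
      by (rule RG_eqI) (use f f' r 1 in \<open>simp_all add: mult_RG_closed mult_RG smult_RG\<close>)
    have 2: "(\<Oplus>y\<in>carrier G. f y \<otimes> (r \<odot>\<^bsub>RG\<^esub> f') (inv\<^bsub>G\<^esub> y \<otimes>\<^bsub>G\<^esub> x)) =
      r \<otimes> (\<Oplus>y\<in>carrier G. f y \<otimes> f' (inv\<^bsub>G\<^esub> y \<otimes>\<^bsub>G\<^esub> x))" if "x \<in> carrier G" for x
      using c that r finite_G
      by (subst finsum_rdistr) (auto simp: smult_RG m_lcomm intro!: finsum_cong')
    show "f \<otimes>\<^bsub>RG\<^esub> (r \<odot>\<^bsub>RG\<^esub> f') = r \<odot>\<^bsub>RG\<^esub> (f \<otimes>\<^bsub>RG\<^esub> f')"
      by (rule RG_eqI) (use f f' r 2 in \<open>simp_all add: mult_RG_closed mult_RG smult_RG\<close>)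
  qed
qed

text \<open>The substitution y \<mapsto> h^-1 y in the convolution sum; as h^-1 acts by an
  automorphism of G, it is compatible with forming y^-1 x.\<close>

lemma act_mult_RG:
  assumes h: "h \<in> carrier H" and f: "f \<in> carrier RG" and f': "f' \<in> carrier RG"
  shows "act RG h f \<otimes>\<^bsub>RG\<^esub> act RG h f' = act RG h (f \<otimes>\<^bsub>RG\<^esub> f')"
proof (rule RG_eqI)
  fix x assume x: "x \<in> carrier G"
  let ?k = "\<phi> (inv\<^bsub>H\<^esub> h)"
  have k: "bij_betw ?k (carrier G) (carrier G)"
    using h by (intro phi_bij) simp
  let ?t = "\<lambda>y. f y \<otimes> f' (inv\<^bsub>G\<^esub> y \<otimes>\<^bsub>G\<^esub> ?k x)"
  have t: "?t \<in> carrier G \<rightarrow> carrier R"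
    using h x RG_closed[OF f] RG_closed[OF f'] by auto
  have "(\<Oplus>y\<in>carrier G. act RG h f y \<otimes> act RG h f' (inv\<^bsub>G\<^esub> y \<otimes>\<^bsub>G\<^esub> x)) = (\<Oplus>y\<in>carrier G. ?t (?k y))"
    using h x f f' RG_closed[OF f] RG_closed[OF f']
    by (intro finsum_cong') (auto simp: act_RG phi_mult phi_inv)
  also have "\<dots> = (\<Oplus>y\<in>?k ` carrier G. ?t y)"
    using t k by (intro finsum_reindex[symmetric]) (auto simp: bij_betw_def)
  also have "?k ` carrier G = carrier G"
    using k by (simp add: bij_betw_def)
  finally show "(act RG h f \<otimes>\<^bsub>RG\<^esub> act RG h f') x = act RG h (f \<otimes>\<^bsub>RG\<^esub> f') x"
    using h x f f' by (simp add: mult_RG act_RG mult_RG_closed)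
qed (use assms in \<open>simp_all add: mult_RG_closed act_RG_closed\<close>)

lemma pairing_RG: "K \<subseteq> carrier H \<Longrightarrow> pairing R K RG RG RG (mult RG)"
  by (intro pairing.intro pairing_axioms.intro group_module.equivariant[OF group_module_RG] bilinear_mult_RG)
    (auto intro: act_mult_RG)

lemma theta_closed: "r \<in> carrier R \<Longrightarrow> theta R G a r \<in> carrier RG"
  by (auto simp: theta_def RG_simps)

lemma theta_linear: "linear_on R (trivial_module R) RG (theta R G a)"
  by (rule linear_onI; (rule RG_eqI)?)
    (auto simp: theta_closed RG.a_closed RG.smult_closed, auto simp: theta_def RG_simps)

lemma act_theta:
  assumes "h \<in> carrier H" "a \<in> carrier G" "r \<in> carrier R"
  shows "act RG h (theta R G a r) = theta R G (\<phi> h a) r"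
proof (rule RG_eqI)
  show "act RG h (theta R G a r) x = theta R G (\<phi> h a) r x" if "x \<in> carrier G" for x
    using assms that by (simp add: act_RG theta_closed) (simp add: theta_def phi_eq_iff)
qed (use assms in \<open>simp_all add: act_RG_closed theta_closed\<close>)

text \<open>In the convolution only y = a contributes, and there the second factor vanishes unless
  a^-1 x = b.\<close>

lemma theta_mult:
  assumes a: "a \<in> carrier G" and b: "b \<in> carrier G" and r: "r \<in> carrier R" "r' \<in> carrier R"
  shows "theta R G a r \<otimes>\<^bsub>RG\<^esub> theta R G b r' = theta R G (a \<otimes>\<^bsub>G\<^esub> b) (r \<otimes> r')"
proof (rule RG_eqI)
  fix x assume x: "x \<in> carrier G"
  have "(\<Oplus>y\<in>carrier G. theta R G a r y \<otimes> theta R G b r' (inv\<^bsub>G\<^esub> y \<otimes>\<^bsub>G\<^esub> x)) =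
      (\<Oplus>y\<in>carrier G. if y = a then r \<otimes> theta R G b r' (inv\<^bsub>G\<^esub> y \<otimes>\<^bsub>G\<^esub> x) else \<zero>)"
    using r x by (intro finsum_cong') (auto simp: theta_def)
  also have "\<dots> = r \<otimes> theta R G b r' (inv\<^bsub>G\<^esub> a \<otimes>\<^bsub>G\<^esub> x)"
    using a x r finite_G by (intro add.finprod_singleton_swap) (auto simp: theta_def)
  also have "\<dots> = theta R G (a \<otimes>\<^bsub>G\<^esub> b) (r \<otimes> r') x"
    using a b x r by (auto simp: theta_def simp flip: G.m_assoc)
  finally show "(theta R G a r \<otimes>\<^bsub>RG\<^esub> theta R G b r') x = theta R G (a \<otimes>\<^bsub>G\<^esub> b) (r \<otimes> r') x"
    using x by (simp add: mult_RG)
qed (use assms in \<open>simp_all add: mult_RG_closed theta_closed\<close>)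

end

section \<open>Sums over double cosets\<close>

text \<open>
  For \<open>x\<close> in a set of double coset representatives, \<open>m \<mapsto> (m y A, m y x B)\<close> identifies \<open>H/V\<close> with one
  orbit of \<open>H\<close> on \<open>H/A \<times> H/B\<close>, where \<open>V = \<^sup>y\<^sup>xB \<inter> \<^sup>yA\<close>; here \<open>H/V\<close> is decomposed along \<open>V \<le> U \<le> H\<close>.
\<close>

locale double_cosets = H: group H + A: subgroup A H + B: subgroup B H
  for H :: "'h monoid" (structure) and A B :: "'h set" +
  fixes D :: "'h set" and y :: "'h \<Rightarrow> 'h" and U V :: "'h \<Rightarrow> 'h set"
  assumes finite_H: "finite (carrier H)" and D: "D \<subseteq> carrier H"
    and double: "\<And>h. h \<in> carrier H \<Longrightarrow> \<exists>!x. x \<in> D \<and> h \<in> (A #> x) <#> B"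
    and y: "\<And>x. x \<in> D \<Longrightarrow> y x \<in> carrier H"
    and U: "\<And>x. x \<in> D \<Longrightarrow> subgroup (U x) H"
    and V: "\<And>x. x \<in> D \<Longrightarrow> V x = conj_subgroup H (y x \<otimes> x) B \<inter> conj_subgroup H (y x) A"
    and VU: "\<And>x. x \<in> D \<Longrightarrow> V x \<subseteq> U x"
begin

abbreviation cosets_A where "cosets_A \<equiv> lcosets\<^bsub>H\<lparr>carrier := carrier H\<rparr>\<^esub> A"
abbreviation cosets_B where "cosets_B \<equiv> lcosets\<^bsub>H\<lparr>carrier := carrier H\<rparr>\<^esub> B"

lemma double_iff:
  "x \<in> D \<Longrightarrow> h \<in> (A #> x) <#> B \<longleftrightarrow> (\<exists>a\<in>A. \<exists>b\<in>B. h = a \<otimes> x \<otimes> b)"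
  by (auto simp: set_mult_def r_coset_def)

lemma V_subgroup: "x \<in> D \<Longrightarrow> subgroup (V x) H"
  using D y by (auto simp: V intro!: H.subgroups_Inter_pair subgroup_conj_subgroup
      H.group_axioms A.subgroup_axioms B.subgroup_axioms)

lemma HA: "subgroup_pair H (carrier H) A"
  by (intro subgroup_pair.intro subgroup_pair_axioms.intro H.group_axioms H.subgroup_self
      A.subgroup_axioms A.subset)

lemma HB: "subgroup_pair H (carrier H) B"
  by (intro subgroup_pair.intro subgroup_pair_axioms.intro H.group_axioms H.subgroup_self
      B.subgroup_axioms B.subset)

lemma HU: "x \<in> D \<Longrightarrow> subgroup_pair H (carrier H) (U x)"
  by (intro subgroup_pair.intro subgroup_pair_axioms.intro H.group_axioms H.subgroup_self
      U subgroup.subset)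

lemma UV: "x \<in> D \<Longrightarrow> subgroup_pair H (U x) (V x)"
  by (intro subgroup_pair.intro subgroup_pair_axioms.intro H.group_axioms U V_subgroup VU)

text \<open>The disjoint union of the sets H/V(x), each written as H/U(x) \<times> U(x)/V(x), the
  shape in which two successive corestrictions produce it.\<close>

definition triples where
  "triples = Sigma D (\<lambda>x. (lcosets\<^bsub>H\<lparr>carrier := carrier H\<rparr>\<^esub> U x) \<times> (lcosets\<^bsub>H\<lparr>carrier := U x\<rparr>\<^esub> V x))"

text \<open>The element m y(x), where m is the product of the two chosen representatives; these
  products m represent H/V(x).\<close>

definition shift where
  "shift = (\<lambda>(x, C, C'). coset_rep C \<otimes> coset_rep C' \<otimes> y x)"

definition coset_pair where
  "coset_pair = (\<lambda>(x, C, C'). (shift (x, C, C') <# A, (shift (x, C, C') \<otimes> x) <# B))"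

lemma triplesD:
  assumes "(x, C, C') \<in> triples"
  shows "x \<in> D" "x \<in> carrier H" "y x \<in> carrier H" "coset_rep C \<in> carrier H" "coset_rep C' \<in> U x"
    "coset_rep C' \<in> carrier H" "shift (x, C, C') \<in> carrier H"
    "coset_rep C <# U x = C" "coset_rep C' <# V x = C'"
proof -
  show x: "x \<in> D" "x \<in> carrier H" "y x \<in> carrier H"
    using assms D y by (auto simp: triples_def)
  have C: "C \<in> lcosets\<^bsub>H\<lparr>carrier := carrier H\<rparr>\<^esub> U x" "C' \<in> lcosets\<^bsub>H\<lparr>carrier := U x\<rparr>\<^esub> V x"
    using assms by (auto simp: triples_def)
  show c: "coset_rep C \<in> carrier H" "coset_rep C' \<in> U x"
    "coset_rep C <# U x = C" "coset_rep C' <# V x = C'"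
    using subgroup_pair.coset_rep_closed[OF HU C(1)] subgroup_pair.coset_rep_closed[OF UV C(2)]
      subgroup_pair.coset_rep_coset[OF HU C(1)] subgroup_pair.coset_rep_coset[OF UV C(2)] x
    by auto
  show c': "coset_rep C' \<in> carrier H"
    using c(2) subgroup.subset[OF U[OF x(1)]] by auto
  show "shift (x, C, C') \<in> carrier H"
    using x c c' by (simp add: shift_def)
qed

text \<open>Equal coset pairs give s' = s a and s' x' = s x b, hence a x' = x b, and x and x'
  represent the same double coset. Once x' = x, the element y a y^-1 lies in V(x) and links the two
  products m.\<close>

lemma inj_coset_pair: "inj_on coset_pair triples"
proof (rule inj_onI)
  fix z z' assume zz': "z \<in> triples" "z' \<in> triples" "coset_pair z = coset_pair z'"
  obtain x C1 C2 where z: "z = (x, C1, C2)"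
    by (rule prod_cases3)
  obtain x' C1' C2' where z': "z' = (x', C1', C2')"
    by (rule prod_cases3)
  have t: "(x, C1, C2) \<in> triples" and t': "(x', C1', C2') \<in> triples"
    and eq: "coset_pair (x, C1, C2) = coset_pair (x', C1', C2')"
    using zz' by (simp_all add: z z')
  note d = triplesD[OF t] and d' = triplesD[OF t']
  note cl = d(2,3,4,6,7) and cl' = d'(2,3,4,6,7)
  let ?s = "shift (x, C1, C2)" and ?s' = "shift (x', C1', C2')"
  have eqs: "?s <# A = ?s' <# A" "(?s \<otimes> x) <# B = (?s' \<otimes> x') <# B"
    using eq by (simp_all add: coset_pair_def)
  obtain a where a: "a \<in> A" "?s' = ?s \<otimes> a"
    using eqs(1) unfolding H.lcoset_eq_iff[OF A.subgroup_axioms cl(5) cl'(5)] by blast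
  have sx: "?s \<otimes> x \<in> carrier H" "?s' \<otimes> x' \<in> carrier H"
    using cl cl' by simp_all
  obtain b where b: "b \<in> B" "?s' \<otimes> x' = ?s \<otimes> x \<otimes> b"
    using eqs(2) unfolding H.lcoset_eq_iff[OF B.subgroup_axioms sx] by blast
  have aH: "a \<in> carrier H" and bH: "b \<in> carrier H"
    using a(1) b(1) by auto
  have "?s \<otimes> (a \<otimes> x') = ?s \<otimes> a \<otimes> x'"
    using cl cl' aH by (simp add: H.m_assoc)
  also have "\<dots> = ?s \<otimes> x \<otimes> b"
    using b(2) by (simp only: a(2))
  also have "\<dots> = ?s \<otimes> (x \<otimes> b)"
    using cl bH by (simp add: H.m_assoc)
  finally have "?s \<otimes> (a \<otimes> x') = ?s \<otimes> (x \<otimes> b)" .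
  then have ax: "a \<otimes> x' = x \<otimes> b"
    using cl cl' aH bH by simp
  have "x \<otimes> b \<in> (A #> x) <#> B"
    unfolding double_iff[OF d(1)]
    by (rule bexI[of _ "\<one>"], rule bexI[of _ b]) (use cl b(1) bH A.one_closed in simp_all)
  moreover have "x \<otimes> b \<in> (A #> x') <#> B"
    unfolding double_iff[OF d'(1)]
    by (rule bexI[of _ a], rule bexI[of _ "\<one>"]) (use cl bH cl' a(1) aH ax B.one_closed in simp_all)
  moreover have "x \<otimes> b \<in> carrier H"
    using cl bH by simp
  ultimately have x: "x' = x"
    using double[of "x \<otimes> b"] d(1) d'(1) by blast
  \<comment> \<open>The quotient of the two products m. Because a x = x b, it is both the conjugate
    of a by y and the conjugate of b by y x, so it lies in the intersection V(x).\<close>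
  define v where "v = y x \<otimes> a \<otimes> inv y x"
  have vH: "v \<in> carrier H"
    using cl aH by (simp add: v_def)
  have vb: "v = y x \<otimes> x \<otimes> b \<otimes> inv (y x \<otimes> x)"
  proof -
    have "y x \<otimes> x \<otimes> b \<otimes> inv (y x \<otimes> x) = y x \<otimes> (x \<otimes> b) \<otimes> (inv x \<otimes> inv y x)"
      using cl bH by (simp add: H.inv_mult_group H.m_assoc)
    also have "\<dots> = y x \<otimes> (a \<otimes> x) \<otimes> (inv x \<otimes> inv y x)"
      using ax x by simp
    also have "\<dots> = v"
      using cl aH by (simp add: v_def H.m_assoc flip: H.m_assoc[of x "inv x"])
    finally show ?thesis ..
  qed
  have "v \<in> conj_subgroup H (y x \<otimes> x) B"
    unfolding conj_subgroup_iff by (rule bexI[of _ b]) (rule vb, rule b(1))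
  moreover have "v \<in> conj_subgroup H (y x) A"
    unfolding conj_subgroup_iff by (rule bexI[of _ a]) (rule v_def, rule a(1))
  ultimately have vV: "v \<in> V x"
    unfolding V[OF d(1)] by (rule IntI)
  have "coset_rep C1' \<otimes> coset_rep C2' \<otimes> y x = coset_rep C1 \<otimes> coset_rep C2 \<otimes> y x \<otimes> a"
    using a x by (simp add: shift_def)
  also have "\<dots> = coset_rep C1 \<otimes> coset_rep C2 \<otimes> v \<otimes> y x"
    using cl aH by (simp add: v_def H.m_assoc)
  finally have w: "coset_rep C1' \<otimes> coset_rep C2' = coset_rep C1 \<otimes> coset_rep C2 \<otimes> v"
    using cl cl' vH by (simp add: x)
  have u': "coset_rep C2' \<in> U x"
    using d'(5) x by simp
  interpret U: subgroup "U x" H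
    by (rule U[OF d(1)])
  \<comment> \<open>As v and both inner representatives lie in U(x), the outer representatives
    define the same coset of U(x). After they are cancelled, the inner ones differ by v \<in>
    V(x).\<close>
  have "coset_rep C1' = coset_rep C1 \<otimes> (coset_rep C2 \<otimes> v \<otimes> inv coset_rep C2')"
  proof -
    have "coset_rep C1' = coset_rep C1' \<otimes> coset_rep C2' \<otimes> inv coset_rep C2'"
      using cl' by (simp add: H.m_assoc)
    then show ?thesis
      using cl cl' vH by (simp add: w H.m_assoc)
  qed
  moreover have "coset_rep C2 \<otimes> v \<otimes> inv coset_rep C2' \<in> U x"
    using d(5) u' vV VU[OF d(1)] by auto
  ultimately have "coset_rep C1 <# U x = coset_rep C1' <# U x"
    using cl cl' by (subst H.lcoset_eq_iff[OF U.subgroup_axioms]) auto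
  then have C1: "C1' = C1"
    using d(8) d'(8) x by simp
  have "coset_rep C2' = coset_rep C2 \<otimes> v"
    using w cl cl' vH by (simp add: C1 H.m_assoc)
  then have "coset_rep C2 <# V x = coset_rep C2' <# V x"
    using cl cl' vV by (subst H.lcoset_eq_iff[OF V_subgroup[OF d(1)]]) auto
  then have "C2' = C2"
    using d(9) d'(9) x by simp
  with x C1 show "z = z'"
    by (simp add: z z')
qed

text \<open>Given the cosets uA and vB, write u^-1 v = a x b with x \<in> D. Then m = u a y^-1
  satisfies m y = u a and m y x = v b^-1, so it reaches both cosets.\<close>

lemma image_coset_pair: "coset_pair ` triples = cosets_A \<times> cosets_B"
proof
  show "coset_pair ` triples \<subseteq> cosets_A \<times> cosets_B"
  proof (rule image_subsetI)
    fix t assume "t \<in> triples"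
    moreover obtain x C C' where xC: "t = (x, C, C')"
      by (cases t) auto
    ultimately have t: "(x, C, C') \<in> triples"
      by simp
    show "coset_pair t \<in> cosets_A \<times> cosets_B"
      using triplesD[OF t] subgroup_pair.coset_mem[OF HA, of "shift (x, C, C')"]
        subgroup_pair.coset_mem[OF HB, of "shift (x, C, C') \<otimes> x"]
      by (simp add: coset_pair_def xC)
  qed
  show "cosets_A \<times> cosets_B \<subseteq> coset_pair ` triples"
  proof clarify
    fix X Y assume XY: "X \<in> cosets_A" "Y \<in> cosets_B"
    then obtain u v where u: "u \<in> carrier H" "X = u <# A" and v: "v \<in> carrier H" "Y = v <# B"
      unfolding H.lcosets_update_iff by blast
    have "inv u \<otimes> v \<in> carrier H"
      using u v by simp
    from double[OF this] obtain x where x: "x \<in> D" "inv u \<otimes> v \<in> (A #> x) <#> B"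
      by auto
    then obtain a b where ab: "a \<in> A" "b \<in> B" "inv u \<otimes> v = a \<otimes> x \<otimes> b"
      by (auto simp: double_iff)
    have H: "a \<in> carrier H" "b \<in> carrier H" "x \<in> carrier H" "y x \<in> carrier H"
      using ab x D y by auto
    interpret U: subgroup "U x" H
      by (rule U[OF x(1)])
    note HU_mem = subgroup_pair.coset_mem[OF HU[OF x(1)]]
    interpret UV: subgroup_pair H "U x" "V x"
      by (rule UV[OF x(1)])
    define m where "m = u \<otimes> a \<otimes> inv y x"
    have mH: "m \<in> carrier H"
      using u H by (simp add: m_def)
    define C where "C = m <# U x"
    \<comment> \<open>The representative chosen in mU(x) is m w. Taking the inner coset of w^-1
      restores m up to some c \<in> V(x), which the cosets of A and B absorb because c y = y a' and
      c y x = y x b'.\<close>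
    obtain w where w: "w \<in> U x" "coset_rep C = m \<otimes> w"
      using H.coset_rep[OF U.subgroup_axioms mH] by (auto simp: C_def)
    define C' where "C' = inv w <# V x"
    obtain c where c: "c \<in> V x" "coset_rep C' = inv w \<otimes> c"
      using H.coset_rep[OF UV.L.subgroup_axioms, of "inv w"] w by (auto simp: C'_def)
    have wH: "w \<in> carrier H" and cH: "c \<in> carrier H"
      using w c by auto
    have t: "(x, C, C') \<in> triples"
      using x w HU_mem[OF mH] UV.coset_mem[of "inv w"] by (simp add: triples_def C_def C'_def)
    have s: "shift (x, C, C') = m \<otimes> c \<otimes> y x"
      using mH wH cH H by (simp add: shift_def w c H.m_assoc flip: H.m_assoc[of w "inv w"])
    from c obtain a' where a': "a' \<in> A" "c = y x \<otimes> a' \<otimes> inv y x"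
      using x by (auto simp: V conj_subgroup_iff)
    from c obtain b' where b': "b' \<in> B" "c = y x \<otimes> x \<otimes> b' \<otimes> inv (y x \<otimes> x)"
      using x by (auto simp: V conj_subgroup_iff)
    have H': "a' \<in> carrier H" "b' \<in> carrier H"
      using a' b' by auto
    have "c \<otimes> y x = y x \<otimes> a'"
      using H H' by (simp add: a' H.m_assoc)
    then have s1: "shift (x, C, C') = u \<otimes> (a \<otimes> a')"
      using u H H' cH mH by (simp add: s m_def H.m_assoc) (simp flip: H.m_assoc)
    have "c \<otimes> (y x \<otimes> x) = y x \<otimes> x \<otimes> b'"
      unfolding b'(2) using H H' by (simp only: H.m_assoc H.m_closed H.inv_closed H.l_inv H.r_one)
    then have "shift (x, C, C') \<otimes> x = m \<otimes> (y x \<otimes> x \<otimes> b')"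
      using H cH mH by (simp add: s H.m_assoc)
    also have "\<dots> = u \<otimes> (a \<otimes> x \<otimes> b')"
      using u H H' by (simp add: m_def H.m_assoc) (simp flip: H.m_assoc)
    also have "a \<otimes> x = inv u \<otimes> v \<otimes> inv b"
      using ab u v H by (simp add: H.m_assoc)
    finally have s2: "shift (x, C, C') \<otimes> x = v \<otimes> (inv b \<otimes> b')"
      using u v H H' by (simp add: H.m_assoc) (simp flip: H.m_assoc)
    have "X = shift (x, C, C') <# A"
      unfolding u(2) using s1 ab a' u H H' 
      by (subst H.lcoset_eq_iff[OF A.subgroup_axioms]) auto
    moreover have "Y = (shift (x, C, C') \<otimes> x) <# B"
      unfolding v(2) using s2 ab b' v H H' triplesD(7)[OF t]
      by (subst H.lcoset_eq_iff[OF B.subgroup_axioms]) auto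
    ultimately show "(X, Y) \<in> coset_pair ` triples"
      using t by (auto simp: coset_pair_def intro!: rev_image_eqI)
  qed
qed

text \<open>The nested sums are flattened to \<open>triples\<close> and reindexed along
  \<open>coset_pair\<close>. Invariance of E is needed because the representatives chosen in H/A and
  H/B need not be the elements m y and m y x.\<close>

lemma finsum_double_cosets:
  assumes "abelian_monoid M"
    and cl: "\<And>u v. \<lbrakk>u \<in> carrier H; v \<in> carrier H\<rbrakk> \<Longrightarrow> E u v \<in> carrier M"
    and EA: "\<And>u v a. \<lbrakk>u \<in> carrier H; v \<in> carrier H; a \<in> A\<rbrakk> \<Longrightarrow> E (u \<otimes> a) v = E u v"
    and EB: "\<And>u v b. \<lbrakk>u \<in> carrier H; v \<in> carrier H; b \<in> B\<rbrakk> \<Longrightarrow> E u (v \<otimes> b) = E u v"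
  shows "(\<Oplus>\<^bsub>M\<^esub>x\<in>D. \<Oplus>\<^bsub>M\<^esub>C\<in>lcosets\<^bsub>H\<lparr>carrier := carrier H\<rparr>\<^esub> U x. \<Oplus>\<^bsub>M\<^esub>C'\<in>lcosets\<^bsub>H\<lparr>carrier := U x\<rparr>\<^esub> V x.
      E (coset_rep C \<otimes> coset_rep C' \<otimes> y x) (coset_rep C \<otimes> coset_rep C' \<otimes> (y x \<otimes> x))) =
    (\<Oplus>\<^bsub>M\<^esub>z\<in>cosets_A \<times> cosets_B. E (coset_rep (fst z)) (coset_rep (snd z)))"
proof -
  interpret M: abelian_monoid M by fact
  let ?E = "\<lambda>x C C'. E (coset_rep C \<otimes> coset_rep C' \<otimes> y x) (coset_rep C \<otimes> coset_rep C' \<otimes> (y x \<otimes> x))"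
  let ?CU = "\<lambda>x. lcosets\<^bsub>H\<lparr>carrier := carrier H\<rparr>\<^esub> U x" and ?CV = "\<lambda>x. lcosets\<^bsub>H\<lparr>carrier := U x\<rparr>\<^esub> V x"
  have fin: "finite (?CU x)" "finite (?CV x)" if "x \<in> D" for x
    by (rule subgroup_pair.finite_cosets[OF HU[OF that] finite_H])
      (rule subgroup_pair.finite_cosets[OF UV[OF that] finite_H])
  have pcl: "E (coset_rep (fst z)) (coset_rep (snd z)) \<in> carrier M" if "z \<in> cosets_A \<times> cosets_B" for z
    by (rule cl[OF subgroup_pair.coset_rep_closed[OF HA] subgroup_pair.coset_rep_closed[OF HB]])
      (use that in \<open>simp_all add: mem_Times_iff\<close>)
  have finD: "finite D"
    using D finite_H by (rule finite_subset)
  have Ecl: "?E x C C' \<in> carrier M" if "x \<in> D" "C \<in> ?CU x" "C' \<in> ?CV x" for x C C'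
  proof -
    have t: "(x, C, C') \<in> triples"
      using that by (simp add: triples_def)
    show ?thesis
      using triplesD[OF t] by (intro cl) auto
  qed
  have "(\<Oplus>\<^bsub>M\<^esub>x\<in>D. \<Oplus>\<^bsub>M\<^esub>C\<in>?CU x. \<Oplus>\<^bsub>M\<^esub>C'\<in>?CV x. ?E x C C') =
      (\<Oplus>\<^bsub>M\<^esub>x\<in>D. \<Oplus>\<^bsub>M\<^esub>z\<in>?CU x \<times> ?CV x. ?E x (fst z) (snd z))"
    using fin Ecl by (intro M.finsum_cong' refl M.add.finprod_Sigma) (auto intro!: M.finsum_closed)
  also have "\<dots> = (\<Oplus>\<^bsub>M\<^esub>t\<in>triples. ?E (fst t) (fst (snd t)) (snd (snd t)))"
    unfolding triples_def using finD fin Ecl by (intro M.add.finprod_Sigma) auto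
  also have "\<dots> = (\<Oplus>\<^bsub>M\<^esub>t\<in>triples. E (coset_rep (fst (coset_pair t))) (coset_rep (snd (coset_pair t))))"
  proof (rule M.finsum_cong')
    fix t assume "t \<in> triples"
    moreover obtain x C C' where t: "t = (x, C, C')"
      by (cases t) auto
    ultimately have T: "(x, C, C') \<in> triples"
      by simp
    note d = triplesD[OF T]
    let ?s = "shift (x, C, C')"
    have "E (coset_rep (?s <# A)) (coset_rep ((?s \<otimes> x) <# B)) = E (coset_rep (?s <# A)) (?s \<otimes> x)"
    proof (rule subgroup_pair.coset_rep_invariant[OF HB])
      have "coset_rep (?s <# A) \<in> carrier H"
        using d by (intro subgroup_pair.coset_rep_closed[OF HA] subgroup_pair.coset_mem[OF HA]) auto
      then show "E (coset_rep (?s <# A)) (u \<otimes> l) = E (coset_rep (?s <# A)) u"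
        if "u \<in> carrier H" "l \<in> B" for u l
        using that by (intro EB)
    qed (use d in auto)
    also have "\<dots> = E ?s (?s \<otimes> x)"
      by (rule subgroup_pair.coset_rep_invariant[OF HA, where E = "\<lambda>u. E u (?s \<otimes> x)"]) (use d in \<open>auto intro: EA\<close>)
    finally have e: "E (coset_rep (?s <# A)) (coset_rep ((?s \<otimes> x) <# B)) = E ?s (?s \<otimes> x)" .
    have "?s \<otimes> x = coset_rep C \<otimes> coset_rep C' \<otimes> (y x \<otimes> x)"
      using d by (simp add: shift_def H.m_assoc)
    with e show "?E (fst t) (fst (snd t)) (snd (snd t)) =
        E (coset_rep (fst (coset_pair t))) (coset_rep (snd (coset_pair t)))"
      by (simp add: t coset_pair_def shift_def)
  next
    show "(\<lambda>t. E (coset_rep (fst (coset_pair t))) (coset_rep (snd (coset_pair t)))) \<in> triples \<rightarrow> carrier M"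
    proof
      fix t assume "t \<in> triples"
      then have "coset_pair t \<in> cosets_A \<times> cosets_B"
        using image_coset_pair by blast
      then show "E (coset_rep (fst (coset_pair t))) (coset_rep (snd (coset_pair t))) \<in> carrier M"
        by (rule pcl)
    qed
  qed simp
  also have "\<dots> = (\<Oplus>\<^bsub>M\<^esub>z\<in>coset_pair ` triples. E (coset_rep (fst z)) (coset_rep (snd z)))"
    using pcl by (intro M.finsum_reindex[symmetric] inj_coset_pair) (auto simp: image_coset_pair)
  finally show ?thesis
    by (simp only: image_coset_pair)
qed

end

section \<open>The product formula\<close>

lemma cochain_map_closed:
  assumes "cochain_map R P K M L N F" and "f \<in> rg_hom R K (ob P n) M"
  shows "F n f \<in> rg_hom R L (ob P n) N"
  using additive_map.closed[of "hom_module R K (ob P n) M" "hom_module R L (ob P n) N" "F n" f] assms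
  by (simp add: cochain_map_def hom_module_simps(1))

locale product_setting = diagonal_complex R H P \<Delta> \<epsilon> + group_automorphisms R G H \<phi>
  for R :: "'r ring" (structure) and H :: "'h monoid" and P :: "('r, 'p, 'h) rg_complex"
    and \<Delta> :: "int \<Rightarrow> int \<Rightarrow> 'p \<Rightarrow> ('p \<times> 'p \<Rightarrow> 'r) set" and \<epsilon> :: "'p \<Rightarrow> 'r"
    and G :: "'g monoid" and \<phi> :: "'h \<Rightarrow> 'g \<Rightarrow> 'g" +
  assumes finite_H: "finite (carrier H)"
begin

abbreviation triv :: "('r, 'r, 'h) rg_module" where "triv \<equiv> trivial_module R"
abbreviation stab where "stab a \<equiv> stabilizer H \<phi> a"
abbreviation lcos where "lcos a \<equiv> lcosets\<^bsub>H\<lparr>carrier := carrier H\<rparr>\<^esub> (stab a)"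

lemma base_cring: "base_cring R"
  by (rule base_cring_axioms)

lemma module_complex_triv: "module_complex R H P triv"
  by (intro module_complex.intro group_complex_axioms group_module_trivial H.group_axioms base_cring)

lemma module_complex_RG: "module_complex R H P RG"
  by (intro module_complex.intro group_complex_axioms group_module_RG)

sublocale triv: base_module R triv
  unfolding base_module_def by (rule module_trivial_module)

lemma bilinear_triv: "bilinear R triv triv triv (mult triv)"
  using pairing_trivial[OF base_cring H.group_axioms subset_refl] by (rule pairing.axioms)

lemma stab_subgroup: "a \<in> carrier G \<Longrightarrow> subgroup (stab a) H"
  by (rule action.stabilizer_subgroup)

lemma stab_pair: "a \<in> carrier G \<Longrightarrow> subgroup_pair H (carrier H) (stab a)"
  by (intro subgroup_pair.intro subgroup_pair_axioms.intro H.group_axioms H.subgroup_self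
      stab_subgroup subgroup.subset)

lemma corestriction_stab: "a \<in> carrier G \<Longrightarrow> corestriction R H P RG (carrier H) (stab a)"
  by (intro corestriction.intro corestriction_axioms.intro module_complex_RG stab_pair finite_H)

lemma cochains_triv: "K \<subseteq> carrier H \<Longrightarrow> cochains R H P K triv"
  by (rule module_complex.cochains_subset[OF module_complex_triv])

lemma cochains_RG: "K \<subseteq> carrier H \<Longrightarrow> cochains R H P K RG"
  by (rule module_complex.cochains_subset[OF module_complex_RG])

lemma cup_pairing_triv: "K \<subseteq> carrier H \<Longrightarrow> cup_pairing R H P \<Delta> \<epsilon> K triv triv triv (mult triv)"
  by (intro cup_pairing.intro cup_pairing_axioms.intro diagonal_complex_axioms
      pairing_trivial[OF base_cring H.group_axioms])

lemma cup_pairing_RG: "cup_pairing R H P \<Delta> \<epsilon> (carrier H) RG RG RG (mult RG)"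
  by (intro cup_pairing.intro cup_pairing_axioms.intro diagonal_complex_axioms pairing_RG subset_refl)

definition psi_cochain where
  "psi_cochain a n f =
    cor_cochain H P (carrier H) (stab a) RG n (compose (carrier (ob P n)) (theta R G a) f)"

lemma cochain_map_theta:
  assumes a: "a \<in> carrier G"
  shows "cochain_map R P (stab a) triv (stab a) RG (\<lambda>n. compose (carrier (ob P n)) (theta R G a))"
proof -
  have sub: "stab a \<subseteq> carrier H"
    by (rule action.stabilizer_subset)
  show ?thesis
  proof (rule cochains.cochain_map_coeff[OF cochains_triv[OF sub] cochains_RG[OF sub] theta_linear])
    fix k x assume "k \<in> stab a" "x \<in> carrier triv"
    then show "theta R G a (act triv k x) = act RG k (theta R G a x)"
      using a by (simp add: act_theta stabilizer_def)
  qed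
qed

lemma cochain_map_psi:
  assumes a: "a \<in> carrier G"
  shows "cochain_map R P (stab a) RG (carrier H) RG (cor_cochain H P (carrier H) (stab a) RG)"
  by (rule corestriction.cochain_map_cor[OF corestriction_stab[OF a]])

lemma represents_psi:
  assumes a: "a \<in> carrier G" and r: "represents R P (stab a) triv S f \<alpha>"
  shows "represents R P (carrier H) RG S (\<lambda>n. psi_cochain a n (f n)) (psi R G H \<phi> P a \<alpha>)"
proof -
  have sub: "stab a \<subseteq> carrier H"
    by (rule action.stabilizer_subset)
  note 1 = represents_tate_map[OF cochains_triv[OF sub] cochains_RG[OF sub] cochain_map_theta[OF a] r]
  note 2 = represents_tate_map[OF cochains_RG[OF sub] cochains_RG[OF subset_refl] cochain_map_psi[OF a] 1]
  then show ?thesis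
    by (simp add: psi_def cor_def coeff_map_def psi_cochain_def)
qed

lemma psi_cochain_hom:
  assumes a: "a \<in> carrier G" and f: "f \<in> rg_hom R (stab a) (ob P n) triv"
  shows "psi_cochain a n f \<in> rg_hom R (carrier H) (ob P n) RG"
  unfolding psi_cochain_def
  by (rule cochain_map_closed[OF cochain_map_psi[OF a] cochain_map_closed[OF cochain_map_theta[OF a] f]])

lemma triv_closed: "f \<in> rg_hom R K (ob P n) triv \<Longrightarrow> x \<in> carrier (ob P n) \<Longrightarrow> f x \<in> carrier R"
  using rg_hom_closed[of f R K "ob P n" triv x] by simp

lemma lcos_rep: "a \<in> carrier G \<Longrightarrow> C \<in> lcos a \<Longrightarrow> coset_rep C \<in> carrier H"
  by (rule subgroup_pair.coset_rep_closed[OF stab_pair])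

text \<open>Translation by u affects \<theta> only through its group element, by
  \<open>act_theta\<close>; the coefficient keeps the value of f at the moved argument.\<close>

lemma psi_cochain_eq:
  assumes a: "a \<in> carrier G" and f: "f \<in> rg_hom R K (ob P n) triv" and z: "z \<in> carrier (ob P n)"
  shows "psi_cochain a n f z =
    (\<Oplus>\<^bsub>RG\<^esub>C\<in>lcos a. theta R G (\<phi> (coset_rep C) a) (f (act (ob P n) (inv\<^bsub>H\<^esub> coset_rep C) z)))"
proof -
  have "psi_cochain a n f z =
      (\<Oplus>\<^bsub>RG\<^esub>C\<in>lcos a. translate H (ob P n) RG (coset_rep C) (compose (carrier (ob P n)) (theta R G a) f) z)"
    using z by (simp only: psi_cochain_def restrict_apply'[OF z]
        corestriction.cor_cochain_eq[OF corestriction_stab[OF a]])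
  also have "\<dots> = (\<Oplus>\<^bsub>RG\<^esub>C\<in>lcos a. theta R G (\<phi> (coset_rep C) a) (f (act (ob P n) (inv\<^bsub>H\<^esub> coset_rep C) z)))"
  proof (rule RG.finsum_cong')
    fix C assume "C \<in> lcos a"
    then have "coset_rep C \<in> carrier H"
      by (rule lcos_rep[OF a])
    then show "translate H (ob P n) RG (coset_rep C) (compose (carrier (ob P n)) (theta R G a) f) z =
        theta R G (\<phi> (coset_rep C) a) (f (act (ob P n) (inv\<^bsub>H\<^esub> coset_rep C) z))"
      using z a by (simp add: translate_def compose_def P.act_closed act_theta triv_closed[OF f])
  next
    show "(\<lambda>C. theta R G (\<phi> (coset_rep C) a) (f (act (ob P n) (inv\<^bsub>H\<^esub> coset_rep C) z)))
        \<in> lcos a \<rightarrow> carrier RG"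
      using z by (intro funcsetI theta_closed triv_closed[OF f] P.act_closed H.inv_closed lcos_rep[OF a])
  qed simp
  finally show ?thesis .
qed

text \<open>The R-valued coefficient of the group element belonging to (u, v), before the cup sign.
  It takes elements of H; that only their cosets matter for equivariant f and g is
  \<open>twisted_lift_invariant\<close>.\<close>

definition twisted_lift where
  "twisted_lift p q f g z u v = tensor_lift (ob P p) (ob P q) triv
    (\<lambda>m n. f (act (ob P p) (inv\<^bsub>H\<^esub> u) m) \<otimes> g (act (ob P q) (inv\<^bsub>H\<^esub> v) n)) (\<Delta> p q z)"

lemma twisted_bilinear:
  assumes f: "linear_on R (ob P p) triv f" and g: "linear_on R (ob P q) triv g"
    and u: "u \<in> carrier H" and v: "v \<in> carrier H"
  shows "bilinear R (ob P p) (ob P q) triv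
    (\<lambda>m n. f (act (ob P p) (inv\<^bsub>H\<^esub> u) m) \<otimes> g (act (ob P q) (inv\<^bsub>H\<^esub> v) n))"
proof -
  have "linear_on R (ob P p) triv (\<lambda>m. f (act (ob P p) (inv\<^bsub>H\<^esub> u) m))"
    using u by (intro linear_on_compose[OF P.act_linear f]) simp
  moreover have "linear_on R (ob P q) triv (\<lambda>n. g (act (ob P q) (inv\<^bsub>H\<^esub> v) n))"
    using v by (intro linear_on_compose[OF P.act_linear g]) simp
  ultimately show ?thesis
    using bilinear_compose[OF bilinear_triv _ _ P.base_module_axioms P.base_module_axioms] by simp
qed

lemma twisted_lift_closed:
  assumes "linear_on R (ob P p) triv f" "linear_on R (ob P q) triv g" "u \<in> carrier H" "v \<in> carrier H"
    and z: "z \<in> carrier (ob P (p + q))"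
  shows "twisted_lift p q f g z u v \<in> carrier R"
  using linear_onD(1)[OF bilinear.lift_linear[OF twisted_bilinear[OF assms(1-4)]] Delta_closed[OF z]]
  by (simp add: twisted_lift_def)

text \<open>The action on R is trivial, so an equivariant f does not notice k^-1 in its
  argument.\<close>

lemma hom_triv_invariant:
  assumes f: "f \<in> rg_hom R K (ob P n) triv" and K: "subgroup K H" and u: "u \<in> carrier H"
    and k: "k \<in> K" and m: "m \<in> carrier (ob P n)"
  shows "f (act (ob P n) (inv\<^bsub>H\<^esub> (u \<otimes>\<^bsub>H\<^esub> k)) m) = f (act (ob P n) (inv\<^bsub>H\<^esub> u) m)"
proof -
  interpret K: subgroup K H by fact
  have kH: "k \<in> carrier H" "inv\<^bsub>H\<^esub> k \<in> K"
    using k by auto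
  show ?thesis
    using u kH m by (simp add: H.inv_mult_group P.act_mult P.act_closed rg_homD(3)[OF f] triv_closed[OF f])
qed

lemma twisted_lift_invariant:
  assumes f: "f \<in> rg_hom R K (ob P p) triv" and g: "g \<in> rg_hom R L (ob P q) triv"
    and K: "subgroup K H" and L: "subgroup L H"
    and u: "u \<in> carrier H" and v: "v \<in> carrier H" and z: "z \<in> carrier (ob P (p + q))"
  shows "k \<in> K \<Longrightarrow> twisted_lift p q f g z (u \<otimes>\<^bsub>H\<^esub> k) v = twisted_lift p q f g z u v"
    and "l \<in> L \<Longrightarrow> twisted_lift p q f g z u (v \<otimes>\<^bsub>H\<^esub> l) = twisted_lift p q f g z u v"
proof -
  note b = twisted_bilinear[OF rg_homD(2)[OF f] rg_homD(2)[OF g]]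
  show "twisted_lift p q f g z (u \<otimes>\<^bsub>H\<^esub> k) v = twisted_lift p q f g z u v" if k: "k \<in> K"
    unfolding twisted_lift_def
  proof (rule tensor_pair.lift_cong[OF tensor_pair_ob b b _ Delta_closed[OF z]])
    show "u \<otimes>\<^bsub>H\<^esub> k \<in> carrier H" "v \<in> carrier H" "u \<in> carrier H" "v \<in> carrier H"
      using u v k subgroup.subset[OF K] by auto
  qed (simp add: hom_triv_invariant[OF f K u k])
  show "twisted_lift p q f g z u (v \<otimes>\<^bsub>H\<^esub> l) = twisted_lift p q f g z u v" if l: "l \<in> L"
    unfolding twisted_lift_def
  proof (rule tensor_pair.lift_cong[OF tensor_pair_ob b b _ Delta_closed[OF z]])
    show "u \<in> carrier H" "v \<otimes>\<^bsub>H\<^esub> l \<in> carrier H" "u \<in> carrier H" "v \<in> carrier H"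
      using u v l subgroup.subset[OF L] by auto
  qed (simp add: hom_triv_invariant[OF g L v l])
qed

text \<open>Both corestrictions are expanded and multiplied by \<open>theta_mult\<close>. The tensor
  lift then commutes with the finite sum and with each linear \<open>theta\<close>, so that only
  scalars remain under it.\<close>

lemma pairing_cup_psi:
  assumes a: "a \<in> carrier G" and b: "b \<in> carrier G"
    and f: "f \<in> rg_hom R (stab a) (ob P p) triv" and g: "g \<in> rg_hom R (stab b) (ob P q) triv"
    and z: "z \<in> carrier (ob P (p + q))"
  shows "pairing_cup P \<Delta> RG (mult RG) s p q (psi_cochain a p f) (psi_cochain b q g) z =
    sign_pow RG s (\<Oplus>\<^bsub>RG\<^esub>w\<in>lcos a \<times> lcos b.
      theta R G (\<phi> (coset_rep (fst w)) a \<otimes>\<^bsub>G\<^esub> \<phi> (coset_rep (snd w)) b)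
        (twisted_lift p q f g z (coset_rep (fst w)) (coset_rep (snd w))))"
proof -
  let ?f = "\<lambda>C m. f (act (ob P p) (inv\<^bsub>H\<^esub> coset_rep C) m)"
  let ?g = "\<lambda>C n. g (act (ob P q) (inv\<^bsub>H\<^esub> coset_rep C) n)"
  let ?x = "\<lambda>w. \<phi> (coset_rep (fst w)) a \<otimes>\<^bsub>G\<^esub> \<phi> (coset_rep (snd w)) b"
  note mods = P.base_module_axioms P.base_module_axioms
  have fst_snd: "fst w \<in> lcos a" "snd w \<in> lcos b" if "w \<in> lcos a \<times> lcos b" for w
    using that unfolding mem_Times_iff by (rule conjunct1, rule conjunct2)
  have rep: "coset_rep (fst w) \<in> carrier H" "coset_rep (snd w) \<in> carrier H" if "w \<in> lcos a \<times> lcos b" for w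
    by (rule lcos_rep[OF a fst_snd(1)[OF that]]) (rule lcos_rep[OF b fst_snd(2)[OF that]])
  have fin: "finite (lcos a)" "finite (lcos b)"
    by (rule subgroup_pair.finite_cosets[OF stab_pair[OF a] finite_H])
      (rule subgroup_pair.finite_cosets[OF stab_pair[OF b] finite_H])
  have bil: "bilinear R (ob P p) (ob P q) triv (\<lambda>m n. ?f (fst w) m \<otimes> ?g (snd w) n)"
    if "w \<in> lcos a \<times> lcos b" for w
    by (rule twisted_bilinear[OF rg_homD(2)[OF f] rg_homD(2)[OF g] rep[OF that]])
  have bilRG: "bilinear R (ob P p) (ob P q) RG (\<lambda>m n. theta R G (?x w) (?f (fst w) m \<otimes> ?g (snd w) n))"
    if "w \<in> lcos a \<times> lcos b" for w
    by (rule bilinear_push[OF bil[OF that] theta_linear base_module_RG])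
  have fc: "?f C m \<in> carrier R" if "C \<in> lcos a" "m \<in> carrier (ob P p)" for C m
    using that by (intro triv_closed[OF f] P.act_closed H.inv_closed lcos_rep[OF a])
  have gc: "?g C n \<in> carrier R" if "C \<in> lcos b" "n \<in> carrier (ob P q)" for C n
    using that by (intro triv_closed[OF g] P.act_closed H.inv_closed lcos_rep[OF b])
  have prod: "psi_cochain a p f m \<otimes>\<^bsub>RG\<^esub> psi_cochain b q g n =
      (\<Oplus>\<^bsub>RG\<^esub>w\<in>lcos a \<times> lcos b. theta R G (?x w) (?f (fst w) m \<otimes> ?g (snd w) n))"
    if m: "m \<in> carrier (ob P p)" and n: "n \<in> carrier (ob P q)" for m n
  proof -
    let ?tf = "\<lambda>C. theta R G (\<phi> (coset_rep C) a) (?f C m)"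
    let ?tg = "\<lambda>C. theta R G (\<phi> (coset_rep C) b) (?g C n)"
    have tf: "?tf C \<in> carrier RG" if "C \<in> lcos a" for C
      by (rule theta_closed[OF fc[OF that m]])
    have tg: "?tg C \<in> carrier RG" if "C \<in> lcos b" for C
      by (rule theta_closed[OF gc[OF that n]])
    have gRG: "(\<Oplus>\<^bsub>RG\<^esub>C\<in>lcos b. ?tg C) \<in> carrier RG"
      by (intro RG.finsum_closed funcsetI tg)
    have lin: "additive_map RG RG (\<lambda>u. u \<otimes>\<^bsub>RG\<^esub> v)" "additive_map RG RG (\<lambda>u. v \<otimes>\<^bsub>RG\<^esub> u)"
      if "v \<in> carrier RG" for v
      by (rule linear_on_additive_map[OF bilinear.linear_left[OF bilinear_mult_RG that]
            RG.abelian_group_axioms RG.abelian_group_axioms])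
        (rule linear_on_additive_map[OF bilinear.linear_right[OF bilinear_mult_RG that]
            RG.abelian_group_axioms RG.abelian_group_axioms])
    have "psi_cochain a p f m \<otimes>\<^bsub>RG\<^esub> psi_cochain b q g n = (\<Oplus>\<^bsub>RG\<^esub>C\<in>lcos a. ?tf C) \<otimes>\<^bsub>RG\<^esub> (\<Oplus>\<^bsub>RG\<^esub>C\<in>lcos b. ?tg C)"
      by (simp only: psi_cochain_eq[OF a f m] psi_cochain_eq[OF b g n])
    also have "\<dots> = (\<Oplus>\<^bsub>RG\<^esub>C\<in>lcos a. ?tf C \<otimes>\<^bsub>RG\<^esub> (\<Oplus>\<^bsub>RG\<^esub>C\<in>lcos b. ?tg C))"
      by (rule additive_map.map_finsum[OF lin(1)[OF gRG] tf])
    also have "\<dots> = (\<Oplus>\<^bsub>RG\<^esub>C\<in>lcos a. \<Oplus>\<^bsub>RG\<^esub>C'\<in>lcos b. ?tf C \<otimes>\<^bsub>RG\<^esub> ?tg C')"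
    proof (rule RG.finsum_cong'[OF refl])
      show "?tf C \<otimes>\<^bsub>RG\<^esub> (\<Oplus>\<^bsub>RG\<^esub>C\<in>lcos b. ?tg C) = (\<Oplus>\<^bsub>RG\<^esub>C'\<in>lcos b. ?tf C \<otimes>\<^bsub>RG\<^esub> ?tg C')"
        if "C \<in> lcos a" for C
        by (rule additive_map.map_finsum[OF lin(2)[OF tf[OF that]] tg])
      show "(\<lambda>C. \<Oplus>\<^bsub>RG\<^esub>C'\<in>lcos b. ?tf C \<otimes>\<^bsub>RG\<^esub> ?tg C') \<in> lcos a \<rightarrow> carrier RG"
        by (intro funcsetI RG.finsum_closed mult_RG_closed tf tg)
    qed
    also have "\<dots> = (\<Oplus>\<^bsub>RG\<^esub>w\<in>lcos a \<times> lcos b. ?tf (fst w) \<otimes>\<^bsub>RG\<^esub> ?tg (snd w))"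
      by (rule RG.add.finprod_Sigma[OF fin(1) fin(2)]) (rule mult_RG_closed[OF tf tg])
    also have "\<dots> = (\<Oplus>\<^bsub>RG\<^esub>w\<in>lcos a \<times> lcos b. theta R G (?x w) (?f (fst w) m \<otimes> ?g (snd w) n))"
    proof (rule RG.finsum_cong'[OF refl])
      fix w assume w: "w \<in> lcos a \<times> lcos b"
      show "?tf (fst w) \<otimes>\<^bsub>RG\<^esub> ?tg (snd w) = theta R G (?x w) (?f (fst w) m \<otimes> ?g (snd w) n)"
        by (intro theta_mult phi_closed rep[OF w] a b fc gc fst_snd[OF w] m n)
    next
      show "(\<lambda>w. theta R G (?x w) (?f (fst w) m \<otimes> ?g (snd w) n)) \<in> lcos a \<times> lcos b \<rightarrow> carrier RG"
        by (intro funcsetI theta_closed m_closed fc gc fst_snd m n)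
    qed
    finally show ?thesis .
  qed
  have "tensor_lift (ob P p) (ob P q) RG (\<lambda>m n. psi_cochain a p f m \<otimes>\<^bsub>RG\<^esub> psi_cochain b q g n) (\<Delta> p q z) =
      (\<Oplus>\<^bsub>RG\<^esub>w\<in>lcos a \<times> lcos b. tensor_lift (ob P p) (ob P q) RG
        (\<lambda>m n. theta R G (?x w) (?f (fst w) m \<otimes> ?g (snd w) n)) (\<Delta> p q z))"
  proof (rule tensor_pair.lift_finsum[OF tensor_pair_ob bilRG base_module_RG _ prod _ Delta_closed[OF z]])
    show "bilinear R (ob P p) (ob P q) RG (\<lambda>m n. psi_cochain a p f m \<otimes>\<^bsub>RG\<^esub> psi_cochain b q g n)"
      by (rule bilinear_compose[OF bilinear_mult_RG rg_homD(2)[OF psi_cochain_hom[OF a f]]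
            rg_homD(2)[OF psi_cochain_hom[OF b g]] mods])
    show "finite (lcos a \<times> lcos b)"
      using fin by (rule finite_cartesian_product)
  qed
  also have "\<dots> = (\<Oplus>\<^bsub>RG\<^esub>w\<in>lcos a \<times> lcos b. theta R G (?x w)
      (twisted_lift p q f g z (coset_rep (fst w)) (coset_rep (snd w))))"
  proof (rule RG.finsum_cong'[OF refl])
    fix w assume w: "w \<in> lcos a \<times> lcos b"
    show "tensor_lift (ob P p) (ob P q) RG (\<lambda>m n. theta R G (?x w) (?f (fst w) m \<otimes> ?g (snd w) n)) (\<Delta> p q z)
        = theta R G (?x w) (twisted_lift p q f g z (coset_rep (fst w)) (coset_rep (snd w)))"
      unfolding twisted_lift_def
      by (rule tensor_pair.lift_push[OF tensor_pair_ob bil[OF w] theta_linear base_module_RG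
            Delta_closed[OF z], symmetric])
  next
    show "(\<lambda>w. theta R G (?x w) (twisted_lift p q f g z (coset_rep (fst w)) (coset_rep (snd w))))
        \<in> lcos a \<times> lcos b \<rightarrow> carrier RG"
      by (intro funcsetI theta_closed twisted_lift_closed rg_homD(2)[OF f] rg_homD(2)[OF g] rep z)
  qed
  finally show ?thesis
    using z by (simp only: pairing_cup_def restrict_apply'[OF z])
qed

text \<open>By equivariance of \<open>\<Delta>\<close> the factor w^-1 reaches both arguments, where
  h^-1 w^-1 = (w h)^-1. In this way the coset representatives of the corestrictions enter the
  coefficients on the right-hand side.\<close>

lemma pairing_cup_translate:
  assumes f: "linear_on R (ob P p) triv f" and g: "linear_on R (ob P q) triv g"
    and h: "h \<in> carrier H" "h' \<in> carrier H" and w: "w \<in> carrier H"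
    and z: "z \<in> carrier (ob P (p + q))"
  shows "pairing_cup P \<Delta> triv (mult triv) s p q (translate H (ob P p) triv h f)
      (translate H (ob P q) triv h' g) (act (ob P (p + q)) (inv\<^bsub>H\<^esub> w) z) =
    sign_pow triv s (twisted_lift p q f g z (w \<otimes>\<^bsub>H\<^esub> h) (w \<otimes>\<^bsub>H\<^esub> h'))"
proof -
  have pair: "group_module_pair R H (ob P n) triv" for n
    by (rule module_complex.pair[OF module_complex_triv])
  note tf = group_module_pair.translate_linear[OF pair f h(1)]
    and tg = group_module_pair.translate_linear[OF pair g h(2)]
  let ?b = "\<lambda>m n. translate H (ob P p) triv h f m \<otimes> translate H (ob P q) triv h' g n"
  have wi: "inv\<^bsub>H\<^esub> w \<in> carrier H"
    using w by simp
  have b: "bilinear R (ob P p) (ob P q) triv ?b"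
    using bilinear_compose[OF bilinear_triv tf tg P.base_module_axioms P.base_module_axioms] by simp
  have wh: "w \<otimes>\<^bsub>H\<^esub> h \<in> carrier H" "w \<otimes>\<^bsub>H\<^esub> h' \<in> carrier H"
    using w h by simp_all
  have eq: "translate H (ob P n) triv k e (act (ob P n) (inv\<^bsub>H\<^esub> w) m) = e (act (ob P n) (inv\<^bsub>H\<^esub> (w \<otimes>\<^bsub>H\<^esub> k)) m)"
    if "linear_on R (ob P n) triv e" "k \<in> carrier H" "m \<in> carrier (ob P n)" for n k e m
    using that w linear_onD(1)[OF that(1)]
    by (simp add: translate_def P.act_closed H.inv_mult_group P.act_mult)
  have "tensor_lift (ob P p) (ob P q) triv ?b (\<Delta> p q (act (ob P (p + q)) (inv\<^bsub>H\<^esub> w) z)) =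
      tensor_lift (ob P p) (ob P q) triv (\<lambda>m n. ?b (act (ob P p) (inv\<^bsub>H\<^esub> w) m) (act (ob P q) (inv\<^bsub>H\<^esub> w) n)) (\<Delta> p q z)"
    by (rule lift_Delta_act[OF b wi z])
  also have "\<dots> = twisted_lift p q f g z (w \<otimes>\<^bsub>H\<^esub> h) (w \<otimes>\<^bsub>H\<^esub> h')"
    unfolding twisted_lift_def
    by (rule tensor_pair.lift_cong[OF tensor_pair_ob
          bilinear_compose[OF b P.act_linear[OF wi] P.act_linear[OF wi] P.base_module_axioms P.base_module_axioms]
          twisted_bilinear[OF f g wh] _ Delta_closed[OF z]])
      (simp add: eq[OF f h(1)] eq[OF g h(2)])
  finally show ?thesis
    using P.act_closed[OF wi z] by (simp add: pairing_cup_def)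
qed

end

section \<open>The product formula, conjugate stabilizers and orbits\<close>

context product_setting
begin

lemma phi_mult_stab:
  "\<lbrakk>u \<in> carrier H; k \<in> stab e; e \<in> carrier G\<rbrakk> \<Longrightarrow> \<phi> (u \<otimes>\<^bsub>H\<^esub> k) e = \<phi> u e"
  by (simp add: stabilizer_def phi_comp)

text \<open>Stated for the group elements a, b and c(x) instead of indices, so that orbits do not
  occur. Both sides receive representing cochains, and these are shown to be equal in each degree
  n.\<close>

lemma product_formula:
  assumes a: "a \<in> carrier G" and b: "b \<in> carrier G"
    and dc: "double_cosets H (stab a) (stab b) D y (\<lambda>x. stab (c x)) V"
    and c: "\<And>x. x \<in> D \<Longrightarrow> c x = \<phi> (y x) a \<otimes>\<^bsub>G\<^esub> \<phi> (y x \<otimes>\<^bsub>H\<^esub> x) b"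
    and \<alpha>: "\<alpha> \<in> carrier (tate_total R P (stab a) triv)"
    and \<beta>: "\<beta> \<in> carrier (tate_total R P (stab b) triv)"
  shows "cup_ring R P \<Delta> (carrier H) RG (psi R G H \<phi> P a \<alpha>) (psi R G H \<phi> P b \<beta>) =
    (\<Oplus>\<^bsub>tate_total R P (carrier H) RG\<^esub>x\<in>D. psi R G H \<phi> P (c x) (cor R H P (stab (c x)) (V x) triv
      (cup_ring R P \<Delta> (V x) triv
        (res R P (V x) triv (conj_map R H P (y x) (stab a) triv \<alpha>))
        (res R P (V x) triv (conj_map R H P (y x \<otimes>\<^bsub>H\<^esub> x) (stab b) triv \<beta>)))))"
proof -
  interpret dc: double_cosets H "stab a" "stab b" D y "\<lambda>x. stab (c x)" V
    by (rule dc)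
  have stab_sub: "stab e \<subseteq> carrier H" for e
    by (rule action.stabilizer_subset)
  obtain S f where S: "finite S" and f: "represents R P (stab a) triv S f \<alpha>"
    by (rule cochains.ex_represents[OF cochains_triv[OF stab_sub] \<alpha>])
  obtain S' g where S': "finite S'" and g: "represents R P (stab b) triv S' g \<beta>"
    by (rule cochains.ex_represents[OF cochains_triv[OF stab_sub] \<beta>])
  let ?LV = "\<lambda>x. lcosets\<^bsub>H\<lparr>carrier := stab (c x)\<rparr>\<^esub> V x"
  let ?p = "\<lambda>x w v. w \<otimes>\<^bsub>H\<^esub> v \<otimes>\<^bsub>H\<^esub> y x" and ?q = "\<lambda>x w v. w \<otimes>\<^bsub>H\<^esub> v \<otimes>\<^bsub>H\<^esub> (y x \<otimes>\<^bsub>H\<^esub> x)"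
  let ?cup = "\<lambda>x. cup_ring R P \<Delta> (V x) triv
      (res R P (V x) triv (conj_map R H P (y x) (stab a) triv \<alpha>))
      (res R P (V x) triv (conj_map R H P (y x \<otimes>\<^bsub>H\<^esub> x) (stab b) triv \<beta>))"
  let ?T = "{p + q |p q. p \<in> S \<and> q \<in> S'}"
  have "?T = (\<lambda>(p, q). p + q) ` (S \<times> S')"
    by auto
  then have T: "finite ?T"
    by (simp only: finite_imageI[OF finite_cartesian_product[OF S S']])
  have fH: "f n \<in> rg_hom R (stab a) (ob P n) triv" for n
    by (rule cochains.cocycle_hom[OF cochains_triv[OF stab_sub] representsD(1)[OF f]])
  have gH: "g n \<in> rg_hom R (stab b) (ob P n) triv" for n
    by (rule cochains.cocycle_hom[OF cochains_triv[OF stab_sub] representsD(1)[OF g]])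
  let ?cc = "\<lambda>n p. pairing_cup P \<Delta> RG (mult RG) (p * (n - p)) p (n - p)
    (psi_cochain a p (f p)) (psi_cochain b (n - p) (g (n - p)))"
  let ?C = "\<lambda>n. hom_module R (carrier H) (ob P n) RG"
  have lhs: "represents R P (carrier H) RG ?T (\<lambda>n. \<Oplus>\<^bsub>?C n\<^esub>p\<in>S. ?cc n p)
      (cup_ring R P \<Delta> (carrier H) RG (psi R G H \<phi> P a \<alpha>) (psi R G H \<phi> P b \<beta>))"
    by (rule represents_cup_ring[OF cup_pairing_RG represents_psi[OF a f] represents_psi[OF b g] S])
  \<comment> \<open>The abbreviations follow the right-hand side outwards: conjugated cocycles,
    their products, the sum over the degrees p, the inner corestriction. Restriction to V(x) leaves
    a cochain as it is and does not show.\<close>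
  let ?f = "\<lambda>x n. translate H (ob P n) triv (y x) (f n)"
  let ?g = "\<lambda>x n. translate H (ob P n) triv (y x \<otimes>\<^bsub>H\<^esub> x) (g n)"
  let ?d = "\<lambda>x n p. pairing_cup P \<Delta> triv (mult triv) (p * (n - p)) p (n - p) (?f x p) (?g x (n - p))"
  let ?e = "\<lambda>x n. \<Oplus>\<^bsub>hom_module R (V x) (ob P n) triv\<^esub>p\<in>S. ?d x n p"
  let ?k = "\<lambda>x n. cor_cochain H P (stab (c x)) (V x) triv n (?e x n)"
  have D: "x \<in> carrier H" "y x \<in> carrier H" "y x \<otimes>\<^bsub>H\<^esub> x \<in> carrier H" "c x \<in> carrier G"
    "V x \<subseteq> conj_subgroup H (y x) (stab a)" "V x \<subseteq> conj_subgroup H (y x \<otimes>\<^bsub>H\<^esub> x) (stab b)"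
    if "x \<in> D" for x
  proof -
    show x: "x \<in> carrier H" "y x \<in> carrier H" "y x \<otimes>\<^bsub>H\<^esub> x \<in> carrier H"
      using subsetD[OF dc.D that] dc.y[OF that] by simp_all
    show "c x \<in> carrier G"
      unfolding c[OF that] by (intro G.m_closed phi_closed x a b)
    show "V x \<subseteq> conj_subgroup H (y x) (stab a)" "V x \<subseteq> conj_subgroup H (y x \<otimes>\<^bsub>H\<^esub> x) (stab b)"
      unfolding dc.V[OF that] by (rule Int_lower2, rule Int_lower1)
  qed
  have conj_sub: "conj_subgroup H h (stab e) \<subseteq> carrier H" if "h \<in> carrier H" "e \<in> carrier G" for h e
    by (rule subgroup.subset[OF subgroup_conj_subgroup[OF H.group_axioms stab_subgroup[OF that(2)] that(1)]])
  have res_conj: "represents R P (V x) triv S0 (\<lambda>n. translate H (ob P n) triv h (f0 n))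
      (res R P (V x) triv (conj_map R H P h (stab e) triv \<gamma>))"
    if x: "x \<in> D" and h: "h \<in> carrier H" and e: "e \<in> carrier G" and V: "V x \<subseteq> conj_subgroup H h (stab e)"
      and r: "represents R P (stab e) triv S0 f0 \<gamma>" for x h e S0 f0 \<gamma>
  proof -
    note sub = conj_sub[OF h e]
    have VH: "V x \<subseteq> carrier H"
      using V sub by (rule subset_trans)
    have "represents R P (conj_subgroup H h (stab e)) triv S0 (\<lambda>n. translate H (ob P n) triv h (f0 n))
        (conj_map R H P h (stab e) triv \<gamma>)"
      using represents_tate_map[OF cochains_triv[OF stab_sub] cochains_triv[OF sub]
          module_complex.cochain_map_conj[OF module_complex_triv stab_sub h sub] r]
      by (simp only: conj_map_def translate_def[abs_def])
    from represents_tate_map[OF cochains_triv[OF sub] cochains_triv[OF VH]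
        cochains.cochain_map_res[OF cochains_triv[OF sub] V] this]
    show ?thesis
      by (simp only: res_def)
  qed
  have cor_V: "corestriction R H P triv (stab (c x)) (V x)" if "x \<in> D" for x
    by (intro corestriction.intro corestriction_axioms.intro module_complex_triv dc.UV[OF that] finite_H)
  have VH: "V x \<subseteq> carrier H" if "x \<in> D" for x
    by (rule subgroup.subset[OF dc.V_subgroup[OF that]])
  have cup_V: "represents R P (V x) triv ?T (?e x) (?cup x)"
    if x: "x \<in> D" for x
    by (rule represents_cup_ring[OF cup_pairing_triv[OF VH[OF x]]
          res_conj[OF x D(2)[OF x] a D(5)[OF x] f] res_conj[OF x D(3)[OF x] b D(6)[OF x] g] S])
  have rhs1: "represents R P (carrier H) RG ?T (\<lambda>n. psi_cochain (c x) n (?k x n))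
      (psi R G H \<phi> P (c x) (cor R H P (stab (c x)) (V x) triv (?cup x)))"
    if x: "x \<in> D" for x
    unfolding cor_def
    by (rule represents_psi[OF D(4)[OF x] represents_tate_map[OF cochains_triv[OF VH[OF x]] cochains_triv[OF stab_sub]
          corestriction.cochain_map_cor[OF cor_V[OF x]] cup_V[OF x]]])
  note rhs = cochains.represents_finsum[OF cochains_RG[OF subset_refl] rhs1 T]
  have eH: "?e x n \<in> rg_hom R (V x) (ob P n) triv" if "x \<in> D" for x n
    by (rule cochains.cocycle_hom[OF cochains_triv[OF VH[OF that]] representsD(1)[OF cup_V[OF that]]])
  have dH: "?d x n p \<in> rg_hom R (V x) (ob P n) triv" if x: "x \<in> D" for x n p
  proof -
    note f' = cochains.cocycle_hom[OF cochains_triv[OF VH[OF x]]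
        representsD(1)[OF res_conj[OF x D(2)[OF x] a D(5)[OF x] f]]]
    note g' = cochains.cocycle_hom[OF cochains_triv[OF VH[OF x]]
        representsD(1)[OF res_conj[OF x D(3)[OF x] b D(6)[OF x] g]]]
    from cup_pairing.pcup_closed[OF cup_pairing_triv[OF VH[OF x]] f'[of p] g'[of "n - p"], of "p * (n - p)"]
    show ?thesis by simp
  qed
  have kH: "?k x n \<in> rg_hom R (stab (c x)) (ob P n) triv" if "x \<in> D" for x n
    by (rule cochain_map_closed[OF corestriction.cochain_map_cor[OF cor_V[OF that]] eH[OF that]])
  have psiH: "psi_cochain (c x) n (?k x n) \<in> rg_hom R (carrier H) (ob P n) RG" if "x \<in> D" for x n
    by (rule psi_cochain_hom[OF D(4)[OF that] kH[OF that]])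
  have ccH: "?cc n p \<in> rg_hom R (carrier H) (ob P n) RG" for n p
    using cup_pairing.pcup_closed[OF cup_pairing_RG psi_cochain_hom[OF a fH[of p]] psi_cochain_hom[OF b gH[of "n - p"]]]
    by simp
  have "(\<Oplus>\<^bsub>?C n\<^esub>p\<in>S. ?cc n p) = (\<Oplus>\<^bsub>?C n\<^esub>x\<in>D. psi_cochain (c x) n (?k x n))" for n
  proof -
    have hp: "hom_pair R (carrier H) (ob P n) RG"
      by (rule cochains.hom_pair[OF cochains_RG[OF subset_refl]])
    have "(\<Oplus>\<^bsub>RG\<^esub>p\<in>S. ?cc n p z) = (\<Oplus>\<^bsub>RG\<^esub>x\<in>D. psi_cochain (c x) n (?k x n) z)"
      if z: "z \<in> carrier (ob P n)" for z
    proof -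
      have z': "z \<in> carrier (ob P (p + (n - p)))" for p
        using z by simp
      let ?t = "\<lambda>p. twisted_lift p (n - p) (f p) (g (n - p)) z"
      let ?th = "\<lambda>u v. theta R G (\<phi> u a \<otimes>\<^bsub>G\<^esub> \<phi> v b)"
      \<comment> \<open>The summand at (u, v) with all degrees p collected inside, so that the
        reindexing over double cosets is applied to one function of (u, v).\<close>
      let ?E = "\<lambda>u v. \<Oplus>\<^bsub>RG\<^esub>p\<in>S. sign_pow RG (p * (n - p)) (?th u v (?t p u v))"
      have tc: "?t p u v \<in> carrier R" if "u \<in> carrier H" "v \<in> carrier H" for p u v
        by (rule twisted_lift_closed[OF rg_homD(2)[OF fH] rg_homD(2)[OF gH] that z'])
      have thc: "sign_pow RG s (?th u v (?t p u v)) \<in> carrier RG" if "u \<in> carrier H" "v \<in> carrier H" for s p u v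
        by (rule RG.sign_pow_closed[OF theta_closed[OF tc[OF that]]])
      have rep: "coset_rep (fst w) \<in> carrier H" "coset_rep (snd w) \<in> carrier H" if "w \<in> lcos a \<times> lcos b" for w
        by (rule lcos_rep[OF a conjunct1[OF that[unfolded mem_Times_iff]]])
          (rule lcos_rep[OF b conjunct2[OF that[unfolded mem_Times_iff]]])
      have fin: "finite (lcos a \<times> lcos b)"
        by (rule finite_cartesian_product[OF subgroup_pair.finite_cosets[OF stab_pair[OF a] finite_H]
              subgroup_pair.finite_cosets[OF stab_pair[OF b] finite_H]])
      have "(\<Oplus>\<^bsub>RG\<^esub>p\<in>S. ?cc n p z) = (\<Oplus>\<^bsub>RG\<^esub>p\<in>S. \<Oplus>\<^bsub>RG\<^esub>w\<in>lcos a \<times> lcos b.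
          sign_pow RG (p * (n - p)) (?th (coset_rep (fst w)) (coset_rep (snd w))
              (?t p (coset_rep (fst w)) (coset_rep (snd w)))))"
      proof (rule RG.finsum_cong'[OF refl])
        fix p
        have sp: "additive_map RG RG (sign_pow RG s)" for s
          by unfold_locales (simp_all add: RG.sign_pow_closed RG.sign_pow_add)
        show "?cc n p z = (\<Oplus>\<^bsub>RG\<^esub>w\<in>lcos a \<times> lcos b.
            sign_pow RG (p * (n - p)) (?th (coset_rep (fst w)) (coset_rep (snd w))
              (?t p (coset_rep (fst w)) (coset_rep (snd w)))))"
          unfolding pairing_cup_psi[OF a b fH gH z']
          by (rule additive_map.map_finsum[OF sp]) (rule theta_closed[OF tc[OF rep]])
      qed (intro funcsetI RG.finsum_closed thc rep)
      also have "\<dots> = (\<Oplus>\<^bsub>RG\<^esub>w\<in>lcos a \<times> lcos b. ?E (coset_rep (fst w)) (coset_rep (snd w)))"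
        by (rule RG.add.finprod_swap[OF S fin]) (intro thc rep)
      also have "\<dots> = (\<Oplus>\<^bsub>RG\<^esub>x\<in>D. \<Oplus>\<^bsub>RG\<^esub>C\<in>lcos (c x). \<Oplus>\<^bsub>RG\<^esub>C'\<in>?LV x.
          ?E (?p x (coset_rep C) (coset_rep C')) (?q x (coset_rep C) (coset_rep C')))"
      proof (rule dc.finsum_double_cosets[symmetric])
        show "abelian_monoid RG"
          by (rule RG.abelian_monoid_axioms)
        show "?E u v \<in> carrier RG" if "u \<in> carrier H" "v \<in> carrier H" for u v
          by (intro RG.finsum_closed funcsetI thc that)
        \<comment> \<open>Right multiplication by a stabilizer element changes neither the group
          element nor the coefficient, which is the invariance that the reindexing asks for.\<close>
        note ti = twisted_lift_invariant[OF fH gH stab_subgroup[OF a] stab_subgroup[OF b] _ _ z']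
        show "?E (u \<otimes>\<^bsub>H\<^esub> k) v = ?E u v" if "u \<in> carrier H" "v \<in> carrier H" "k \<in> stab a" for u v k
          by (simp only: phi_mult_stab[OF that(1,3) a] ti(1)[OF that])
        show "?E u (v \<otimes>\<^bsub>H\<^esub> k) = ?E u v" if "u \<in> carrier H" "v \<in> carrier H" "k \<in> stab b" for u v k
          by (simp only: phi_mult_stab[OF that(2,3) b] ti(2)[OF that])
      qed
      also have "\<dots> = (\<Oplus>\<^bsub>RG\<^esub>x\<in>D. psi_cochain (c x) n (?k x n) z)"
      proof (rule RG.finsum_cong'[OF refl])
        fix x assume x: "x \<in> D"
        interpret th: additive_map triv RG "theta R G e" for e
          by (rule linear_on_additive_map[OF theta_linear triv.abelian_group_axioms RG.abelian_group_axioms])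
        have hpV: "hom_pair R (V x) (ob P n) triv"
          by (rule cochains.hom_pair[OF cochains_triv[OF VH[OF x]]])
        have repV: "coset_rep C' \<in> stab (c x)" "coset_rep C' \<in> carrier H"
          if "C' \<in> ?LV x" for C'
          using subgroup_pair.coset_rep_closed[OF dc.UV[OF x] that]
            subsetD[OF stab_sub subgroup_pair.coset_rep_closed[OF dc.UV[OF x] that]] .
        have "psi_cochain (c x) n (?k x n) z = (\<Oplus>\<^bsub>RG\<^esub>C\<in>lcos (c x).
            theta R G (\<phi> (coset_rep C) (c x)) (?k x n (act (ob P n) (inv\<^bsub>H\<^esub> coset_rep C) z)))"
          by (rule psi_cochain_eq[OF D(4)[OF x] kH[OF x] z])
        also have "\<dots> = (\<Oplus>\<^bsub>RG\<^esub>C\<in>lcos (c x). \<Oplus>\<^bsub>RG\<^esub>C'\<in>?LV x.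
          ?E (?p x (coset_rep C) (coset_rep C')) (?q x (coset_rep C) (coset_rep C')))"
        proof (rule RG.finsum_cong'[OF refl])
          fix C assume C: "C \<in> lcos (c x)"
          let ?w = "coset_rep C"
          have w: "?w \<in> carrier H"
            by (rule lcos_rep[OF D(4)[OF x] C])
          have wz: "act (ob P n) (inv\<^bsub>H\<^esub> ?w) z \<in> carrier (ob P n)"
            by (intro P.act_closed H.inv_closed w z)
          let ?s = "\<lambda>v p. sign_pow triv (p * (n - p)) (?t p (?p x ?w v) (?q x ?w v))"
          have wv: "?p x ?w v \<in> carrier H" "?q x ?w v \<in> carrier H"
            if "v \<in> carrier H" for v
            by (intro H.m_closed w that D(2)[OF x] D(1)[OF x])+
          have sc: "?s v p \<in> carrier triv" if "v \<in> carrier H" for v p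
            by (intro triv.sign_pow_closed) (simp only: trivial_module_simps tc[OF wv[OF that]])
          \<comment> \<open>The outer action of v on R is trivial, and the arguments combine to (w
            v)^-1 z. Each product thus becomes the twisted lift at the pair (w v y, w v y
            x).\<close>
          have tr: "translate H (ob P n) triv v (?e x n) (act (ob P n) (inv\<^bsub>H\<^esub> ?w) z) = (\<Oplus>\<^bsub>triv\<^esub>p\<in>S. ?s v p)"
            if v: "v \<in> carrier H" for v
          proof -
            let ?zz = "act (ob P n) (inv\<^bsub>H\<^esub> v) (act (ob P n) (inv\<^bsub>H\<^esub> ?w) z)"
            have zz: "?zz = act (ob P n) (inv\<^bsub>H\<^esub> (?w \<otimes>\<^bsub>H\<^esub> v)) z"
              using v w z by (simp add: H.inv_mult_group P.act_mult)
            have zzc: "?zz \<in> carrier (ob P n)"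
              by (intro P.act_closed H.inv_closed v wz)
            have "translate H (ob P n) triv v (?e x n) (act (ob P n) (inv\<^bsub>H\<^esub> ?w) z) = ?e x n ?zz"
              using wz triv_closed[OF eH[OF x] zzc] by (simp add: translate_def)
            also have "\<dots> = (\<Oplus>\<^bsub>triv\<^esub>p\<in>S. ?d x n p ?zz)"
              unfolding hom_pair.hom_finsum[OF hpV dH[OF x]] using zzc by (rule restrict_apply')
            also have "\<dots> = (\<Oplus>\<^bsub>triv\<^esub>p\<in>S. ?s v p)"
            proof (rule triv.finsum_cong'[OF refl])
              show "?d x n p ?zz = ?s v p" for p
                using pairing_cup_translate[OF rg_homD(2)[OF fH[of p]] rg_homD(2)[OF gH[of "n - p"]]
                    D(2)[OF x] D(3)[OF x] H.m_closed[OF w v] z', of "p * (n - p)"]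
                unfolding zz by simp
            qed (intro funcsetI sc[OF v])
            finally show ?thesis .
          qed
          have "?k x n (act (ob P n) (inv\<^bsub>H\<^esub> ?w) z) =
              (\<Oplus>\<^bsub>triv\<^esub>C'\<in>?LV x.
                translate H (ob P n) triv (coset_rep C') (?e x n) (act (ob P n) (inv\<^bsub>H\<^esub> ?w) z))"
            unfolding corestriction.cor_cochain_eq[OF cor_V[OF x]] using wz by (rule restrict_apply')
          also have "\<dots> = (\<Oplus>\<^bsub>triv\<^esub>C'\<in>?LV x. \<Oplus>\<^bsub>triv\<^esub>p\<in>S. ?s (coset_rep C') p)"
            by (rule triv.finsum_cong'[OF refl]) (intro funcsetI triv.finsum_closed sc repV tr | assumption)+
          finally have k: "?k x n (act (ob P n) (inv\<^bsub>H\<^esub> ?w) z) = \<dots>" .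
          \<comment> \<open>Since v fixes c(x), the outer representative w may be replaced by w v;
            expanding c(x) then gives the group element that belongs to the pair (w v y, w v y
            x).\<close>
          have ph: "\<phi> ?w (c x) = \<phi> (?p x ?w v) a \<otimes>\<^bsub>G\<^esub> \<phi> (?q x ?w v) b"
            if v: "v \<in> stab (c x)" "v \<in> carrier H" for v
          proof -
            have "\<phi> ?w (c x) = \<phi> (?w \<otimes>\<^bsub>H\<^esub> v) (c x)"
              by (rule phi_mult_stab[OF w v(1) D(4)[OF x], symmetric])
            also have "\<dots> = \<phi> (?w \<otimes>\<^bsub>H\<^esub> v) (\<phi> (y x) a) \<otimes>\<^bsub>G\<^esub> \<phi> (?w \<otimes>\<^bsub>H\<^esub> v) (\<phi> (y x \<otimes>\<^bsub>H\<^esub> x) b)"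
              unfolding c[OF x] by (intro phi_mult phi_closed H.m_closed w v D[OF x] a b)
            finally show ?thesis
              by (simp only: phi_comp[OF H.m_closed[OF w v(2)] D(2)[OF x] a]
                  phi_comp[OF H.m_closed[OF w v(2)] D(3)[OF x] b])
          qed
          have "theta R G (\<phi> ?w (c x)) (?k x n (act (ob P n) (inv\<^bsub>H\<^esub> ?w) z)) =
              (\<Oplus>\<^bsub>RG\<^esub>C'\<in>?LV x. theta R G (\<phi> ?w (c x)) (\<Oplus>\<^bsub>triv\<^esub>p\<in>S. ?s (coset_rep C') p))"
            unfolding k by (rule th.map_finsum) (intro triv.finsum_closed funcsetI sc repV)
          also have "\<dots> = (\<Oplus>\<^bsub>RG\<^esub>C'\<in>?LV x.
            ?E (?p x ?w (coset_rep C')) (?q x ?w (coset_rep C')))"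
          proof (rule RG.finsum_cong'[OF refl])
            fix C' assume C': "C' \<in> ?LV x"
            let ?v = "coset_rep C'"
            note v = repV[OF C']
            have "theta R G (\<phi> ?w (c x)) (\<Oplus>\<^bsub>triv\<^esub>p\<in>S. ?s ?v p) = (\<Oplus>\<^bsub>RG\<^esub>p\<in>S. theta R G (\<phi> ?w (c x)) (?s ?v p))"
              by (rule th.map_finsum) (rule sc[OF v(2)])
            also have "\<dots> = ?E (?p x ?w ?v) (?q x ?w ?v)"
            proof (rule RG.finsum_cong'[OF refl])
              fix p
              have "?t p (?p x ?w ?v) (?q x ?w ?v) \<in> carrier triv"
                by (simp only: trivial_module_simps tc[OF wv[OF v(2)]])
              from th.map_sign_pow[OF this]
              show "theta R G (\<phi> ?w (c x)) (?s ?v p) = sign_pow RG (p * (n - p))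
                (?th (?p x ?w ?v) (?q x ?w ?v)
                  (?t p (?p x ?w ?v) (?q x ?w ?v)))"
                by (simp only: ph[OF v])
            qed (intro funcsetI thc wv v)
            finally show "theta R G (\<phi> ?w (c x)) (\<Oplus>\<^bsub>triv\<^esub>p\<in>S. ?s ?v p) = \<dots>" .
          qed (intro funcsetI RG.finsum_closed thc wv repV)
          finally show "theta R G (\<phi> ?w (c x)) (?k x n (act (ob P n) (inv\<^bsub>H\<^esub> ?w) z)) = \<dots>" .
        next
          have "?p x (coset_rep C) (coset_rep C') \<in> carrier H" "?q x (coset_rep C) (coset_rep C') \<in> carrier H"
            if "C \<in> lcos (c x)" "C' \<in> ?LV x" for C C'
            by (intro H.m_closed lcos_rep[OF D(4)[OF x] that(1)] repV[OF that(2)] D(1)[OF x] D(2)[OF x])+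
          then show "(\<lambda>C. \<Oplus>\<^bsub>RG\<^esub>C'\<in>?LV x.
              ?E (?p x (coset_rep C) (coset_rep C')) (?q x (coset_rep C) (coset_rep C')))
              \<in> lcos (c x) \<rightarrow> carrier RG"
            by (intro funcsetI RG.finsum_closed thc)
        qed
        finally show "(\<Oplus>\<^bsub>RG\<^esub>C\<in>lcos (c x). \<Oplus>\<^bsub>RG\<^esub>C'\<in>?LV x.
          ?E (?p x (coset_rep C) (coset_rep C')) (?q x (coset_rep C) (coset_rep C'))) =
          psi_cochain (c x) n (?k x n) z" ..
      next
        show "(\<lambda>x. psi_cochain (c x) n (?k x n) z) \<in> D \<rightarrow> carrier RG"
          by (intro funcsetI rg_hom_closed[OF psiH] z)
      qed
      finally show ?thesis .
    qed
    then have "(\<lambda>z\<in>carrier (ob P n). \<Oplus>\<^bsub>RG\<^esub>p\<in>S. ?cc n p z) =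
        (\<lambda>z\<in>carrier (ob P n). \<Oplus>\<^bsub>RG\<^esub>x\<in>D. psi_cochain (c x) n (?k x n) z)"
      by (rule restrict_ext)
    also have "\<dots> = (\<Oplus>\<^bsub>?C n\<^esub>x\<in>D. psi_cochain (c x) n (?k x n))"
      by (rule hom_pair.hom_finsum[OF hp psiH, symmetric])
    finally show ?thesis
      unfolding hom_pair.hom_finsum[OF hp ccH] .
  qed
  \<comment> \<open>Both sides are classes of the same cocycle in every degree.\<close>
  then show ?thesis
    by (intro ext) (simp only: representsD(2)[OF lhs] representsD(2)[OF rhs])
qed

lemma conj_stab:
  assumes l: "l \<in> conj_subgroup H h (stab e)" and h: "h \<in> carrier H" and e: "e \<in> carrier G"
  shows "l \<in> carrier H" "\<phi> l (\<phi> h e) = \<phi> h e"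
proof -
  obtain k where k: "k \<in> stab e" "l = h \<otimes>\<^bsub>H\<^esub> k \<otimes>\<^bsub>H\<^esub> inv\<^bsub>H\<^esub> h"
    using l by (auto simp: conj_subgroup_iff)
  have kH: "k \<in> carrier H"
    using k(1) action.stabilizer_subset by auto
  show lH: "l \<in> carrier H"
    using h kH by (simp add: k(2))
  have "\<phi> l (\<phi> h e) = \<phi> (l \<otimes>\<^bsub>H\<^esub> h) e"
    by (rule phi_comp[OF lH h e, symmetric])
  also have "l \<otimes>\<^bsub>H\<^esub> h = h \<otimes>\<^bsub>H\<^esub> k"
    using h kH by (simp add: k(2) H.m_assoc)
  also have "\<phi> (h \<otimes>\<^bsub>H\<^esub> k) e = \<phi> h e"
    by (rule phi_mult_stab[OF h k(1) e])
  finally show "\<phi> l (\<phi> h e) = \<phi> h e" .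
qed

text \<open>The two conjugates fix the factors ha and h'b respectively, so their intersection fixes
  the product, as H acts by automorphisms. This is the inclusion of V(x) in H_k.\<close>

lemma conj_Int_subset_stab:
  assumes "a \<in> carrier G" "b \<in> carrier G" "h \<in> carrier H" "h' \<in> carrier H"
  shows "conj_subgroup H h' (stab b) \<inter> conj_subgroup H h (stab a) \<subseteq> stab (\<phi> h a \<otimes>\<^bsub>G\<^esub> \<phi> h' b)"
proof
  fix l assume "l \<in> conj_subgroup H h' (stab b) \<inter> conj_subgroup H h (stab a)"
  then have "l \<in> conj_subgroup H h' (stab b)" "l \<in> conj_subgroup H h (stab a)"
    by auto
  from conj_stab[OF this(1) assms(4,2)] conj_stab[OF this(2) assms(3,1)]
  show "l \<in> stab (\<phi> h a \<otimes>\<^bsub>G\<^esub> \<phi> h' b)"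
    using assms by (simp add: stabilizer_def phi_mult)
qed

lemma orbit_eq_iff:
  assumes "e \<in> carrier G" "e' \<in> carrier G"
  shows "orbit H \<phi> e' = orbit H \<phi> e \<longleftrightarrow> e' \<in> orbit H \<phi> e"
proof
  assume "orbit H \<phi> e' = orbit H \<phi> e"
  with action.orbit_refl[OF assms(2)] show "e' \<in> orbit H \<phi> e"
    by simp
next
  have sub: "orbit H \<phi> x \<subseteq> orbit H \<phi> x'" if "x \<in> carrier G" "x' \<in> carrier G" "x \<in> orbit H \<phi> x'" for x x'
  proof
    fix z assume z: "z \<in> orbit H \<phi> x"
    then have "z \<in> carrier G"
      using that(1) by (auto simp: orbit_def)
    then show "z \<in> orbit H \<phi> x'"
      using action.orbit_trans[OF that(2,1) _ that(3) z] by blast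
  qed
  assume e': "e' \<in> orbit H \<phi> e"
  show "orbit H \<phi> e' = orbit H \<phi> e"
    by (rule equalityI[OF sub[OF assms(2,1) e'] sub[OF assms action.orbit_sym[OF assms e']]])
qed

text \<open>Membership of g k in the orbit of e is equality of their orbits, and k \<mapsto> orbit
  of g k is a bijection onto all orbits.\<close>

lemma orbit_representative:
  assumes g: "g ` I \<subseteq> carrier G" and bij: "bij_betw (\<lambda>k. orbit H \<phi> (g k)) I (orbits H (carrier G) \<phi>)"
    and e: "e \<in> carrier G"
  shows "\<exists>!k. k \<in> I \<and> g k \<in> orbit H \<phi> e"
proof -
  have "orbit H \<phi> e \<in> (\<lambda>k. orbit H \<phi> (g k)) ` I"
    using bij e by (auto simp: bij_betw_def orbits_def)
  then obtain k where k: "k \<in> I" "orbit H \<phi> (g k) = orbit H \<phi> e"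
    by auto
  have eq: "orbit H \<phi> (g l) = orbit H \<phi> e \<longleftrightarrow> g l \<in> orbit H \<phi> e" if "l \<in> I" for l
    using g that by (intro orbit_eq_iff e) auto
  show ?thesis
  proof (rule ex1I[of _ k])
    show "k \<in> I \<and> g k \<in> orbit H \<phi> e"
      using k eq by blast
    fix l assume l: "l \<in> I \<and> g l \<in> orbit H \<phi> e"
    then have "orbit H \<phi> (g l) = orbit H \<phi> e"
      using eq by simp
    then have "orbit H \<phi> (g l) = orbit H \<phi> (g k)"
      by (simp only: k(2))
    with l k bij show "l = k"
      unfolding bij_betw_def inj_on_def by blast
  qed
qed

end

theorem theorem5p5:
  fixes R :: "'r ring" and G :: "'g monoid" and H :: "'h monoid"
    and \<phi> :: "'h \<Rightarrow> 'g \<Rightarrow> 'g"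
    and P :: "('r, 'p, 'h) rg_complex" and \<epsilon> :: "'p \<Rightarrow> 'r"
    and \<Delta> :: "int \<Rightarrow> int \<Rightarrow> 'p \<Rightarrow> ('p \<times> 'p \<Rightarrow> 'r) set"
    and g :: "nat \<Rightarrow> 'g" and t i j :: nat and D :: "'h set"
  defines "RG \<equiv> group_ring R G H \<phi>"
    and "triv \<equiv> (trivial_module R :: ('r, 'r, 'h) rg_module)"
    and "St \<equiv> (\<lambda>k. stabilizer H \<phi> (g k))"
    and "\<psi> \<equiv> (\<lambda>k. psi R G H \<phi> P (g k))"
  assumes "group G" and "finite (carrier G)"
    and "group H" and "finite (carrier H)"
    and "group_hom H (AutoGroup G) \<phi>"
    and "cring R"
    and "R \<simeq> int_ring \<or> (field R \<and> ring_char R > 0 \<and> ring_char R dvd order G)"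
    and "complete_resolution R H P \<epsilon>"
    and "diagonal_approximation R H P \<epsilon> \<Delta>"
    and "g ` {1..t} \<subseteq> carrier G"
    and "bij_betw (\<lambda>k. orbit H \<phi> (g k)) {1..t} (orbits H (carrier G) \<phi>)"
    and "i \<in> {1..t}" and "j \<in> {1..t}"
    and "D \<subseteq> carrier H"
    and "\<forall>h\<in>carrier H. \<exists>!x. x \<in> D \<and> h \<in> (St i #>\<^bsub>H\<^esub> x) <#>\<^bsub>H\<^esub> St j"
  shows "(\<forall>x\<in>D. \<exists>!k. k \<in> {1..t} \<and>
            (\<exists>y\<in>carrier H. g k = \<phi> y (g i) \<otimes>\<^bsub>G\<^esub> \<phi> (y \<otimes>\<^bsub>H\<^esub> x) (g j))) \<and>
    (\<forall>k y V.
       (\<forall>x\<in>D. k x \<in> {1..t} \<and> y x \<in> carrier H \<and>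
          g (k x) = \<phi> (y x) (g i) \<otimes>\<^bsub>G\<^esub> \<phi> (y x \<otimes>\<^bsub>H\<^esub> x) (g j) \<and>
          V x = conj_subgroup H (y x \<otimes>\<^bsub>H\<^esub> x) (St j) \<inter> conj_subgroup H (y x) (St i))
       \<longrightarrow> (\<forall>x\<in>D. subgroup (V x) (H\<lparr>carrier := St (k x)\<rparr>)) \<and>
           (\<forall>\<alpha>\<in>carrier (tate_total R P (St i) triv). \<forall>\<beta>\<in>carrier (tate_total R P (St j) triv).
              cup_ring R P \<Delta> (carrier H) RG (\<psi> i \<alpha>) (\<psi> j \<beta>) =
              (\<Oplus>\<^bsub>tate_total R P (carrier H) RG\<^esub>x\<in>D.
                 \<psi> (k x) (cor R H P (St (k x)) (V x) triv
                   (cup_ring R P \<Delta> (V x) triv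
                     (res R P (V x) triv (conj_map R H P (y x) (St i) triv \<alpha>))
                     (res R P (V x) triv (conj_map R H P (y x \<otimes>\<^bsub>H\<^esub> x) (St j) triv \<beta>)))))))"
proof -
  have "chain_complex R H P"
    using \<open>complete_resolution R H P \<epsilon>\<close> by (simp add: complete_resolution_def)
  then interpret S: product_setting R H P \<Delta> \<epsilon> G \<phi>
    using assms by (intro product_setting.intro product_setting_axioms.intro diagonal_complex.intro
        diagonal_complex_axioms.intro group_complex.intro group_complex_axioms.intro base_cring.intro
        group_automorphisms.intro group_automorphisms_axioms.intro)
  have gG: "g k \<in> carrier G" if "k \<in> {1..t}" for k
    using that \<open>g ` {1..t} \<subseteq> carrier G\<close> by blast
  note a = gG[OF \<open>i \<in> {1..t}\<close>] and b = gG[OF \<open>j \<in> {1..t}\<close>]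
  have DH: "x \<in> carrier H" if "x \<in> D" for x
    using that \<open>D \<subseteq> carrier H\<close> by blast
  show ?thesis
  proof (intro conjI ballI allI impI)
    fix x assume "x \<in> D"
    then have x: "x \<in> carrier H"
      by (rule DH)
    \<comment> \<open>As y acts by an automorphism, the equation for g k says that g k lies in the
      orbit of this element, in which y does not occur. Hence k is determined by x alone.\<close>
    let ?e = "g i \<otimes>\<^bsub>G\<^esub> \<phi> x (g j)"
    have e: "?e \<in> carrier G"
      by (intro S.G.m_closed S.phi_closed a b x)
    have "\<phi> y (g i) \<otimes>\<^bsub>G\<^esub> \<phi> (y \<otimes>\<^bsub>H\<^esub> x) (g j) = \<phi> y ?e" if "y \<in> carrier H" for y
      using that x a b by (simp add: S.phi_mult S.phi_comp)
    then have "(\<exists>y\<in>carrier H. g k = \<phi> y (g i) \<otimes>\<^bsub>G\<^esub> \<phi> (y \<otimes>\<^bsub>H\<^esub> x) (g j)) \<longleftrightarrow> g k \<in> orbit H \<phi> ?e" for k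
      by (auto simp: orbit_def)
    then show "\<exists>!k. k \<in> {1..t} \<and> (\<exists>y\<in>carrier H. g k = \<phi> y (g i) \<otimes>\<^bsub>G\<^esub> \<phi> (y \<otimes>\<^bsub>H\<^esub> x) (g j))"
      using S.orbit_representative[OF \<open>g ` {1..t} \<subseteq> carrier G\<close> _ e]
        \<open>bij_betw (\<lambda>k. orbit H \<phi> (g k)) {1..t} (orbits H (carrier G) \<phi>)\<close> by presburger
  next
    fix k y V
    assume kyV: "\<forall>x\<in>D. k x \<in> {1..t} \<and> y x \<in> carrier H \<and>
        g (k x) = \<phi> (y x) (g i) \<otimes>\<^bsub>G\<^esub> \<phi> (y x \<otimes>\<^bsub>H\<^esub> x) (g j) \<and>
        V x = conj_subgroup H (y x \<otimes>\<^bsub>H\<^esub> x) (St j) \<inter> conj_subgroup H (y x) (St i)"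
    then have k: "k x \<in> {1..t}" and y: "y x \<in> carrier H"
      and c: "g (k x) = \<phi> (y x) (g i) \<otimes>\<^bsub>G\<^esub> \<phi> (y x \<otimes>\<^bsub>H\<^esub> x) (g j)"
      and V: "V x = conj_subgroup H (y x \<otimes>\<^bsub>H\<^esub> x) (S.stab (g j)) \<inter> conj_subgroup H (y x) (S.stab (g i))"
      if "x \<in> D" for x
      using that by (simp_all add: St_def)
    have V_sub: "V x \<subseteq> S.stab (g (k x))" if "x \<in> D" for x
      unfolding V[OF that] c[OF that]
      by (intro S.conj_Int_subset_stab a b y S.H.m_closed DH that)
    \<comment> \<open>The groups U(x) of the decomposition are the stabilizers of g (k x), the
      targets of the inner corestrictions.\<close>
    have dc: "double_cosets H (S.stab (g i)) (S.stab (g j)) D y (\<lambda>x. S.stab (g (k x))) V"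
    proof (intro double_cosets.intro double_cosets_axioms.intro S.H.group_axioms S.stab_subgroup a b S.finite_H)
      show "\<exists>!x. x \<in> D \<and> h \<in> (S.stab (g i) #>\<^bsub>H\<^esub> x) <#>\<^bsub>H\<^esub> S.stab (g j)" if "h \<in> carrier H" for h
        using that \<open>\<forall>h\<in>carrier H. \<exists>!x. x \<in> D \<and> h \<in> (St i #>\<^bsub>H\<^esub> x) <#>\<^bsub>H\<^esub> St j\<close> by (simp add: St_def)
    qed (rule \<open>D \<subseteq> carrier H\<close> | erule y | erule V | erule V_sub | erule gG[OF k])+
    show "subgroup (V x) (H\<lparr>carrier := St (k x)\<rparr>)" if "x \<in> D" for x
      unfolding St_def
      by (rule S.H.subgroup_incl[OF double_cosets.V_subgroup[OF dc that]
            S.stab_subgroup[OF gG[OF k[OF that]]] V_sub[OF that]])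
    fix \<alpha> \<beta>
    assume \<alpha>: "\<alpha> \<in> carrier (tate_total R P (St i) triv)" and \<beta>: "\<beta> \<in> carrier (tate_total R P (St j) triv)"
    show "cup_ring R P \<Delta> (carrier H) RG (\<psi> i \<alpha>) (\<psi> j \<beta>) =
        (\<Oplus>\<^bsub>tate_total R P (carrier H) RG\<^esub>x\<in>D.
           \<psi> (k x) (cor R H P (St (k x)) (V x) triv
             (cup_ring R P \<Delta> (V x) triv
               (res R P (V x) triv (conj_map R H P (y x) (St i) triv \<alpha>))
               (res R P (V x) triv (conj_map R H P (y x \<otimes>\<^bsub>H\<^esub> x) (St j) triv \<beta>)))))"
      unfolding RG_def triv_def St_def \<psi>_def
      by (rule S.product_formula[OF a b dc c \<alpha>[unfolded St_def triv_def] \<beta>[unfolded St_def triv_def]])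
  qed
qed

end
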